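(* Let $\widehat\beta_n=(\widehat\beta_{n,A}^{T},\widehat\beta_{n,B}^{T})^{T}$ be the penalized estimator described in the context, where $\rho$ satisfies (R3): $\rho$ is twice continuously differentiable with $\psi=\rho'$ and $\psi'=\rho''$ bounded. Assume that: (H2) $w$ is a non-negative bounded function, with $\|w\|_\infty=1$, whose support $\mathcal{C}_w=\{x:w(x)>0\}$ satisfies $\mathbb{P}(x\in\mathcal{C}_w)>0$; (H3) $\mathbb{E}[w(x)\|x\|^2]<\infty$. Suppose that there exists some $\delta>0$ such that $$\sup_{\|\beta_A-\beta_{0,A}\|_2\le\delta}\|\nabla I_{\lambda_n}(\beta_A)\|_2=o\Big(\frac1{\sqrt n}\Big),$$ that $\mathbb{P}(\widehat\beta_{n,B}=0_{p-k})\to1$ and that $\widehat\beta_n\to\beta_0$ in probability. Let $\widetilde A$ and $\widetilde B$ be the $k\times k$ submatrices of $A$ and $B$, respectively, corresponding to the first $k$ coordinates. Then, if $\widetilde A$ is invertible, $$\sqrt n(\widehat\beta_{n,A}-\beta_{0,A})\ \text{ converges in distribution to }\ N_k(0,\widetilde A^{-1}\widetilde B\widetilde A^{-1}).$$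
   Context: Model: $p\ge1$ is fixed; $(y_i,x_i)$, $i\ge 1$, are i.i.d. copies of $(y,x)$ with $x\in\mathbb{R}^p$, $y\in\{0,1\}$ and $\mathbb{P}(y=1\mid x)=F(x^{T}\beta_0)$, where $F(t)=e^t/(1+e^t)$. The true parameter is $\beta_0=(\beta_{0,A}^{T},0_{p-k}^{T})^{T}\in\mathbb{R}^p$, where $\beta_{0,A}\in\mathbb{R}^k$, $k\ge1$, has all its coordinates non-zero. Any $\beta\in\mathbb{R}^p$ is written $\beta=(\beta_A^{T},\beta_B^{T})^{T}$ with $\beta_A\in\mathbb{R}^k$, $\beta_B\in\mathbb{R}^{p-k}$. Loss: $\rho:[0,\infty)\to\mathbb{R}$ is a bounded, differentiable, nondecreasing function with derivative $\psi=\rho'$, and $$\phi(y,t)=y\,\rho(-\log F(t))+(1-y)\,\rho(-\log(1-F(t)))+G(F(t))+G(1-F(t)),\qquad G(t)=\int_0^t\psi(-\log u)\,du .$$ With $\nu(t)=\psi(-\log F(t))[1-F(t)]+\psi(-\log[1-F(t)])F(t)$, define $$A=\mathbb{E}\big(F(x^{T}\beta_0)[1-F(x^{T}\beta_0)]\nu(x^{T}\beta_0)w(x)xx^{T}\big),\quad B=\mathbb{E}\big(F(x^{T}\beta_0)[1-F(x^{T}\beta_0)]\nu^2(x^{T}\beta_0)w^2(x)xx^{T}\big).$$ Weight: $w:\mathbb{R}^p\to[0,\infty)$ measurable. Penalty: for each tuning parameter $\lambda>0$, $I_\lambda:\mathbb{R}^p\to[0,\infty)$ is a penalty function; $\lambda_n>0$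 is the sequence of tuning parameters. For $\mathbf b\in\mathbb{R}^k$, $\nabla I_\lambda(\mathbf b)=\partial I_\lambda\big((\mathbf b^{T},0_{p-k}^{T})^{T}\big)/\partial\mathbf b$ (which is assumed to exist on the ball $\|\mathbf b-\beta_{0,A}\|_2\le\delta$ for $\lambda=\lambda_n$). Estimator: $L_n(\beta)=\frac1n\sum_{i=1}^n\phi(y_i,x_i^{T}\beta)\,w(x_i)$ and $\widehat\beta_n$ is a minimizer, $\widehat\beta_n=\operatorname{argmin}_{\beta\in\mathbb{R}^p}\{L_n(\beta)+I_{\lambda_n}(\beta)\}$. *)

theory Defs
  imports "HOL-Probability.Probability"
begin

text \<open>
  The active coordinates (the block A) are the range of an injection \<open>emb :: 'k \<Rightarrow> 'p\<close>
  between the index types of the vectors \<open>real ^ 'k\<close> and \<open>real ^ 'p\<close>; the remaining coordinates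
  (the block B) are those outside \<open>range emb\<close>.  Taking \<open>emb\<close> to be the inclusion of the first
  \<open>k\<close> indices gives the usual partition.  The block B may be empty (\<open>k = p\<close>).
\<close>

definition zero_pad :: "('k::finite \<Rightarrow> 'p::finite) \<Rightarrow> real ^ 'k \<Rightarrow> real ^ 'p" where
  "zero_pad emb b = (\<chi> j. if j \<in> range emb then b $ inv emb j else 0)"

definition blockA :: "('k::finite \<Rightarrow> 'p::finite) \<Rightarrow> real ^ 'p \<Rightarrow> real ^ 'k" where
  "blockA emb \<beta> = (\<chi> i. \<beta> $ emb i)"

definition submat :: "('k::finite \<Rightarrow> 'p::finite) \<Rightarrow> real ^ 'p ^ 'p \<Rightarrow> real ^ 'k ^ 'k" where
  "submat emb H = (\<chi> i j. H $ emb i $ emb j)"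

definition logistic :: "real \<Rightarrow> real" where
  "logistic t = exp t / (1 + exp t)"

definition corr_G :: "(real \<Rightarrow> real) \<Rightarrow> real \<Rightarrow> real" where
  "corr_G \<psi> t = integral {0..t} (\<lambda>u. \<psi> (- ln u))"

definition loss_phi :: "(real \<Rightarrow> real) \<Rightarrow> (real \<Rightarrow> real) \<Rightarrow> real \<Rightarrow> real \<Rightarrow> real" where
  "loss_phi \<rho> \<psi> y t =
     y * \<rho> (- ln (logistic t)) + (1 - y) * \<rho> (- ln (1 - logistic t))
     + corr_G \<psi> (logistic t) + corr_G \<psi> (1 - logistic t)"

definition nu :: "(real \<Rightarrow> real) \<Rightarrow> real \<Rightarrow> real" where
  "nu \<psi> t = \<psi> (- ln (logistic t)) * (1 - logistic t) + \<psi> (- ln (1 - logistic t)) * logistic t"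

definition emp_loss ::
  "(real \<Rightarrow> real) \<Rightarrow> (real \<Rightarrow> real) \<Rightarrow> (real ^ 'p::finite \<Rightarrow> real) \<Rightarrow>
   (nat \<Rightarrow> real) \<Rightarrow> (nat \<Rightarrow> real ^ 'p) \<Rightarrow> nat \<Rightarrow> real ^ 'p \<Rightarrow> real" where
  "emp_loss \<rho> \<psi> w ys xs n \<beta> = (1 / real n) * (\<Sum>i=1..n. loss_phi \<rho> \<psi> (ys i) (xs i \<bullet> \<beta>) * w (xs i))"

definition outer :: "real ^ 'p::finite \<Rightarrow> real ^ 'p ^ 'p" where
  "outer v = (\<chi> i j. v $ i * v $ j)"

definition mat_A ::
  "'a measure \<Rightarrow> ('a \<Rightarrow> real ^ 'p::finite) \<Rightarrow> (real \<Rightarrow> real) \<Rightarrow> (real ^ 'p \<Rightarrow> real) \<Rightarrow> real ^ 'p \<Rightarrow> real ^ 'p ^ 'p" where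
  "mat_A M x \<psi> w \<beta> =
     (\<integral>\<omega>. (logistic (x \<omega> \<bullet> \<beta>) * (1 - logistic (x \<omega> \<bullet> \<beta>)) * nu \<psi> (x \<omega> \<bullet> \<beta>) * w (x \<omega>))
            *\<^sub>R outer (x \<omega>) \<partial>M)"

definition mat_B ::
  "'a measure \<Rightarrow> ('a \<Rightarrow> real ^ 'p::finite) \<Rightarrow> (real \<Rightarrow> real) \<Rightarrow> (real ^ 'p \<Rightarrow> real) \<Rightarrow> real ^ 'p \<Rightarrow> real ^ 'p ^ 'p" where
  "mat_B M x \<psi> w \<beta> =
     (\<integral>\<omega>. (logistic (x \<omega> \<bullet> \<beta>) * (1 - logistic (x \<omega> \<bullet> \<beta>)) * (nu \<psi> (x \<omega> \<bullet> \<beta>))\<^sup>2 * (w (x \<omega>))\<^sup>2)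
            *\<^sub>R outer (x \<omega>) \<partial>M)"

text \<open>
  The gradient is the vector of partial derivatives; its existence only means that all partial
  derivatives exist (Frechet differentiability is not required).
\<close>

definition has_partials_at :: "(real ^ 'k::finite \<Rightarrow> real) \<Rightarrow> real ^ 'k \<Rightarrow> bool" where
  "has_partials_at f b \<longleftrightarrow> (\<forall>j. (\<lambda>s::real. f (b + s *\<^sub>R axis j 1)) differentiable (at 0))"

definition grad :: "(real ^ 'k::finite \<Rightarrow> real) \<Rightarrow> real ^ 'k \<Rightarrow> real ^ 'k" where
  "grad f b = (\<chi> j. deriv (\<lambda>s::real. f (b + s *\<^sub>R axis j 1)) 0)"

definition converges_in_prob ::
  "'a measure \<Rightarrow> (nat \<Rightarrow> 'a \<Rightarrow> 'b::metric_space) \<Rightarrow> 'b \<Rightarrow> bool" where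
  "converges_in_prob M X c \<longleftrightarrow>
     (\<forall>\<epsilon>>0. (\<lambda>n. measure M {\<omega> \<in> space M. dist (X n \<omega>) c > \<epsilon>}) \<longlonglongrightarrow> 0)"

definition converges_in_distr ::
  "'a measure \<Rightarrow> (nat \<Rightarrow> 'a \<Rightarrow> 'b::metric_space) \<Rightarrow> 'b measure \<Rightarrow> bool" where
  "converges_in_distr M X N \<longleftrightarrow>
     (\<forall>f::'b \<Rightarrow> real. continuous_on UNIV f \<longrightarrow> bounded (range f) \<longrightarrow>
        (\<lambda>n. \<integral>z. f z \<partial>(distr M borel (X n))) \<longlonglongrightarrow> (\<integral>z. f z \<partial>N))"

text \<open>
  The normal law with mean \<open>\<mu>\<close> and symmetric positive definite covariance \<open>\<Sigma>\<close>, given by its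
  Lebesgue density.  (For a singular \<open>\<Sigma>\<close> the definition below is meaningless.  In the theorem
  the covariance is always positive definite: with A and B the blocks of the two moment
  matrices, \<open>v \<bullet> (B *v v) = 0\<close> forces \<open>nu \<cdot> w \<cdot> (x \<bullet> v) = 0\<close> almost surely and hence \<open>A *v v = 0\<close>,
  so B is positive definite as soon as A is invertible.)
\<close>

definition mvn_density :: "real ^ 'k::finite \<Rightarrow> real ^ 'k ^ 'k \<Rightarrow> real ^ 'k \<Rightarrow> real" where
  "mvn_density \<mu> \<Sigma> z =
     exp (- ((z - \<mu>) \<bullet> (matrix_inv \<Sigma> *v (z - \<mu>))) / 2) / sqrt ((2 * pi) ^ CARD('k) * det \<Sigma>)"

definition mvn :: "real ^ 'k::finite \<Rightarrow> real ^ 'k ^ 'k \<Rightarrow> (real ^ 'k) measure" where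
  "mvn \<mu> \<Sigma> = density lborel (\<lambda>z. ennreal (mvn_density \<mu> \<Sigma> z))"

end

(*
  On the event that the B block of the estimator vanishes and the estimator is close to the true
  parameter, the first order conditions along the active coordinates hold, with a penalty gradient of
  size o(1/sqrt n).  Expanding the score around the true parameter gives
  sqrt n (betahat_A - beta0_A) = A^-1 n^-1/2 sum_i s(y_i, x_i) + o_P(1), where s is the negative score.
  The Hessian is controlled by the weak law of large numbers and, in place of a uniform law, by the
  modulus of continuity of the score derivative for covariates in a ball together with the smallness
  of the weighted second moment outside the ball.

  The sum is asymptotically normal by the univariate central limit theorem applied to every linear
  combination.  To pass from characteristic functions to weak convergence in R^k, both sides are
  convolved with a small Gaussian: the smoothed densities are Fourier integrals, hence converge
  pointwise, hence in L^1 by Scheffe's lemma, and the smoothing is harmless for uniformly continuous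
  test functions.  No tightness is needed for this step, and it yields tightness afterwards.
*)
theory Submission
  imports Defs
begin

section \<open>Linear changes of variables for Lebesgue measure\<close>

text \<open>Two obstacles shape the proof. The limit law \<open>mvn\<close> is given by a Lebesgue
  density, while the central limit theorem speaks through characteristic functions; the change of
  variables for linear maps, together with a factorization of the covariance as R R^T, connects the
  two. The second obstacle is that \<open>\<psi>'\<close> is merely continuous and bounded, that
  only a weighted second moment of the covariates is given, and that the estimator is consistent
  without a known rate. Hence the linearization error can be bounded only by a small multiple of the
  rescaled error itself, plus the penalty gradient. This error is absorbed: the multiple, times the
  norm bound of A^-1, is made at most 1/2, so that tightness of the normalized score sum bounds the
  rescaled error with high probability. Only then does the same inequality show that the rescaled
  error and the sum are close.\<close>

lemma prod_Basis_vec: "(\<Prod>b\<in>Basis. F b) = (\<Prod>i\<in>UNIV. F (axis i (1::real)))"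
proof -
  have B: "Basis = range (\<lambda>i. axis i (1::real))" by (auto simp: Basis_vec_def)
  show ?thesis unfolding B by (subst prod.reindex) (auto simp: inj_on_def axis_eq_axis)
qed

text \<open>Fubini in the product representation of Lebesgue measure, with coordinate
  \<open>e\<close> as the innermost variable, because a shear along \<open>e\<close> changes that
  coordinate alone.\<close>

lemma nn_integral_lborel_split_coordinate:
  fixes g :: "'a::euclidean_space \<Rightarrow> ennreal"
  assumes e: "e \<in> Basis" and [measurable]: "g \<in> borel_measurable borel"
  shows "(\<integral>\<^sup>+v. g v \<partial>lborel) =
    (\<integral>\<^sup>+f. (\<integral>\<^sup>+y. g ((\<Sum>b\<in>Basis - {e}. f b *\<^sub>R b) + y *\<^sub>R e) \<partial>lborel) \<partial>(\<Pi>\<^sub>M b\<in>Basis - {e}. lborel))"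
proof -
  interpret P: product_sigma_finite "\<lambda>_::'a. lborel :: real measure" ..
  have B: "Basis = insert e (Basis - {e})" using e by auto
  have m: "(\<lambda>f. \<Sum>b\<in>Basis. f b *\<^sub>R b :: 'a) \<in> (\<Pi>\<^sub>M b\<in>Basis. lborel) \<rightarrow>\<^sub>M borel"
    by measurable
  have "(\<integral>\<^sup>+v. g v \<partial>lborel) = (\<integral>\<^sup>+f. g (\<Sum>b\<in>Basis. f b *\<^sub>R b) \<partial>(\<Pi>\<^sub>M b\<in>Basis. lborel))"
    by (subst lborel_eq, subst nn_integral_distr) auto
  also have "\<dots> = (\<integral>\<^sup>+f. g (\<Sum>b\<in>Basis. f b *\<^sub>R b) \<partial>(\<Pi>\<^sub>M b\<in>insert e (Basis - {e}). lborel))"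
    using B by simp
  also have "\<dots> = (\<integral>\<^sup>+f. (\<integral>\<^sup>+y. g (\<Sum>b\<in>Basis. (f(e := y)) b *\<^sub>R b) \<partial>lborel) \<partial>(\<Pi>\<^sub>M b\<in>Basis - {e}. lborel))"
  proof (subst P.product_nn_integral_insert)
    show "(\<lambda>f. g (\<Sum>b\<in>Basis. f b *\<^sub>R b)) \<in> borel_measurable (\<Pi>\<^sub>M b\<in>insert e (Basis - {e}). lborel)"
      using m B by simp
  qed auto
  also have "\<dots> = (\<integral>\<^sup>+f. (\<integral>\<^sup>+y. g ((\<Sum>b\<in>Basis - {e}. f b *\<^sub>R b) + y *\<^sub>R e) \<partial>lborel) \<partial>(\<Pi>\<^sub>M b\<in>Basis - {e}. lborel))"
    by (intro nn_integral_cong arg_cong[where f=g]) (simp add: sum.remove[OF finite_Basis e] add.commute cong: if_cong)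
  finally show ?thesis .
qed

text \<open>With the other coordinates frozen, the shear is a translation of the coordinate along
  \<open>e\<close>: its amount does not depend on that coordinate since \<open>u\<close> is
  orthogonal to \<open>e\<close>. Translation invariance on the line then suffices.\<close>

lemma nn_integral_lborel_shear:
  fixes g :: "'a::euclidean_space \<Rightarrow> ennreal"
  assumes e: "e \<in> Basis" and u: "u \<bullet> e = 0" and [measurable]: "g \<in> borel_measurable borel"
  shows "(\<integral>\<^sup>+v. g (v + (v \<bullet> u) *\<^sub>R e) \<partial>lborel) = (\<integral>\<^sup>+v. g v \<partial>lborel)"
proof -
  have "(\<integral>\<^sup>+v. g (v + (v \<bullet> u) *\<^sub>R e) \<partial>lborel) =
    (\<integral>\<^sup>+f. (\<integral>\<^sup>+y. g ((\<Sum>b\<in>Basis - {e}. f b *\<^sub>R b) + (((\<Sum>b\<in>Basis - {e}. f b *\<^sub>R b) \<bullet> u) + 1 * y) *\<^sub>R e) \<partial>lborel) \<partial>(\<Pi>\<^sub>M b\<in>Basis - {e}. lborel))"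
    by (subst nn_integral_lborel_split_coordinate[OF e])
       (auto simp: inner_add_left inner_commute[of e u] u algebra_simps)
  also have "\<dots> = (\<integral>\<^sup>+f. (\<integral>\<^sup>+y. g ((\<Sum>b\<in>Basis - {e}. f b *\<^sub>R b) + y *\<^sub>R e) \<partial>lborel) \<partial>(\<Pi>\<^sub>M b\<in>Basis - {e}. lborel))"
  proof (rule nn_integral_cong)
    fix f :: "'a \<Rightarrow> real"
    let ?a = "\<Sum>b\<in>Basis - {e}. f b *\<^sub>R b"
    show "(\<integral>\<^sup>+y. g (?a + ((?a \<bullet> u) + 1 * y) *\<^sub>R e) \<partial>lborel) = (\<integral>\<^sup>+y. g (?a + y *\<^sub>R e) \<partial>lborel)"
      using nn_integral_real_affine[of "\<lambda>y. g (?a + y *\<^sub>R e)" 1 "?a \<bullet> u"] by simp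
  qed
  also have "\<dots> = (\<integral>\<^sup>+v. g v \<partial>lborel)"
    by (subst nn_integral_lborel_split_coordinate[OF e]) auto
  finally show ?thesis .
qed

text \<open>Boxes determine Lebesgue measure, and the preimage of a box is the box with permuted
  sides, whose volume is the same product in another order.\<close>

lemma nn_integral_lborel_permute:
  fixes g :: "real^'n::finite \<Rightarrow> ennreal" and p :: "'n \<Rightarrow> 'n"
  assumes p: "bij p" and [measurable]: "g \<in> borel_measurable borel"
  shows "(\<integral>\<^sup>+v. g (\<chi> i. v $ p i) \<partial>lborel) = (\<integral>\<^sup>+v. g v \<partial>lborel)"
proof -
  let ?h = "\<lambda>v::real^'n. (\<chi> i. v $ p i) :: real^'n"
  have lin: "linear ?h" by (rule linearI) (auto simp: vec_eq_iff)
  have [measurable]: "?h \<in> borel \<rightarrow>\<^sub>M borel"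
    by (intro borel_measurable_continuous_onI linear_continuous_on linear_conv_bounded_linear[THEN iffD1, OF lin])
  have "lborel = distr lborel borel ?h"
  proof (rule lborel_eqI)
    fix l u :: "real^'n" assume le: "\<And>b. b \<in> Basis \<Longrightarrow> l \<bullet> b \<le> u \<bullet> b"
    have le': "l $ i \<le> u $ i" for i using le[of "axis i 1"] by (simp add: axis_in_Basis_iff inner_axis)
    let ?q = "inv p"
    have pq: "p (?q i) = i" "?q (p i) = i" for i using p by (auto simp: bij_def surj_f_inv_f)
    have "?h -` box l u = box (\<chi> i. l $ ?q i) (\<chi> i. u $ ?q i)"
      unfolding mem_box_cart set_eq_iff vimage_def mem_Collect_eq using pq by (auto; metis)
    then have "emeasure (distr lborel borel ?h) (box l u) = emeasure lborel (box (\<chi> i. l $ ?q i) (\<chi> i. u $ ?q i))"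
      by (subst emeasure_distr) auto
    also have "\<dots> = (\<Prod>b\<in>Basis. ((\<chi> i. u $ ?q i) - (\<chi> i. l $ ?q i)) \<bullet> b)"
      using le' by (subst emeasure_lborel_box) (auto simp: Basis_vec_def inner_axis)
    also have "(\<Prod>b\<in>Basis. ((\<chi> i. u $ ?q i) - (\<chi> i. l $ ?q i)) \<bullet> b) = (\<Prod>i\<in>UNIV. u $ ?q i - l $ ?q i)"
      by (simp add: prod_Basis_vec inner_axis)
    also have "\<dots> = (\<Prod>i\<in>UNIV. u $ i - l $ i)"
      by (rule prod.reindex_bij_betw) (use p in \<open>simp add: bij_imp_bij_inv\<close>)
    also have "\<dots> = (\<Prod>b\<in>Basis. (u - l) \<bullet> b)"
      by (simp add: prod_Basis_vec inner_axis)
    finally show "emeasure (distr lborel borel ?h) (box l u) = (\<Prod>b\<in>Basis. (u - l) \<bullet> b)" .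
  qed simp
  then have "(\<integral>\<^sup>+v. g v \<partial>lborel) = (\<integral>\<^sup>+v. g v \<partial>distr lborel borel ?h)" by simp
  then show ?thesis by (simp add: nn_integral_distr)
qed

text \<open>Every linear map is a composite of elementary ones, and the formula passes to
  composites. Singular maps also occur in that induction, so \<open>?P\<close> asserts the formula
  only for nonzero determinant; a composite with nonzero determinant has factors of the same
  kind.\<close>

lemma nn_integral_lborel_linear:
  fixes f :: "real^'n::finite \<Rightarrow> real^'n" and g :: "real^'n \<Rightarrow> ennreal"
  assumes "linear f" "det (matrix f) \<noteq> 0" and g: "g \<in> borel_measurable borel"
  shows "(\<integral>\<^sup>+v. g v \<partial>lborel) = ennreal \<bar>det (matrix f)\<bar> * (\<integral>\<^sup>+v. g (f v) \<partial>lborel)"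
proof -
  let ?P = "\<lambda>f::real^'n \<Rightarrow> real^'n. linear f \<and> (det (matrix f) \<noteq> 0 \<longrightarrow> (\<forall>g. g \<in> borel_measurable borel \<longrightarrow>
     (\<integral>\<^sup>+v. g v \<partial>lborel) = ennreal \<bar>det (matrix f)\<bar> * (\<integral>\<^sup>+v. g (f v) \<partial>lborel)))"
  have meas: "f \<in> borel \<rightarrow>\<^sub>M borel" if "linear f" for f :: "real^'n \<Rightarrow> real^'n"
    by (intro borel_measurable_continuous_onI linear_continuous_on linear_conv_bounded_linear[THEN iffD1, OF that])
  have "?P f"
  proof (rule induct_linear_elementary[OF \<open>linear f\<close>])
    fix f h :: "real^'n \<Rightarrow> real^'n"
    assume l: "linear f" "linear h" and P: "?P f" "?P h"
    have M: "matrix (f \<circ> h) = matrix f ** matrix h" using matrix_compose[OF l(2,1)] by (simp add: o_def)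
    show "?P (f \<circ> h)"
    proof (intro conjI impI allI)
      show "linear (f \<circ> h)" using l by (rule linear_compose[rotated])
      fix g :: "real^'n \<Rightarrow> ennreal"
      assume d: "det (matrix (f \<circ> h)) \<noteq> 0" and g[measurable]: "g \<in> borel_measurable borel"
      have [measurable]: "f \<in> borel \<rightarrow>\<^sub>M borel" using meas[OF l(1)] .
      have "(\<integral>\<^sup>+v. g v \<partial>lborel) = ennreal \<bar>det (matrix f)\<bar> * (\<integral>\<^sup>+v. g (f v) \<partial>lborel)"
        using P(1)[THEN conjunct2, rule_format, OF _ g] d by (simp add: M det_mul)
      also have "(\<integral>\<^sup>+v. g (f v) \<partial>lborel) = ennreal \<bar>det (matrix h)\<bar> * (\<integral>\<^sup>+v. g (f (h v)) \<partial>lborel)"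
        using P(2)[THEN conjunct2, rule_format, of "\<lambda>v. g (f v)"] d by (simp add: M det_mul)
      finally show "(\<integral>\<^sup>+v. g v \<partial>lborel) = ennreal \<bar>det (matrix (f \<circ> h))\<bar> * (\<integral>\<^sup>+v. g ((f \<circ> h) v) \<partial>lborel)"
        by (simp only: M det_mul abs_mult o_apply ennreal_mult[OF abs_ge_zero abs_ge_zero] mult.assoc)
    qed
  next
    fix f :: "real^'n \<Rightarrow> real^'n" and i
    assume l: "linear f" and 0: "\<And>x. f x $ i = 0"
    then have "\<not> surj f"
      by (metis one_neq_zero surjE vec_component)
    then have "det (matrix f) = 0"
      using det_nz_iff_inj[OF l] linear_injective_imp_surjective[OF l] by blast
    then show "?P f" using l by simp
  next
    fix c :: "'n \<Rightarrow> real"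
    let ?h = "\<lambda>x::real^'n. \<chi> i. c i * x$i"
    have lin: "linear ?h" by (rule linearI) (auto simp: vec_eq_iff algebra_simps)
    have det: "det (matrix ?h) = prod c UNIV" by (simp add: axis_def matrix_def det_diagonal)
    show "?P ?h"
    proof (intro conjI lin impI allI)
      fix g :: "real^'n \<Rightarrow> ennreal"
      assume d: "det (matrix ?h) \<noteq> 0" and [measurable]: "g \<in> borel_measurable borel"
      have c: "c i \<noteq> 0" for i using d unfolding det by auto
      have [measurable]: "?h \<in> borel \<rightarrow>\<^sub>M borel" using meas[OF lin] .
      \<comment> \<open>\<open>lborel_affine_euclidean\<close> indexes the scaling factors by basis
        vectors, so \<open>c'\<close> reads the coordinate index back from a basis vector.\<close>
      define c' where "c' b = (THE i. b = axis i 1)" for b :: "real^'n"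
      have c': "c' (axis i 1) = i" for i by (auto simp: c'_def axis_eq_axis)
      have T: "(\<lambda>x. 0 + (\<Sum>j\<in>Basis. (c (c' j) * (x \<bullet> j)) *\<^sub>R j)) = ?h"
      proof
        fix x :: "real^'n"
        have "(\<Sum>j\<in>Basis. (c (c' j) * (x \<bullet> j)) *\<^sub>R j) \<bullet> axis i 1 = c i * x $ i" for i
          by (subst inner_sum_left_Basis) (auto simp: c' inner_axis axis_in_Basis_iff)
        then show "0 + (\<Sum>j\<in>Basis. (c (c' j) * (x \<bullet> j)) *\<^sub>R j) = ?h x"
          by (auto simp: vec_eq_iff inner_axis)
      qed
      have pr: "(\<Prod>j\<in>Basis. \<bar>c (c' j)\<bar>) = \<bar>prod c UNIV\<bar>"
        by (simp add: prod_Basis_vec c' abs_prod)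
      have L: "lborel = density (distr lborel borel ?h) (\<lambda>_. ennreal \<bar>prod c UNIV\<bar>)"
        using lborel_affine_euclidean[where c="\<lambda>j. c (c' j)" and t="0::real^'n"] c unfolding T pr by simp
      have "(\<integral>\<^sup>+v. g v \<partial>lborel) = (\<integral>\<^sup>+v. g v \<partial>density (distr lborel borel ?h) (\<lambda>_. ennreal \<bar>prod c UNIV\<bar>))"
        using L by simp
      also have "\<dots> = ennreal \<bar>prod c UNIV\<bar> * (\<integral>\<^sup>+v. g (?h v) \<partial>lborel)"
        by (subst nn_integral_density) (auto simp: nn_integral_cmult nn_integral_distr)
      finally show "(\<integral>\<^sup>+v. g v \<partial>lborel) = ennreal \<bar>det (matrix ?h)\<bar> * (\<integral>\<^sup>+v. g (?h v) \<partial>lborel)"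
        unfolding det .
    qed
  next
    fix m n :: 'n assume "m \<noteq> n"
    let ?h = "\<lambda>x::real^'n. \<chi> i. x $ Transposition.transpose m n i"
    have lin: "linear ?h" by (rule linearI) (auto simp: vec_eq_iff)
    have "(\<chi> i j. if Transposition.transpose m n i = j then 1 else 0) = (\<chi> i j. if j = Transposition.transpose m n i then 1 else (0::real))"
      by (auto simp: vec_eq_iff)
    then have "matrix ?h = transpose(\<chi> i j. mat 1 $ i $ Transposition.transpose m n j)"
      by (auto simp: matrix_eq transpose_def axis_def mat_def matrix_def)
    then have det: "\<bar>det (matrix ?h)\<bar> = 1"
      by (simp add: det_permute_columns permutes_swap_id sign_swap_id abs_mult)
    show "?P ?h"
      using nn_integral_lborel_permute[of "Transposition.transpose m n"] by (simp add: lin det)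
  next
    fix m n :: 'n assume mn: "m \<noteq> n"
    let ?h = "\<lambda>x::real^'n. \<chi> i. if i = m then x $ m + x $ n else x $ i"
    have h: "?h = (\<lambda>v. v + (v \<bullet> axis n 1) *\<^sub>R axis m 1)"
      by (simp add: fun_eq_iff vec_eq_iff inner_axis) (simp add: axis_def)
    have lin: "linear ?h" by (rule linearI) (auto simp: vec_eq_iff algebra_simps)
    have "matrix ?h = (\<chi> k. if k = m then row m (mat 1) + 1 *s row n (mat 1) else row k (mat 1))"
      using mn by (auto simp: vec_eq_iff matrix_def row_def mat_def axis_def)
    then have det: "det (matrix ?h) = 1"
      using det_row_operation[OF mn, where c=1 and A="mat 1 :: real^'n^'n"] by (simp only: det_I)
    show "?P ?h"
    proof (intro conjI lin impI allI)
      fix g :: "real^'n \<Rightarrow> ennreal" assume g: "g \<in> borel_measurable borel"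
      show "(\<integral>\<^sup>+v. g v \<partial>lborel) = ennreal \<bar>det (matrix ?h)\<bar> * (\<integral>\<^sup>+v. g (?h v) \<partial>lborel)"
        unfolding det unfolding h[THEN fun_cong]
        using nn_integral_lborel_shear[of "axis m 1" "axis n 1" g] mn g
        by (simp add: axis_in_Basis_iff inner_axis_axis)
    qed
  qed
  then show ?thesis using assms by simp
qed

section \<open>The standard Gaussian measure\<close>

text \<open>The product form reduces total mass and characteristic function to one dimension. The
  radial form in \<open>gauss_density_eq\<close> serves for linear substitutions and for recognizing
  the density as a multiple of its own Fourier transform.\<close>

definition gauss_density :: "'a::euclidean_space \<Rightarrow> real" where
  "gauss_density z = (\<Prod>b\<in>Basis. std_normal_density (z \<bullet> b))"

definition gauss :: "'a::euclidean_space measure" where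
  "gauss = density lborel (\<lambda>z. ennreal (gauss_density z))"

lemma norm_squared_eq_sum_Basis: "(norm (z::'a::euclidean_space))\<^sup>2 = (\<Sum>b\<in>Basis. (z \<bullet> b)\<^sup>2)"
  unfolding power2_norm_eq_inner by (subst euclidean_inner) (simp add: power2_eq_square)

lemma gauss_density_eq:
  "gauss_density (z::'a::euclidean_space) = exp (- (norm z)\<^sup>2 / 2) / sqrt (2 * pi) ^ DIM('a)"
proof -
  have "exp (- (norm z)\<^sup>2 / 2) = (\<Prod>b\<in>Basis. exp (- (z \<bullet> b)\<^sup>2 / 2))"
    by (simp add: norm_squared_eq_sum_Basis exp_sum[symmetric] sum_negf[symmetric] sum_divide_distrib del: sum_negf)
  then show ?thesis
    by (simp add: gauss_density_def std_normal_density_def prod.distrib prod_dividef power_one_over)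
qed

lemma gauss_density_nonneg [simp]: "0 \<le> gauss_density z"
  by (auto simp: gauss_density_def intro: prod_nonneg)

lemma gauss_density_measurable [measurable]: "gauss_density \<in> borel_measurable borel"
  unfolding gauss_density_def[abs_def] by measurable

lemma sets_gauss [simp, measurable_cong]: "sets gauss = sets borel"
  and space_gauss [simp]: "space gauss = UNIV"
  by (simp_all add: gauss_def)

lemma prob_space_gauss: "prob_space (gauss :: 'a::euclidean_space measure)"
proof
  have "emeasure gauss (space (gauss :: 'a measure)) = (\<integral>\<^sup>+z. ennreal (gauss_density z) \<partial>(lborel :: 'a measure))"
    by (simp add: gauss_def emeasure_density)
  also have "\<dots> = (\<integral>\<^sup>+z. (\<Prod>b\<in>Basis. ennreal (std_normal_density (z \<bullet> b))) \<partial>(lborel :: 'a measure))"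
    by (simp add: gauss_density_def prod_ennreal)
  also have "\<dots> = (\<Prod>b\<in>(Basis :: 'a set). (\<integral>\<^sup>+x. ennreal (std_normal_density x) \<partial>(lborel :: real measure)))"
    by (subst nn_integral_lborel_prod) auto
  also have "(\<integral>\<^sup>+x. ennreal (std_normal_density x) \<partial>(lborel :: real measure)) = 1"
    using prob_space.emeasure_space_1[OF prob_space_normal_density[of 1 0]] by (simp add: emeasure_density)
  finally show "emeasure gauss (space (gauss :: 'a measure)) = 1" by simp
qed

lemma integral_gauss:
  fixes f :: "'a::euclidean_space \<Rightarrow> 'b::{banach, second_countable_topology}"
  assumes [measurable]: "f \<in> borel_measurable borel"
  shows "integral\<^sup>L gauss f = (\<integral>z. gauss_density z *\<^sub>R f z \<partial>lborel)"
  unfolding gauss_def by (rule integral_density) auto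

text \<open>The integrand is a product of functions of single coordinates, so the integral factors
  into one-dimensional standard normal characteristic functions.\<close>

lemma char_gauss:
  "(\<integral>z. iexp (t \<bullet> z) \<partial>gauss) = complex_of_real (exp (- (norm (t::'a::euclidean_space))\<^sup>2 / 2))"
proof -
  interpret P: product_sigma_finite "\<lambda>_::'a. lborel :: real measure" ..
  let ?F = "\<lambda>b x. complex_of_real (std_normal_density x) * iexp ((t \<bullet> b) * x)"
  have std: "(\<integral>x. ?F b x \<partial>lborel) = complex_of_real (exp (- (t \<bullet> b)\<^sup>2 / 2))" for b
    using char_std_normal_distribution[THEN fun_cong, of "t \<bullet> b"] unfolding char_def
    by (subst (asm) integral_density) (auto simp: scaleR_conv_of_real)
  have int: "integrable lborel (?F b)" for b
  proof (rule Bochner_Integration.integrable_bound[OF integrable_std_normal_moment[of 0]])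
    show "AE x in lborel. norm (?F b x) \<le> norm (std_normal_density x * x ^ 0)"
      by (simp add: norm_mult)
  qed auto
  have "(\<integral>z. iexp (t \<bullet> z) \<partial>gauss) = (\<integral>z. gauss_density z *\<^sub>R iexp (t \<bullet> z) \<partial>lborel)"
    by (rule integral_gauss) auto
  also have "\<dots> = (\<integral>z. (\<Prod>b\<in>Basis. ?F b (z \<bullet> b)) \<partial>lborel)"
  proof (rule Bochner_Integration.integral_cong[OF refl])
    fix z :: 'a
    have "iexp (t \<bullet> z) = (\<Prod>b\<in>Basis. iexp ((t \<bullet> b) * (z \<bullet> b)))"
      by (subst euclidean_inner) (simp add: exp_sum[symmetric] sum_distrib_left)
    then show "gauss_density z *\<^sub>R iexp (t \<bullet> z) = (\<Prod>b\<in>Basis. ?F b (z \<bullet> b))"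
      by (simp add: gauss_density_def prod.distrib scaleR_conv_of_real)
  qed
  also have "\<dots> = (\<integral>f. (\<Prod>b\<in>Basis. ?F b ((\<Sum>c\<in>Basis. f c *\<^sub>R c) \<bullet> b)) \<partial>(\<Pi>\<^sub>M b\<in>Basis. lborel))"
    by (subst lborel_eq, subst integral_distr) auto
  also have "\<dots> = (\<integral>f. (\<Prod>b\<in>Basis. ?F b (f b)) \<partial>(\<Pi>\<^sub>M b\<in>Basis. lborel))"
    by (intro Bochner_Integration.integral_cong refl prod.cong) (simp add: inner_sum_left_Basis)
  also have "\<dots> = (\<Prod>b\<in>Basis. \<integral>x. ?F b x \<partial>lborel)"
    by (rule P.product_integral_prod) (use int in auto)
  also have "\<dots> = complex_of_real (\<Prod>b\<in>Basis. exp (- (t \<bullet> b)\<^sup>2 / 2))"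
    by (simp only: std of_real_prod)
  also have "(\<Prod>b\<in>Basis. exp (- (t \<bullet> b)\<^sup>2 / 2)) = exp (- (norm t)\<^sup>2 / 2)"
    by (simp add: norm_squared_eq_sum_Basis exp_sum[symmetric] sum_negf[symmetric] sum_divide_distrib del: sum_negf)
  finally show ?thesis .
qed

section \<open>Matrix inverses and factorization of positive definite matrices\<close>

lemma
  fixes A :: "real^'n::finite^'n"
  assumes "invertible A"
  shows matrix_inv_right: "A ** matrix_inv A = mat 1" and matrix_inv_left: "matrix_inv A ** A = mat 1"
  using someI_ex[OF assms[unfolded invertible_def]] by (auto simp: matrix_inv_def)

lemma matrix_inv_eqI:
  fixes A B :: "real^'n::finite^'n"
  assumes "A ** B = mat 1"
  shows "matrix_inv A = B"
proof -
  have "invertible A" using assms invertible_right_inverse by blast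
  then show ?thesis
    by (metis assms matrix_inv_left matrix_mul_assoc matrix_mul_lid matrix_mul_rid)
qed

text \<open>Gram-Schmidt for the inner product defined by \<open>S\<close>: if the rows of V form an
  orthonormal basis for this inner product, then V S V^T is the identity, and R = V^-1 is the
  required factor.\<close>

lemma posdef_factorization:
  fixes S :: "real^'n::finite^'n"
  assumes sym: "transpose S = S" and pd: "\<And>v. v \<noteq> 0 \<Longrightarrow> v \<bullet> (S *v v) > 0"
  obtains R :: "real^'n^'n" where "invertible R" "S = R ** transpose R"
proof -
  have symS: "u \<bullet> (S *v v) = v \<bullet> (S *v u)" for u v
    using sym by (metis dot_lmul_matrix inner_commute transpose_matrix_vector)
  define orth where "orth B \<longleftrightarrow> (\<forall>u\<in>B. \<forall>v\<in>B. u \<bullet> (S *v v) = (if u = v then 1 else 0))" for B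
  have "\<exists>B. finite B \<and> card B = m \<and> orth B" if "m \<le> CARD('n)" for m
    using that
  proof (induction m)
    case 0
    then show ?case by (intro exI[of _ "{}"]) (auto simp: orth_def)
  next
    case (Suc m)
    then obtain B where B: "finite B" "card B = m" "orth B" by auto
    let ?V = "(\<lambda>v. S *v v) ` B"
    have "dim (span ?V) \<le> card ?V"
      using B by (simp add: dim_le_card')
    also have "\<dots> \<le> m" using B card_image_le by blast
    finally have "dim ?V < DIM(real^'n)" using Suc.prems by simp
    \<comment> \<open>At most \<open>m\<close> vectors, fewer than the dimension, leave a nonzero
      vector orthogonal to all of them. Euclidean orthogonality to the images under \<open>S\<close>
      is orthogonality for the form \<open>S\<close>.\<close>
    then obtain x where x: "x \<noteq> 0" and o: "\<And>y. y \<in> span ?V \<Longrightarrow> orthogonal x y"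
      using orthogonal_to_subspace_exists[of ?V] by blast
    define c where "c = x \<bullet> (S *v x)"
    have c: "c > 0" using pd[OF x] by (simp add: c_def)
    define u where "u = (1 / sqrt c) *\<^sub>R x"
    have uu: "u \<bullet> (S *v u) = 1"
      using c by (simp add: u_def matrix_vector_mult_scaleR c_def[symmetric])
    have uB: "u \<bullet> (S *v v) = 0" if "v \<in> B" for v
      using o[OF span_base, of "S *v v"] that by (auto simp: u_def orthogonal_def)
    have Bu: "v \<bullet> (S *v u) = 0" if "v \<in> B" for v
      using uB[OF that] symS[of v u] by simp
    \<comment> \<open>The form is 1 on the pair (u, u) but 0 on (u, v) for every v in
      \<open>B\<close>, so the cardinality really grows.\<close>
    have "u \<notin> B" using uu uB by force
    moreover have "orth (insert u B)"
      using B(3) uu uB Bu unfolding orth_def by auto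
    ultimately show ?case using B by (intro exI[of _ "insert u B"]) auto
  qed
  then obtain B where B: "finite B" "card B = CARD('n)" "orth B" by blast
  then obtain f :: "'n \<Rightarrow> real^'n" where f: "bij_betw f UNIV B"
    using finite_same_card_bij[of "UNIV :: 'n set" B] by auto
  define V where "V = (\<chi> i. f i)"
  have inj: "f i = f j \<longleftrightarrow> i = j" and mem: "f i \<in> B" for i j
    using f by (auto simp: bij_betw_def inj_def)
  have "(V ** S ** transpose V) $ i $ j = f i \<bullet> (S *v f j)" for i j
  proof -
    have "(V ** S ** transpose V) $ i $ j = (\<Sum>k\<in>UNIV. \<Sum>l\<in>UNIV. f i $ l * S $ l $ k * f j $ k)"
      by (simp add: V_def matrix_matrix_mult_def transpose_def sum_distrib_right)
    also have "\<dots> = (\<Sum>l\<in>UNIV. \<Sum>k\<in>UNIV. f i $ l * S $ l $ k * f j $ k)"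
      by (rule sum.swap)
    also have "\<dots> = f i \<bullet> (S *v f j)"
      by (simp add: inner_vec_def matrix_vector_mult_def sum_distrib_left mult.assoc)
    finally show ?thesis .
  qed
  also have "f i \<bullet> (S *v f j) = mat 1 $ i $ j" for i j
    using B(3) mem inj by (auto simp: orth_def mat_def)
  finally have VSV: "V ** S ** transpose V = mat 1" by (simp add: vec_eq_iff)
  have iV: "invertible V" 
    using VSV by (metis invertible_right_inverse matrix_mul_assoc)
  define R where "R = matrix_inv V"
  have RV: "R ** V = mat 1" "V ** R = mat 1"
    using iV by (auto simp: R_def matrix_inv_left matrix_inv_right)
  have "transpose V ** transpose R = mat 1"
    using RV(1) by (metis matrix_transpose_mul transpose_mat)
  then have "R ** transpose R = R ** (V ** S ** transpose V) ** transpose R"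
    by (simp add: VSV)
  also have "\<dots> = (R ** V) ** S ** (transpose V ** transpose R)"
    by (simp add: matrix_mul_assoc)
  finally have "S = R ** transpose R"
    using RV \<open>transpose V ** transpose R = mat 1\<close> by simp
  moreover have "invertible R" using RV by (auto simp: invertible_def)
  ultimately show ?thesis using that by blast
qed

section \<open>The multivariate normal law\<close>

text \<open>Under the substitution z = R v the exponent becomes that of the standard Gaussian, and
  the root of det S is the absolute value of det R, which cancels the Jacobian.\<close>

lemma mvn_eq_distr_gauss:
  fixes S R :: "real^'k::finite^'k"
  assumes R: "invertible R" and S: "S = R ** transpose R"
  shows "mvn 0 S = distr gauss borel ((*v) R)"
proof (rule measure_eqI)
  have [measurable]: "(*v) R \<in> borel \<rightarrow>\<^sub>M borel"
    by (intro borel_measurable_continuous_onI linear_continuous_on) (simp add: linear_linear[symmetric])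
  let ?Q = "matrix_inv R"
  have Q: "?Q ** R = mat 1" "R ** ?Q = mat 1" using R by (auto simp: matrix_inv_left matrix_inv_right)
  have QT: "transpose R ** transpose ?Q = mat 1" "transpose ?Q ** transpose R = mat 1"
    using Q by (metis matrix_transpose_mul transpose_mat)+
  have detR: "det R \<noteq> 0" using R by (simp add: invertible_det_nz)
  have "S ** (transpose ?Q ** ?Q) = R ** (transpose R ** transpose ?Q) ** ?Q"
    unfolding S by (simp add: matrix_mul_assoc)
  then have S1: "S ** (transpose ?Q ** ?Q) = mat 1" by (simp add: QT Q)
  then have iS: "matrix_inv S = transpose ?Q ** ?Q"
    by (rule matrix_inv_eqI)
  have dens: "mvn_density 0 S (R *v v) = gauss_density v / \<bar>det R\<bar>" for v
  proof -
    have "matrix_inv S *v (R *v v) = transpose ?Q *v ((?Q ** R) *v v)"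
      by (simp add: iS matrix_vector_mul_assoc matrix_mul_assoc)
    also have "\<dots> = transpose ?Q *v v" by (simp add: Q)
    finally have "(R *v v) \<bullet> (matrix_inv S *v (R *v v)) = (R *v v) \<bullet> (transpose ?Q *v v)" by simp
    also have "\<dots> = v \<bullet> (transpose R *v (transpose ?Q *v v))"
      by (metis dot_lmul_matrix transpose_matrix_vector inner_commute)
    also have "\<dots> = (norm v)\<^sup>2"
      by (simp only: matrix_vector_mul_assoc QT power2_norm_eq_inner matrix_vector_mul_lid)
    finally have 1: "(R *v v) \<bullet> (matrix_inv S *v (R *v v)) = (norm v)\<^sup>2" .
    have "det S = (det R)\<^sup>2" by (simp add: S det_mul power2_eq_square)
    then have "sqrt ((2 * pi) ^ CARD('k) * det S) = sqrt (2 * pi) ^ CARD('k) * \<bar>det R\<bar>"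
      by (simp only: real_sqrt_mult[of _ "(det R)\<^sup>2"] real_sqrt_power[symmetric] real_sqrt_abs)
    then show ?thesis using 1 by (simp add: mvn_density_def gauss_density_eq)
  qed
  have "det S \<noteq> 0" by (simp add: S det_mul detR)
  then have m[measurable]: "mvn_density 0 S \<in> borel_measurable borel"
    unfolding mvn_density_def[abs_def]
    by (intro borel_measurable_continuous_onI continuous_intros linear_continuous_on)
       (simp_all add: linear_linear[symmetric] linear_continuous_on)
  fix A assume "A \<in> sets (mvn 0 S)"
  then have [measurable]: "A \<in> sets borel" by (simp add: mvn_def)
  have "emeasure (mvn 0 S) A = (\<integral>\<^sup>+z. ennreal (mvn_density 0 S z) * indicator A z \<partial>lborel)"
    unfolding mvn_def by (subst emeasure_density) auto
  also have "\<dots> = ennreal \<bar>det R\<bar> * (\<integral>\<^sup>+v. ennreal (mvn_density 0 S (R *v v)) * indicator A (R *v v) \<partial>lborel)"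
    by (subst nn_integral_lborel_linear[of "(*v) R"]) (auto simp: detR)
  also have "\<dots> = (\<integral>\<^sup>+v. ennreal \<bar>det R\<bar> * (ennreal (mvn_density 0 S (R *v v)) * indicator A (R *v v)) \<partial>lborel)"
    by (subst nn_integral_cmult) auto
  also have "\<dots> = (\<integral>\<^sup>+v. ennreal (gauss_density v) * indicator A (R *v v) \<partial>lborel)"
    using detR by (intro nn_integral_cong) (simp add: dens mult.assoc[symmetric] ennreal_mult[symmetric])
  also have "\<dots> = (\<integral>\<^sup>+v. indicator A (R *v v) \<partial>gauss)"
    unfolding gauss_def by (subst nn_integral_density) auto
  also have "\<dots> = emeasure (distr gauss borel ((*v) R)) A"
    by (simp add: nn_integral_distr nn_integral_indicator[symmetric] del: nn_integral_indicator)
  finally show "emeasure (mvn 0 S) A = emeasure (distr gauss borel ((*v) R)) A" .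
qed (simp add: mvn_def)

text \<open>Both facts are transported from \<open>gauss\<close> along a factor R of S. The factor
  disappears from the result because the squared norm of R^T t is t . S t.\<close>

lemma
  fixes S :: "real^'k::finite^'k"
  assumes sym: "transpose S = S" and pd: "\<And>v. v \<noteq> 0 \<Longrightarrow> v \<bullet> (S *v v) > 0"
  shows prob_space_mvn: "prob_space (mvn 0 S)"
    and char_mvn: "(\<integral>z. iexp (t \<bullet> z) \<partial>mvn 0 S) = complex_of_real (exp (- (t \<bullet> (S *v t)) / 2))"
proof -
  obtain R :: "real^'k^'k" where R: "invertible R" "S = R ** transpose R"
    using posdef_factorization[OF assms] by blast
  have m[measurable]: "(*v) R \<in> borel \<rightarrow>\<^sub>M borel"
    by (intro borel_measurable_continuous_onI linear_continuous_on) (simp add: linear_linear[symmetric])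
  interpret prob_space "gauss :: (real^'k) measure" by (rule prob_space_gauss)
  show "prob_space (mvn 0 S)"
    unfolding mvn_eq_distr_gauss[OF R] by (rule prob_space_distr) simp
  have tr: "t \<bullet> (R *v z) = (transpose R *v t) \<bullet> z" for z
    by (metis dot_lmul_matrix transpose_matrix_vector)
  have "(\<integral>z. iexp (t \<bullet> z) \<partial>mvn 0 S) = (\<integral>z. iexp ((transpose R *v t) \<bullet> z) \<partial>gauss)"
    unfolding mvn_eq_distr_gauss[OF R] by (subst integral_distr) (auto simp: tr)
  also have "\<dots> = complex_of_real (exp (- (norm (transpose R *v t))\<^sup>2 / 2))"
    by (rule char_gauss)
  also have "(norm (transpose R *v t))\<^sup>2 = t \<bullet> (S *v t)"
    unfolding power2_norm_eq_inner R(2) tr[symmetric] by (simp only: matrix_vector_mul_assoc)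
  finally show "(\<integral>z. iexp (t \<bullet> z) \<partial>mvn 0 S) = complex_of_real (exp (- (t \<bullet> (S *v t)) / 2))" .
qed

section \<open>Convergence of characteristic functions\<close>

text \<open>The density of x + s z for independent x of law \<open>\<mu>\<close> and z standard
  Gaussian, that is, of the convolution of \<open>\<mu>\<close> with a Gaussian of scale
  \<open>s\<close>.\<close>

definition smoothed_density :: "real \<Rightarrow> 'a::euclidean_space measure \<Rightarrow> 'a \<Rightarrow> real" where
  "smoothed_density s \<mu> y = (\<integral>x. gauss_density ((1/s) *\<^sub>R (y - x)) / s ^ DIM('a) \<partial>\<mu>)"

lemma integral_lborel_affine:
  fixes f :: "'a::euclidean_space \<Rightarrow> real"
  assumes s: "s > 0" and [measurable]: "f \<in> borel_measurable borel"
  shows "(\<integral>y. f y / s ^ DIM('a) \<partial>lborel) = (\<integral>z. f (x + s *\<^sub>R z) \<partial>lborel)"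
    and "integrable lborel (\<lambda>y. f y / s ^ DIM('a)) \<longleftrightarrow> integrable lborel (\<lambda>z. f (x + s *\<^sub>R z))"
proof -
  have L: "lborel = density (distr lborel borel (\<lambda>z. x + s *\<^sub>R z)) (\<lambda>_. ennreal (s ^ DIM('a)))"
    using lborel_affine[of s x] s by (simp add: ennreal_power)
  show "(\<integral>y. f y / s ^ DIM('a) \<partial>lborel) = (\<integral>z. f (x + s *\<^sub>R z) \<partial>lborel)"
    using s by (subst L, subst integral_density) (auto simp: integral_distr)
  show "integrable lborel (\<lambda>y. f y / s ^ DIM('a)) \<longleftrightarrow> integrable lborel (\<lambda>z. f (x + s *\<^sub>R z))"
    using s by (subst L, subst integrable_density) (auto simp: integrable_distr_eq)
qed

context
  fixes \<mu> :: "'a::euclidean_space measure" and s :: real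
  assumes \<mu>: "prob_space \<mu>" and sets\<mu>[measurable_cong]: "sets \<mu> = sets borel" and s: "s > 0"
begin

interpretation \<mu>: prob_space \<mu> by fact
interpretation \<gamma>: prob_space "gauss :: 'a measure" by (rule prob_space_gauss)
interpretation PL: pair_sigma_finite \<mu> "lborel :: 'a measure" ..
interpretation PG: pair_prob_space \<mu> "gauss :: 'a measure" ..

lemma integrable_gauss_density: "integrable lborel (gauss_density :: 'a \<Rightarrow> real)"
proof -
  have "integrable (gauss :: 'a measure) (\<lambda>_. 1 :: real)" by simp
  then show ?thesis unfolding gauss_def by (subst (asm) integrable_density) auto
qed

text \<open>The substitution y = x + s z turns the Gaussian integral into one against the kernel
  centred at x, and Fubini integrates the kernel over x first. The constant function 1 as
  \<open>g\<close> yields measurability, integrability and total mass of the smoothed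
  density.\<close>

lemma integral_gauss_smooth:
  fixes g :: "'a \<Rightarrow> real"
  assumes [measurable]: "g \<in> borel_measurable borel" and C: "\<And>x. \<bar>g x\<bar> \<le> C"
  shows "(\<integral>x. (\<integral>z. g (x + s *\<^sub>R z) \<partial>gauss) \<partial>\<mu>) = (\<integral>y. smoothed_density s \<mu> y * g y \<partial>lborel)"
    and "integrable lborel (\<lambda>y. smoothed_density s \<mu> y * g y)"
proof -
  let ?h = "\<lambda>x y. gauss_density ((1/s) *\<^sub>R (y - x)) * g y"
  have C0: "C \<ge> 0" using C[of 0] by linarith
  have h[measurable]: "(\<lambda>(x,y). ?h x y / s ^ DIM('a)) \<in> borel_measurable (\<mu> \<Otimes>\<^sub>M lborel)"
    by measurable
  have inth: "integrable lborel (\<lambda>z. gauss_density z * g (x + s *\<^sub>R z))" for x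
    by (rule Bochner_Integration.integrable_bound[OF integrable_mult_left[OF integrable_gauss_density, of C]])
       (auto simp: abs_mult intro!: mult_left_mono order_trans[OF C abs_ge_self])
  have inner: "(\<integral>z. g (x + s *\<^sub>R z) \<partial>gauss) = (\<integral>y. ?h x y / s ^ DIM('a) \<partial>lborel)" for x
    using integral_lborel_affine(1)[OF s, of "?h x" x] s by (simp add: integral_gauss)
  have int_in: "integrable lborel (\<lambda>y. ?h x y / s ^ DIM('a))" for x
    using integral_lborel_affine(2)[OF s, of "?h x" x] s inth by simp
  have int: "integrable (\<mu> \<Otimes>\<^sub>M lborel) (\<lambda>(x,y). ?h x y / s ^ DIM('a))"
  proof (rule PL.Fubini_integrable[OF h])
    have "(\<integral>y. norm (?h x y / s ^ DIM('a)) \<partial>lborel) = (\<integral>z. \<bar>g (x + s *\<^sub>R z)\<bar> \<partial>gauss)" for x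
      using integral_lborel_affine(1)[OF s, of "\<lambda>y. \<bar>?h x y\<bar>" x] s
      by (simp add: integral_gauss abs_mult)
    moreover have "integrable \<mu> (\<lambda>x. (\<integral>z. \<bar>g (x + s *\<^sub>R z)\<bar> \<partial>gauss))"
    proof (rule \<mu>.integrable_const_bound[of _ C])
      have "\<bar>\<integral>z. \<bar>g (x + s *\<^sub>R z)\<bar> \<partial>gauss\<bar> \<le> C" for x
      proof -
        have "(\<integral>z. \<bar>g (x + s *\<^sub>R z)\<bar> \<partial>gauss) \<le> (\<integral>z. C \<partial>(gauss :: 'a measure))"
          using C C0 by (intro integral_mono \<gamma>.integrable_const_bound[of _ C]) auto
        then show ?thesis by (simp add: \<gamma>.prob_space[unfolded space_gauss])
      qed
      then show "AE x in \<mu>. norm (\<integral>z. \<bar>g (x + s *\<^sub>R z)\<bar> \<partial>gauss) \<le> C" by simp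
      show "(\<lambda>x. \<integral>z. \<bar>g (x + s *\<^sub>R z)\<bar> \<partial>gauss) \<in> borel_measurable \<mu>"
        by measurable
    qed
    ultimately show "integrable \<mu> (\<lambda>x. \<integral>y. norm (case (x, y) of (x, y) \<Rightarrow> ?h x y / s ^ DIM('a)) \<partial>lborel)"
      by simp
    show "AE x in \<mu>. integrable lborel (\<lambda>y. case (x, y) of (x, y) \<Rightarrow> ?h x y / s ^ DIM('a))"
      using int_in by simp
  qed
  have pg: "(\<integral>x. ?h x y / s ^ DIM('a) \<partial>\<mu>) = smoothed_density s \<mu> y * g y" for y
    unfolding smoothed_density_def by (simp add: Bochner_Integration.integral_mult_left_zero[symmetric] algebra_simps del: Bochner_Integration.integral_mult_left_zero)
  show "(\<integral>x. (\<integral>z. g (x + s *\<^sub>R z) \<partial>gauss) \<partial>\<mu>) = (\<integral>y. smoothed_density s \<mu> y * g y \<partial>lborel)"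
    unfolding inner PL.Fubini_integral[OF int, symmetric] by (simp only: pg)
  show "integrable lborel (\<lambda>y. smoothed_density s \<mu> y * g y)"
    using PL.integrable_snd[OF int] by (simp only: pg)
qed

text \<open>The Gaussian kernel is itself a Fourier integral against \<open>gauss\<close> (fact
  \<open>q\<close>). Exchanging the integrals leaves \<open>\<mu>\<close> only inside its
  characteristic function, which is bounded and integrated against a probability measure; pointwise
  convergence of characteristic functions therefore passes to the density by dominated
  convergence.\<close>

lemma smoothed_density_char:
  "complex_of_real (smoothed_density s \<mu> y) =
     (\<integral>z. iexp ((1/s) *\<^sub>R y \<bullet> z) * (\<integral>x. iexp ((-1/s) *\<^sub>R z \<bullet> x) \<partial>\<mu>) \<partial>gauss) / (s * sqrt (2 * pi)) ^ DIM('a)"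
proof -
  let ?F = "\<lambda>x z. iexp ((1/s) *\<^sub>R (y - x) \<bullet> z)"
  have q: "complex_of_real (gauss_density u) = (\<integral>z. iexp (u \<bullet> z) \<partial>gauss) / sqrt (2 * pi) ^ DIM('a)" for u :: 'a
    by (simp add: char_gauss gauss_density_eq)
  have split: "?F x z = iexp ((1/s) *\<^sub>R y \<bullet> z) * iexp ((-1/s) *\<^sub>R z \<bullet> x)" for x z
    by (simp add: exp_add[symmetric] inner_diff_left inner_commute[of x z] algebra_simps diff_divide_distrib)
  have int: "integrable (\<mu> \<Otimes>\<^sub>M gauss) (\<lambda>(x, z). ?F x z)"
    by (rule PG.P.integrable_const_bound[of _ 1]) auto
  have "complex_of_real (smoothed_density s \<mu> y) = (\<integral>x. complex_of_real (gauss_density ((1/s) *\<^sub>R (y - x)) / s ^ DIM('a)) \<partial>\<mu>)"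
    unfolding smoothed_density_def by (rule integral_complex_of_real[symmetric])
  also have "\<dots> = (\<integral>x. (\<integral>z. ?F x z \<partial>gauss) / (s * sqrt (2 * pi)) ^ DIM('a) \<partial>\<mu>)"
    by (simp add: q power_mult_distrib mult.commute)
  also have "\<dots> = (\<integral>x. (\<integral>z. ?F x z \<partial>gauss) \<partial>\<mu>) / (s * sqrt (2 * pi)) ^ DIM('a)"
    by (rule integral_divide_zero)
  also have "(\<integral>x. (\<integral>z. ?F x z \<partial>gauss) \<partial>\<mu>) = (\<integral>z. (\<integral>x. ?F x z \<partial>\<mu>) \<partial>gauss)"
    by (rule PG.Fubini_integral[OF int, symmetric])
  also have "\<dots> = (\<integral>z. iexp ((1/s) *\<^sub>R y \<bullet> z) * (\<integral>x. iexp ((-1/s) *\<^sub>R z \<bullet> x) \<partial>\<mu>) \<partial>gauss)"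
    unfolding split by (intro Bochner_Integration.integral_cong refl integral_mult_right_zero)
  finally show ?thesis .
qed

lemma smoothed_density_nonneg: "smoothed_density s \<mu> y \<ge> 0"
  unfolding smoothed_density_def using s by (intro integral_nonneg_AE) auto

lemma smoothed_density_measurable: "smoothed_density s \<mu> \<in> borel_measurable lborel"
  using integral_gauss_smooth(2)[of "\<lambda>_. 1" 1] by auto

lemma nn_integral_smoothed_density: "(\<integral>\<^sup>+y. ennreal (smoothed_density s \<mu> y) \<partial>lborel) = 1"
proof -
  have "(\<integral>y. smoothed_density s \<mu> y \<partial>lborel) = 1"
    using integral_gauss_smooth(1)[of "\<lambda>_. 1" 1, symmetric] \<mu>.prob_space \<gamma>.prob_space by simp
  moreover have "integrable lborel (smoothed_density s \<mu>)"
    using integral_gauss_smooth(2)[of "\<lambda>_. 1" 1] by simp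
  ultimately show ?thesis
    by (subst nn_integral_eq_integral) (auto simp: smoothed_density_nonneg)
qed

text \<open>A shift shorter than \<open>d\<close> changes \<open>g\<close> by at most
  \<open>e\<close>; the remaining Gaussian mass is charged at most 2 C. The bound is the same for
  every \<open>\<mu>\<close>, which makes the smoothing error uniform along a sequence of
  laws.\<close>

lemma integral_gauss_smooth_diff:
  fixes g :: "'a \<Rightarrow> real"
  assumes [measurable]: "g \<in> borel_measurable borel" and C: "\<And>x. \<bar>g x\<bar> \<le> C"
    and d: "\<And>x y. dist x y < d \<Longrightarrow> \<bar>g x - g y\<bar> \<le> e" and e0: "e \<ge> 0"
  shows "\<bar>(\<integral>x. (\<integral>z. g (x + s *\<^sub>R z) \<partial>gauss) \<partial>\<mu>) - (\<integral>x. g x \<partial>\<mu>)\<bar>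
     \<le> e + 2 * C * measure gauss {z::'a. norm z \<ge> d / s}"
proof -
  let ?B = "{z::'a. norm z \<ge> d / s}"
  have [measurable]: "?B \<in> sets borel" by measurable
  have C0: "C \<ge> 0" using C[of 0] by linarith
  have ptw: "\<bar>(\<integral>z. g (x + s *\<^sub>R z) \<partial>gauss) - g x\<bar> \<le> e + 2 * C * measure gauss ?B" for x
  proof -
    have i: "integrable gauss (\<lambda>z. g (x + s *\<^sub>R z))"
      using C by (intro \<gamma>.integrable_const_bound[of _ C]) auto
    have "(\<integral>z. g (x + s *\<^sub>R z) \<partial>gauss) - g x = (\<integral>z. g (x + s *\<^sub>R z) - g x \<partial>gauss)"
      using i \<gamma>.prob_space by simp
    also have "\<bar>\<dots>\<bar> \<le> (\<integral>z. \<bar>g (x + s *\<^sub>R z) - g x\<bar> \<partial>gauss)"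
      by (rule integral_abs_bound)
    also have "\<dots> \<le> (\<integral>z. e + 2 * C * indicator ?B z \<partial>gauss)"
    proof (rule integral_mono)
      show "integrable gauss (\<lambda>z. \<bar>g (x + s *\<^sub>R z) - g x\<bar>)" using i by auto
      show "integrable gauss (\<lambda>z. e + 2 * C * indicator ?B z)" by (auto simp: less_top[symmetric])
      fix z :: 'a
      show "\<bar>g (x + s *\<^sub>R z) - g x\<bar> \<le> e + 2 * C * indicator ?B z"
      proof (cases "z \<in> ?B")
        case True
        show ?thesis using e0 True C[of x] C[of "x + s *\<^sub>R z"] by auto
      next
        case False
        then have "dist (x + s *\<^sub>R z) x < d" using s by (simp add: field_simps not_le dist_norm)
        then show ?thesis using False d by simp
      qed
    qed
    also have "\<dots> = e + 2 * C * measure gauss ?B"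
      using \<gamma>.prob_space by (subst Bochner_Integration.integral_add) (auto simp: less_top[symmetric])
    finally show ?thesis .
  qed
  have i1: "integrable \<mu> g" using C by (intro \<mu>.integrable_const_bound[of _ C]) auto
  have b: "\<bar>\<integral>z. g (x + s *\<^sub>R z) \<partial>gauss\<bar> \<le> C + (e + 2 * C * measure gauss ?B)" for x
    using ptw[of x] C[of x] by linarith
  have i2: "integrable \<mu> (\<lambda>x. \<integral>z. g (x + s *\<^sub>R z) \<partial>gauss)"
    using b by (intro \<mu>.integrable_const_bound) auto
  have "\<bar>(\<integral>x. (\<integral>z. g (x + s *\<^sub>R z) \<partial>gauss) \<partial>\<mu>) - (\<integral>x. g x \<partial>\<mu>)\<bar> = \<bar>\<integral>x. (\<integral>z. g (x + s *\<^sub>R z) \<partial>gauss) - g x \<partial>\<mu>\<bar>"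
    using i1 i2 by simp
  also have "\<dots> \<le> (\<integral>x. \<bar>(\<integral>z. g (x + s *\<^sub>R z) \<partial>gauss) - g x\<bar> \<partial>\<mu>)"
    by (rule integral_abs_bound)
  also have "\<dots> \<le> (\<integral>x. e + 2 * C * measure gauss ?B \<partial>\<mu>)"
    using i1 i2 ptw by (intro integral_mono) auto
  also have "\<dots> = e + 2 * C * measure gauss ?B" using \<mu>.prob_space by simp
  finally show ?thesis .
qed

end

lemma char_tendsto_imp_integral_uniformly_continuous:
  fixes \<mu> :: "nat \<Rightarrow> 'a::euclidean_space measure" and N :: "'a measure" and g :: "'a \<Rightarrow> real"
  assumes P: "\<And>n. prob_space (\<mu> n)" "prob_space N"
    and sets[measurable_cong]: "\<And>n. sets (\<mu> n) = sets borel" "sets N = sets borel"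
    and char: "\<And>t. (\<lambda>n. \<integral>x. iexp (t \<bullet> x) \<partial>\<mu> n) \<longlonglongrightarrow> (\<integral>x. iexp (t \<bullet> x) \<partial>N)"
    and uc: "uniformly_continuous_on UNIV g" and bd: "bounded (range g)"
  shows "(\<lambda>n. \<integral>x. g x \<partial>\<mu> n) \<longlonglongrightarrow> (\<integral>x. g x \<partial>N)"
proof -
  have gm[measurable]: "g \<in> borel_measurable borel"
    using uniformly_continuous_imp_continuous[OF uc] by (rule borel_measurable_continuous_onI)
  obtain C where C: "\<And>x. \<bar>g x\<bar> \<le> C" using bd by (auto simp: bounded_iff)
  interpret \<gamma>: prob_space "gauss :: 'a measure" by (rule prob_space_gauss)
  have smooth: "(\<lambda>n. \<integral>x. (\<integral>z. g (x + s *\<^sub>R z) \<partial>gauss) \<partial>\<mu> n) \<longlonglongrightarrow> (\<integral>x. (\<integral>z. g (x + s *\<^sub>R z) \<partial>gauss) \<partial>N)"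
    if s: "s > 0" for s
  proof -
    let ?p = "\<lambda>n. smoothed_density s (\<mu> n)" and ?q = "smoothed_density s N"
    have [measurable]: "?p n \<in> borel_measurable lborel" "?q \<in> borel_measurable lborel" for n
      by (intro smoothed_density_measurable P sets s)+
    have intq: "integrable lborel ?q"
      using integral_gauss_smooth(2)[OF P(2) sets(2) s, of "\<lambda>_. 1" 1] by simp
    have conv: "(\<lambda>n. ?p n y) \<longlonglongrightarrow> ?q y" for y
    proof -
      have "(\<lambda>n. \<integral>z. iexp ((1/s) *\<^sub>R y \<bullet> z) * (\<integral>x. iexp ((-1/s) *\<^sub>R z \<bullet> x) \<partial>\<mu> n) \<partial>gauss)
        \<longlonglongrightarrow> (\<integral>z. iexp ((1/s) *\<^sub>R y \<bullet> z) * (\<integral>x. iexp ((-1/s) *\<^sub>R z \<bullet> x) \<partial>N) \<partial>gauss)"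
      proof (rule integral_dominated_convergence[where w="\<lambda>_. 1"])
        interpret N: prob_space N by fact
        interpret PN: pair_prob_space "gauss :: 'a measure" N ..
        show "(\<lambda>z. iexp ((1/s) *\<^sub>R y \<bullet> z) * (\<integral>x. iexp ((-1/s) *\<^sub>R z \<bullet> x) \<partial>N)) \<in> borel_measurable gauss"
          by measurable
      next
        fix n
        interpret N: prob_space "\<mu> n" by (rule P)
        interpret PN: pair_prob_space "gauss :: 'a measure" "\<mu> n" ..
        show "(\<lambda>z. iexp ((1/s) *\<^sub>R y \<bullet> z) * (\<integral>x. iexp ((-1/s) *\<^sub>R z \<bullet> x) \<partial>\<mu> n)) \<in> borel_measurable gauss"
          by measurable
        have "norm (\<integral>x. iexp ((-1/s) *\<^sub>R z \<bullet> x) \<partial>\<mu> n) \<le> 1" for z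
        proof -
          have "norm (\<integral>x. iexp ((-1/s) *\<^sub>R z \<bullet> x) \<partial>\<mu> n) \<le> (\<integral>x. norm (iexp ((-1/s) *\<^sub>R z \<bullet> x)) \<partial>\<mu> n)"
            by (rule integral_norm_bound)
          also have "\<dots> = 1" using N.prob_space by simp
          finally show ?thesis .
        qed
        then show "AE z in gauss. norm (iexp ((1/s) *\<^sub>R y \<bullet> z) * (\<integral>x. iexp ((-1/s) *\<^sub>R z \<bullet> x) \<partial>\<mu> n)) \<le> 1"
          by (simp add: norm_mult)
      qed (simp, intro AE_I2 tendsto_mult tendsto_const char)
      then have "(\<lambda>n. complex_of_real (?p n y)) \<longlonglongrightarrow> complex_of_real (?q y)"
        unfolding smoothed_density_char[OF P(1) sets(1) s] smoothed_density_char[OF P(2) sets(2) s]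
        using s by (intro tendsto_divide) auto
      then show ?thesis by (simp add: tendsto_of_real_iff)
    qed
    \<comment> \<open>Scheffe's lemma upgrades pointwise to L^1 convergence as long as no mass
      exceeds that of the limit; here all masses equal 1.\<close>
    have "(\<lambda>n. \<integral>\<^sup>+y. norm (?p n y - ?q y) \<partial>lborel) \<longlonglongrightarrow> 0"
    proof (rule Scheffe_lemma2[OF _ intq])
      show "(\<integral>\<^sup>+y. norm (?p n y) \<partial>lborel) \<le> (\<integral>\<^sup>+y. norm (?q y) \<partial>lborel)" for n
        using nn_integral_smoothed_density[OF P(1) sets(1) s] nn_integral_smoothed_density[OF P(2) sets(2) s]
        by (simp add: smoothed_density_nonneg[OF P(1) sets(1) s] smoothed_density_nonneg[OF P(2) sets(2) s])
    qed (use conv in auto)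
    moreover have int_pq: "integrable lborel (\<lambda>y. ?p n y - ?q y)" for n
      using intq integral_gauss_smooth(2)[OF P(1) sets(1) s, of "\<lambda>_. 1" 1] by simp
    ultimately have L1: "(\<lambda>n. \<integral>y. \<bar>?p n y - ?q y\<bar> \<partial>lborel) \<longlonglongrightarrow> 0"
      by (subst (asm) nn_integral_eq_integral) (auto simp: ennreal_0[symmetric] simp del: ennreal_0)
    show ?thesis
    proof (rule Lim_transform2[OF tendsto_const], rule Lim_null_comparison)
      show "(\<lambda>n. C * (\<integral>y. \<bar>?p n y - ?q y\<bar> \<partial>lborel)) \<longlonglongrightarrow> 0"
        using tendsto_mult_left[OF L1, of C] by simp
      show "\<forall>\<^sub>F n in sequentially. norm ((\<integral>x. (\<integral>z. g (x + s *\<^sub>R z) \<partial>gauss) \<partial>N) - (\<integral>x. (\<integral>z. g (x + s *\<^sub>R z) \<partial>gauss) \<partial>\<mu> n))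
        \<le> C * (\<integral>y. \<bar>?p n y - ?q y\<bar> \<partial>lborel)"
      proof (intro always_eventually allI)
        fix n
        note ig = integral_gauss_smooth[OF P(1) sets(1) s gm C] integral_gauss_smooth[OF P(2) sets(2) s gm C]
        have "norm ((\<integral>x. (\<integral>z. g (x + s *\<^sub>R z) \<partial>gauss) \<partial>N) - (\<integral>x. (\<integral>z. g (x + s *\<^sub>R z) \<partial>gauss) \<partial>\<mu> n))
          = \<bar>\<integral>y. ?q y * g y - ?p n y * g y \<partial>lborel\<bar>"
          unfolding ig(1) ig(3) using ig(2)[of n] ig(4) by simp
        also have "\<dots> \<le> (\<integral>y. \<bar>?q y * g y - ?p n y * g y\<bar> \<partial>lborel)"
          by (rule integral_abs_bound)
        also have "\<dots> \<le> (\<integral>y. C * \<bar>?p n y - ?q y\<bar> \<partial>lborel)"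
        proof (rule integral_mono)
          show "integrable lborel (\<lambda>y. \<bar>?q y * g y - ?p n y * g y\<bar>)" using ig(2)[of n] ig(4) by auto
          show "integrable lborel (\<lambda>y. C * \<bar>?p n y - ?q y\<bar>)" using int_pq[of n] by auto
          fix y
          have "\<bar>?q y * g y - ?p n y * g y\<bar> = \<bar>g y\<bar> * \<bar>?p n y - ?q y\<bar>"
            by (simp add: abs_mult[symmetric] algebra_simps abs_minus_commute)
          then show "\<bar>?q y * g y - ?p n y * g y\<bar> \<le> C * \<bar>?p n y - ?q y\<bar>"
            using C[of y] by (simp add: mult_right_mono)
        qed
        finally show "norm ((\<integral>x. (\<integral>z. g (x + s *\<^sub>R z) \<partial>gauss) \<partial>N) - (\<integral>x. (\<integral>z. g (x + s *\<^sub>R z) \<partial>gauss) \<partial>\<mu> n))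
          \<le> C * (\<integral>y. \<bar>?p n y - ?q y\<bar> \<partial>lborel)" by simp
      qed
    qed
  qed
  show ?thesis
  proof (rule LIMSEQ_I)
    fix r :: real assume r: "r > 0"
    \<comment> \<open>Two smoothing errors below 2 e each and one convergence error below e add up
      to less than 5 e, which is below r.\<close>
    define e where "e = r / 8"
    have e: "e > 0" using r by (simp add: e_def)
    obtain d where d: "d > 0" "\<And>x y. dist x y < d \<Longrightarrow> \<bar>g x - g y\<bar> \<le> e"
      using uc e unfolding uniformly_continuous_on_def dist_real_def by (meson UNIV_I less_imp_le)
    have "(\<lambda>k. measure gauss {z::'a. norm z \<ge> real k}) \<longlonglongrightarrow> measure gauss (\<Inter>k. {z::'a. norm z \<ge> real k})"
      by (rule \<gamma>.finite_Lim_measure_decseq) (auto simp: decseq_def)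
    moreover have "(\<Inter>k. {z::'a. norm z \<ge> real k}) = {}"
    proof -
      have "\<exists>k. norm z < real k" for z :: 'a by (rule reals_Archimedean2)
      then show ?thesis by (auto simp flip: not_less)
    qed
    ultimately have "(\<lambda>k. 2 * C * measure gauss {z::'a. norm z \<ge> real k}) \<longlonglongrightarrow> 0"
      using tendsto_mult_left[of _ 0 _ "2 * C"] by simp
    then have "\<forall>\<^sub>F k in sequentially. 2 * C * measure gauss {z::'a. norm z \<ge> real k} < e"
      using e by (rule order_tendstoD)
    then obtain k where k: "2 * C * measure gauss {z::'a. norm z \<ge> real k} < e" "k > 0"
      by (metis (mono_tags, lifting) eventually_conj eventually_gt_at_top eventually_happens trivial_limit_sequentially)
    \<comment> \<open>Chosen so that d / s = k, the radius beyond which the Gaussian mass was just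
      made small.\<close>
    define s where "s = d / real k"
    have s: "s > 0" "d / s = real k" using d(1) k(2) by (auto simp: s_def)
    have near: "\<bar>(\<integral>x. (\<integral>z. g (x + s *\<^sub>R z) \<partial>gauss) \<partial>L) - (\<integral>x. g x \<partial>L)\<bar> < 2 * e"
      if "prob_space L" "sets L = sets borel" for L
      using integral_gauss_smooth_diff[OF that s(1) gm C, of d e, OF d(2)] e k(1) unfolding s(2) by linarith
    obtain n0 where n0: "\<And>n. n \<ge> n0 \<Longrightarrow> \<bar>(\<integral>x. (\<integral>z. g (x + s *\<^sub>R z) \<partial>gauss) \<partial>\<mu> n) - (\<integral>x. (\<integral>z. g (x + s *\<^sub>R z) \<partial>gauss) \<partial>N)\<bar> < e"
      using LIMSEQ_D[OF smooth[OF s(1)] e] by auto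
    have "norm ((\<integral>x. g x \<partial>\<mu> n) - (\<integral>x. g x \<partial>N)) < r" if "n \<ge> n0" for n
      using n0[OF that] near[OF P(1) sets(1), of n] near[OF P(2) sets(2)] e e_def
      unfolding real_norm_def by linarith
    then show "\<exists>n0. \<forall>n\<ge>n0. norm ((\<integral>x. g x \<partial>\<mu> n) - (\<integral>x. g x \<partial>N)) < r" by blast
  qed
qed

section \<open>Weak convergence\<close>

text \<open>A continuous stand-in for the indicator of a ball. A continuous function times the
  cutoff has compact support, hence is an admissible uniformly continuous test function.\<close>

definition cutoff :: "real \<Rightarrow> 'a::real_normed_vector \<Rightarrow> real" where
  "cutoff R x = max 0 (min 1 (R + 1 - norm x))"

lemma cutoff_bounds: "0 \<le> cutoff R x" "cutoff R x \<le> 1"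
  and cutoff_eq_1: "norm x \<le> R \<Longrightarrow> cutoff R x = 1"
  and cutoff_eq_0: "norm x \<ge> R + 1 \<Longrightarrow> cutoff R x = 0"
  by (auto simp: cutoff_def)

lemma abs_cutoff_le [simp]: "\<bar>cutoff R x\<bar> \<le> 1" "\<bar>1 - cutoff R x\<bar> \<le> 1"
  by (auto simp: cutoff_def)

lemma continuous_on_cutoff [continuous_intros]: "continuous_on S (cutoff R)"
  unfolding cutoff_def[abs_def] by (intro continuous_intros)

lemma cutoff_measurable [measurable]: "cutoff R \<in> borel_measurable borel"
  by (intro borel_measurable_continuous_onI continuous_intros)

text \<open>On the compact ball of radius R + 2 continuity is uniform. Two points at distance below
  1 either both lie in that ball or both lie where the cutoff vanishes.\<close>

lemma uniformly_continuous_on_mult_cutoff: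
  fixes f :: "'a::euclidean_space \<Rightarrow> real"
  assumes f: "continuous_on UNIV f"
  shows "uniformly_continuous_on UNIV (\<lambda>x. f x * cutoff R x)"
proof -
  let ?g = "\<lambda>x. f x * cutoff R x"
  have "uniformly_continuous_on (cball 0 (R + 2)) ?g"
    by (intro compact_uniformly_continuous continuous_intros continuous_on_subset[OF f]) auto
  then have uc: "\<exists>d>0. \<forall>x\<in>cball 0 (R+2). \<forall>y\<in>cball 0 (R+2). dist y x < d \<longrightarrow> dist (?g y) (?g x) < e" if "e > 0" for e
    using that unfolding uniformly_continuous_on_def by blast
  show ?thesis unfolding uniformly_continuous_on_def
  proof (intro allI impI)
    fix e :: real assume e: "e > 0"
    obtain d where d: "d > 0" "\<And>x y. x \<in> cball 0 (R+2) \<Longrightarrow> y \<in> cball 0 (R+2) \<Longrightarrow> dist y x < d \<Longrightarrow> dist (?g y) (?g x) < e"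
      using uc[OF e] by blast
    have "dist (?g y) (?g x) < e" if xy: "dist y x < min d 1" for x y
    proof (cases "norm x \<le> R + 1 \<or> norm y \<le> R + 1")
      case True
      have "norm x \<le> norm y + dist y x" "norm y \<le> norm x + dist y x"
        by (metis add.commute dist_commute dist_norm norm_triangle_sub)+
      then show ?thesis using True xy by (intro d(2)) auto
    next
      case False
      then show ?thesis using e by (simp add: cutoff_eq_0)
    qed
    then show "\<exists>d>0. \<forall>x\<in>UNIV. \<forall>x'\<in>UNIV. dist x' x < d \<longrightarrow> dist (?g x') (?g x) < e"
      using d(1) by (intro exI[of _ "min d 1"]) auto
  qed
qed

lemma exists_cutoff_tail_small:
  fixes N :: "'a::euclidean_space measure"
  assumes "prob_space N" and sets[measurable_cong]: "sets N = sets borel" and e: "e > 0"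
  shows "\<exists>R>0. (\<integral>x. 1 - cutoff R x \<partial>N) < e"
proof -
  interpret prob_space N by fact
  have "(\<lambda>k. \<integral>x. 1 - cutoff (real k) x \<partial>N) \<longlonglongrightarrow> (\<integral>x. 0 \<partial>N)"
  proof (rule integral_dominated_convergence[where w="\<lambda>_. 1"])
    show "AE x in N. (\<lambda>k. 1 - cutoff (real k) x) \<longlonglongrightarrow> 0"
    proof (rule AE_I2)
      fix x
      obtain k0 where "norm x < real k0" using reals_Archimedean2 by blast
      then have "\<forall>\<^sub>F k in sequentially. 1 - cutoff (real k) x = 0"
        by (intro eventually_sequentiallyI[of k0]) (auto intro!: cutoff_eq_1)
      then show "(\<lambda>k. 1 - cutoff (real k) x) \<longlonglongrightarrow> 0" by (rule tendsto_eventually)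
    qed
  qed auto
  then have "\<forall>\<^sub>F k in sequentially. (\<integral>x. 1 - cutoff (real k) x \<partial>N) < e"
    using e by (intro order_tendstoD) auto
  then obtain k where "(\<integral>x. 1 - cutoff (real k) x \<partial>N) < e" "k > 0"
    by (metis (mono_tags, lifting) eventually_conj eventually_gt_at_top eventually_happens trivial_limit_sequentially)
  then show ?thesis by (intro exI[of _ "real k"]) auto
qed

text \<open>The cutoff is itself a test function covered by \<open>conv\<close>, so the mass that it
  misses under \<open>\<mu> n\<close> converges to the small mass that it misses under the limit.
  Replacing \<open>f\<close> by its product with the cutoff is then cheap along the whole tail of
  the sequence.\<close>

lemma uniformly_continuous_imp_bounded_continuous_convergence:
  fixes \<mu> :: "nat \<Rightarrow> 'a::euclidean_space measure" and f :: "'a \<Rightarrow> real"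
  assumes P: "\<And>n. prob_space (\<mu> n)" "prob_space N"
    and sets[measurable_cong]: "\<And>n. sets (\<mu> n) = sets borel" "sets N = sets borel"
    and conv: "\<And>g :: 'a \<Rightarrow> real. uniformly_continuous_on UNIV g \<Longrightarrow> bounded (range g) \<Longrightarrow>
       (\<lambda>n. \<integral>x. g x \<partial>\<mu> n) \<longlonglongrightarrow> (\<integral>x. g x \<partial>N)"
    and f: "continuous_on UNIV f" and bd: "bounded (range f)"
  shows "(\<lambda>n. \<integral>x. f x \<partial>\<mu> n) \<longlonglongrightarrow> (\<integral>x. f x \<partial>N)"
proof (rule LIMSEQ_I)
  fix r :: real assume r: "r > 0"
  obtain C where C: "\<And>x. \<bar>f x\<bar> \<le> C" using bd by (auto simp: bounded_iff)
  have C0: "C \<ge> 0" using C[of 0] by linarith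
  \<comment> \<open>Gives C e < r / 4, and C + 1 keeps the divisor positive when C = 0.\<close>
  define e where "e = r / 4 / (C + 1)"
  have e: "e > 0" using r C0 by (simp add: e_def)
  have [measurable]: "f \<in> borel_measurable borel" using f by (rule borel_measurable_continuous_onI)
  obtain R where R: "(\<integral>x. 1 - cutoff R x \<partial>N) < e"
    using exists_cutoff_tail_small[OF P(2) sets(2) e] by blast
  have fh: "\<bar>f x * cutoff R x\<bar> \<le> C" for x
    unfolding abs_mult using C[of x] cutoff_bounds[of R x] mult_mono[of "\<bar>f x\<bar>" C "\<bar>cutoff R x\<bar>" 1] C0 by auto
  have c1: "(\<lambda>n. \<integral>x. f x * cutoff R x \<partial>\<mu> n) \<longlonglongrightarrow> (\<integral>x. f x * cutoff R x \<partial>N)"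
    using fh by (intro conv uniformly_continuous_on_mult_cutoff f) (auto simp: bounded_iff)
  \<comment> \<open>The factor 1 presents the cutoff as a product with a continuous function, the
    form treated by \<open>uniformly_continuous_on_mult_cutoff\<close>.\<close>
  have c2: "(\<lambda>n. \<integral>x. 1 * cutoff R x \<partial>\<mu> n) \<longlonglongrightarrow> (\<integral>x. 1 * cutoff R x \<partial>N)"
    by (intro conv uniformly_continuous_on_mult_cutoff continuous_intros)
       (auto simp: bounded_iff intro!: exI[of _ 1] abs_cutoff_le)
  have split: "integrable L f" "integrable L (cutoff R)" "integrable L (\<lambda>x. f x * cutoff R x)"
      "\<bar>(\<integral>x. f x \<partial>L) - (\<integral>x. f x * cutoff R x \<partial>L)\<bar> \<le> C * (1 - (\<integral>x. cutoff R x \<partial>L))"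
    if L: "prob_space L" "sets L = sets borel" for L
  proof -
    interpret prob_space L by fact
    note [measurable_cong] = L(2)
    show i: "integrable L f" "integrable L (cutoff R)" "integrable L (\<lambda>x. f x * cutoff R x)"
      using C fh cutoff_bounds
      by (auto intro: integrable_const_bound[of _ C] integrable_const_bound[of _ 1])
    have "(\<integral>x. f x \<partial>L) - (\<integral>x. f x * cutoff R x \<partial>L) = (\<integral>x. f x * (1 - cutoff R x) \<partial>L)"
      using i by (simp add: algebra_simps)
    also have "\<bar>\<dots>\<bar> \<le> (\<integral>x. \<bar>f x * (1 - cutoff R x)\<bar> \<partial>L)" by (rule integral_abs_bound)
    also have "\<dots> \<le> (\<integral>x. C * (1 - cutoff R x) \<partial>L)"
    proof (rule integral_mono)
      show "integrable L (\<lambda>x. \<bar>f x * (1 - cutoff R x)\<bar>)"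
        using i by (auto simp: right_diff_distrib)
      show "integrable L (\<lambda>x. C * (1 - cutoff R x))" using i by auto
      show "\<bar>f x * (1 - cutoff R x)\<bar> \<le> C * (1 - cutoff R x)" for x
        using C[of x] cutoff_bounds[of R x] by (simp add: abs_mult mult_right_mono)
    qed
    also have "\<dots> = C * (1 - (\<integral>x. cutoff R x \<partial>L))" using i prob_space by simp
    finally show "\<bar>(\<integral>x. f x \<partial>L) - (\<integral>x. f x * cutoff R x \<partial>L)\<bar> \<le> C * (1 - (\<integral>x. cutoff R x \<partial>L))" .
  qed
  have tail: "1 - (\<integral>x. cutoff R x \<partial>N) < e"
  proof -
    interpret N: prob_space N by (rule P(2))
    show ?thesis using R split(2)[OF P(2) sets(2)] by (simp add: N.prob_space)
  qed
  have "(\<lambda>n. C * (1 - (\<integral>x. cutoff R x \<partial>\<mu> n))) \<longlonglongrightarrow> C * (1 - (\<integral>x. cutoff R x \<partial>N))"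
    using c2 by (intro tendsto_intros) simp
  moreover have "C * (1 - (\<integral>x. cutoff R x \<partial>N)) < r / 4"
  proof -
    have "C * (1 - (\<integral>x. cutoff R x \<partial>N)) \<le> C * e" using tail C0 by (intro mult_left_mono) auto
    also have "\<dots> < (C + 1) * e" using e by (simp add: algebra_simps)
    also have "\<dots> = r / 4" using C0 nonzero_mult_div_cancel_left[of "C + 1" "r / 4"] by (simp only: e_def times_divide_eq_right[of "C + 1" "r / 4"])
    finally show ?thesis .
  qed
  ultimately have ev1: "\<forall>\<^sub>F n in sequentially. C * (1 - (\<integral>x. cutoff R x \<partial>\<mu> n)) < r / 4" "C * (1 - (\<integral>x. cutoff R x \<partial>N)) < r / 4"
    by - (erule (1) order_tendstoD(2), assumption)
  have "\<forall>\<^sub>F n in sequentially. \<bar>(\<integral>x. f x * cutoff R x \<partial>\<mu> n) - (\<integral>x. f x * cutoff R x \<partial>N)\<bar> < r / 4"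
    using tendstoD[OF c1, of "r/4"] r by (simp add: dist_real_def)
  then have "\<forall>\<^sub>F n in sequentially. norm ((\<integral>x. f x \<partial>\<mu> n) - (\<integral>x. f x \<partial>N)) < r"
    using ev1(1)
  proof eventually_elim
    case (elim n)
    show ?case using elim ev1(2) split(4)[OF P(1) sets(1), of n] split(4)[OF P(2) sets(2)]
      unfolding real_norm_def by linarith
  qed
  then show "\<exists>n0. \<forall>n\<ge>n0. norm ((\<integral>x. f x \<partial>\<mu> n) - (\<integral>x. f x \<partial>N)) < r"
    by (simp add: eventually_sequentially)
qed

text \<open>It is enough to compare \<open>T n\<close> and \<open>U n\<close> on uniformly
  continuous test functions. Such a function differs little where the two are close and by at most
  twice its bound elsewhere, an event of vanishing probability.\<close>

lemma converges_in_distr_slutsky: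
  fixes T U :: "nat \<Rightarrow> 'a \<Rightarrow> 'b::euclidean_space"
  assumes M: "prob_space M" and N: "prob_space N" "sets N = sets borel"
    and meas[measurable]: "\<And>n. T n \<in> borel_measurable M" "\<And>n. U n \<in> borel_measurable M"
    and conv: "\<And>g :: 'b \<Rightarrow> real. uniformly_continuous_on UNIV g \<Longrightarrow> bounded (range g) \<Longrightarrow>
       (\<lambda>n. \<integral>x. g x \<partial>distr M borel (U n)) \<longlonglongrightarrow> (\<integral>x. g x \<partial>N)"
    and close: "\<And>\<tau> e. \<tau> > 0 \<Longrightarrow> e > 0 \<Longrightarrow> \<forall>\<^sub>F n in sequentially.
       measure M {\<omega>\<in>space M. dist (T n \<omega>) (U n \<omega>) \<ge> \<tau>} < e"
  shows "converges_in_distr M T N"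
  unfolding converges_in_distr_def
proof (intro allI impI)
  interpret prob_space M by fact
  fix f :: "'b \<Rightarrow> real" assume f: "continuous_on UNIV f" "bounded (range f)"
  show "(\<lambda>n. \<integral>z. f z \<partial>distr M borel (T n)) \<longlonglongrightarrow> (\<integral>z. f z \<partial>N)"
  proof (rule uniformly_continuous_imp_bounded_continuous_convergence[OF _ N(1) _ N(2) _ f])
    fix g :: "'b \<Rightarrow> real" assume g: "uniformly_continuous_on UNIV g" "bounded (range g)"
    have [measurable]: "g \<in> borel_measurable borel"
      using uniformly_continuous_imp_continuous[OF g(1)] by (rule borel_measurable_continuous_onI)
    obtain C where C: "\<And>x. \<bar>g x\<bar> \<le> C" using g(2) by (auto simp: bounded_iff)
    have C0: "C \<ge> 0" using C[of 0] by linarith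
    have int: "integrable M (\<lambda>\<omega>. g (T n \<omega>))" "integrable M (\<lambda>\<omega>. g (U n \<omega>))" for n
      using C by (auto intro: integrable_const_bound[of _ C])
    have "(\<lambda>n. (\<integral>\<omega>. g (T n \<omega>) \<partial>M) - (\<integral>\<omega>. g (U n \<omega>) \<partial>M)) \<longlonglongrightarrow> 0"
    proof (rule LIMSEQ_I)
      fix r :: real assume r: "r > 0"
      obtain d where d: "d > 0" "\<And>x y. dist x y < d \<Longrightarrow> \<bar>g x - g y\<bar> < r / 2"
        using g(1) r unfolding uniformly_continuous_on_def dist_real_def
        by (metis UNIV_I half_gt_zero)
      \<comment> \<open>The threshold makes 2 C times this probability smaller than r / 2, the half
        of r left over by the choice of \<open>d\<close>.\<close>
      have "\<forall>\<^sub>F n in sequentially. measure M {\<omega>\<in>space M. dist (T n \<omega>) (U n \<omega>) \<ge> d} < r / (4 * (C + 1))"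
        using close[OF d(1), of "r / (4 * (C + 1))"] r C0 by simp
      then have "\<forall>\<^sub>F n in sequentially. norm ((\<integral>\<omega>. g (T n \<omega>) \<partial>M) - (\<integral>\<omega>. g (U n \<omega>) \<partial>M) - 0) < r"
      proof eventually_elim
        case (elim n)
        let ?B = "{\<omega>\<in>space M. dist (T n \<omega>) (U n \<omega>) \<ge> d}"
        have B[measurable]: "?B \<in> sets M" by measurable
        have "\<bar>(\<integral>\<omega>. g (T n \<omega>) \<partial>M) - (\<integral>\<omega>. g (U n \<omega>) \<partial>M)\<bar> = \<bar>\<integral>\<omega>. g (T n \<omega>) - g (U n \<omega>) \<partial>M\<bar>"
          using int[of n] by simp
        also have "\<dots> \<le> (\<integral>\<omega>. \<bar>g (T n \<omega>) - g (U n \<omega>)\<bar> \<partial>M)" by (rule integral_abs_bound)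
        also have "\<dots> \<le> (\<integral>\<omega>. r / 2 + 2 * C * indicator ?B \<omega> \<partial>M)"
        proof (rule integral_mono)
          show "integrable M (\<lambda>\<omega>. \<bar>g (T n \<omega>) - g (U n \<omega>)\<bar>)" using int[of n] by auto
          show "integrable M (\<lambda>\<omega>. r / 2 + 2 * C * indicator ?B \<omega>)" by (auto simp: less_top[symmetric])
          fix \<omega> assume w: "\<omega> \<in> space M"
          show "\<bar>g (T n \<omega>) - g (U n \<omega>)\<bar> \<le> r / 2 + 2 * C * indicator ?B \<omega>"
          proof (cases "\<omega> \<in> ?B")
            case True
            then show ?thesis using C[of "T n \<omega>"] C[of "U n \<omega>"] r by auto
          next
            case False
            then show ?thesis using w d(2)[of "T n \<omega>" "U n \<omega>"] by auto
          qed
        qed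
        also have "\<dots> = r / 2 + 2 * C * measure M ?B"
          by (subst Bochner_Integration.integral_add) (auto simp: less_top[symmetric] prob_space)
        also have "\<dots> < r"
        proof -
          have "2 * C * measure M ?B \<le> 2 * C * (r / (4 * (C + 1)))"
            using elim C0 by (intro mult_left_mono) auto
          also have "\<dots> < r / 2" using C0 r by (simp add: field_simps)
          finally show ?thesis by simp
        qed
        finally show ?case by simp
      qed
      then show "\<exists>n0. \<forall>n\<ge>n0. norm ((\<integral>\<omega>. g (T n \<omega>) \<partial>M) - (\<integral>\<omega>. g (U n \<omega>) \<partial>M) - 0) < r"
        by (simp add: eventually_sequentially)
    qed
    from tendsto_add[OF this conv[OF g]]
    show "(\<lambda>n. \<integral>x. g x \<partial>distr M borel (T n)) \<longlonglongrightarrow> (\<integral>x. g x \<partial>N)"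
      by (simp add: integral_distr)
  qed (auto intro: prob_space_distr)
qed

text \<open>One minus the cutoff is uniformly continuous and dominates the indicator of norm at
  least R + 1, so its convergent integrals bound the tail probabilities.\<close>

lemma uniformly_continuous_convergence_imp_tight:
  fixes U :: "nat \<Rightarrow> 'a \<Rightarrow> 'b::euclidean_space"
  assumes M: "prob_space M" and N: "prob_space N" "sets N = sets borel"
    and meas[measurable]: "\<And>n. U n \<in> borel_measurable M"
    and conv: "\<And>g :: 'b \<Rightarrow> real. uniformly_continuous_on UNIV g \<Longrightarrow> bounded (range g) \<Longrightarrow>
       (\<lambda>n. \<integral>x. g x \<partial>distr M borel (U n)) \<longlonglongrightarrow> (\<integral>x. g x \<partial>N)"
    and e: "e > 0"
  obtains K where "K > 0" "\<forall>\<^sub>F n in sequentially. measure M {\<omega>\<in>space M. norm (U n \<omega>) \<ge> K} < e"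
proof -
  interpret prob_space M by fact
  obtain R where R: "R > 0" "(\<integral>x. 1 - cutoff R x \<partial>N) < e"
    using exists_cutoff_tail_small[OF N e] by blast
  have bd: "\<bar>1 - cutoff R x\<bar> \<le> 1" for x :: 'b using cutoff_bounds[of R x] by auto
  have "uniformly_continuous_on UNIV (\<lambda>x::'b. 1 - 1 * cutoff R x)"
    by (intro uniformly_continuous_on_diff uniformly_continuous_on_const uniformly_continuous_on_mult_cutoff continuous_intros)
  then have "(\<lambda>n. \<integral>x. 1 - cutoff R x \<partial>distr M borel (U n)) \<longlonglongrightarrow> (\<integral>x. 1 - cutoff R x \<partial>N)"
    by (intro conv) (auto simp: bounded_iff intro!: exI[of _ 1])
  then have "\<forall>\<^sub>F n in sequentially. (\<integral>x. 1 - cutoff R x \<partial>distr M borel (U n)) < e"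
    using R(2) by (rule order_tendstoD)
  then have "\<forall>\<^sub>F n in sequentially. measure M {\<omega>\<in>space M. norm (U n \<omega>) \<ge> R + 1} < e"
  proof eventually_elim
    case (elim n)
    let ?B = "{\<omega>\<in>space M. norm (U n \<omega>) \<ge> R + 1}"
    have [measurable]: "?B \<in> sets M" by measurable
    have "measure M ?B = (\<integral>\<omega>. indicator ?B \<omega> \<partial>M)" by (simp add: Int_absorb2 subset_eq)
    also have "\<dots> \<le> (\<integral>\<omega>. 1 - cutoff R (U n \<omega>) \<partial>M)"
    proof (rule integral_mono)
      show "integrable M (\<lambda>\<omega>. 1 - cutoff R (U n \<omega>))"
        using bd by (intro integrable_const_bound[of _ 1]) auto
      show "integrable M (indicat_real ?B)" by (auto simp: less_top[symmetric])
      show "indicator ?B \<omega> \<le> 1 - cutoff R (U n \<omega>)" for \<omega>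
        using cutoff_bounds[of R "U n \<omega>"] cutoff_eq_0[of R "U n \<omega>"] by (auto simp: indicator_def)
    qed
    also have "\<dots> < e" using elim by (simp add: integral_distr)
    finally show ?case .
  qed
  then show ?thesis using R(1) by (intro that[of "R + 1"]) auto
qed

section \<open>Limit theorems for i.i.d. samples\<close>

text \<open>Observations are numbered from 1, whereas the central limit theorem takes a family
  indexed by all natural numbers.\<close>

lemma (in prob_space) indep_vars_reindex_Suc:
  assumes "indep_vars (\<lambda>_. N) X {1..}"
  shows "indep_vars (\<lambda>_. N) (\<lambda>i. X (Suc i)) UNIV"
  unfolding indep_vars_def2 indep_sets_def
proof (intro conjI ballI allI impI)
  let ?F = "\<lambda>i. {X i -` A \<inter> space M |A. A \<in> sets N}"
  have rv: "random_variable N (X i)" if "i \<ge> 1" for i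
    using assms that by (auto simp: indep_vars_def2)
  then show "random_variable N (X (Suc i))" for i by simp
  show "?F (Suc i) \<subseteq> events" for i
    using rv[of "Suc i"] by (auto intro: measurable_sets)
  fix J :: "nat set" and A assume J: "J \<noteq> {}" "finite J" and A: "A \<in> (\<Pi> j\<in>J. ?F (Suc j))"
  have "prob (\<Inter>j\<in>Suc ` J. A (j - 1)) = (\<Prod>j\<in>Suc ` J. prob (A (j - 1)))"
  proof (rule indep_setsD[of ?F "{1..}"])
    show "indep_sets ?F {1..}" using assms by (simp add: indep_vars_def2)
    show "\<forall>j\<in>Suc ` J. A (j - 1) \<in> ?F j" using A by (auto simp: Pi_iff)
  qed (use J in auto)
  then show "prob (\<Inter>j\<in>J. A j) = (\<Prod>j\<in>J. prob (A j))"
    by (simp add: prod.reindex)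
qed

locale iid_sample = prob_space M for M :: "'a measure" +
  fixes V :: "nat \<Rightarrow> 'a \<Rightarrow> 's::topological_space" and P :: "'s measure"
  assumes indep_V: "indep_vars (\<lambda>_. borel) V {1..}"
    and distr_V: "i \<ge> 1 \<Longrightarrow> distr M borel (V i) = P"
begin

lemma V_measurable [measurable]: "i \<ge> 1 \<Longrightarrow> V i \<in> borel_measurable M"
  using indep_V by (auto simp: indep_vars_def2)

lemma sets_P [simp, measurable_cong]: "sets P = sets borel"
  using distr_V[of 1] by (metis order_refl sets_distr)

lemma prob_space_P: "prob_space P"
  using distr_V[of 1] prob_space_distr[OF V_measurable[of 1]] by simp

sublocale P: prob_space P by (rule prob_space_P)

lemma
  fixes h :: "'s \<Rightarrow> 'b::{banach, second_countable_topology}"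
  assumes "i \<ge> 1" and [measurable]: "h \<in> borel_measurable borel"
  shows expectation_V: "(\<integral>\<omega>. h (V i \<omega>) \<partial>M) = (\<integral>v. h v \<partial>P)"
    and integrable_V: "integrable M (\<lambda>\<omega>. h (V i \<omega>)) \<longleftrightarrow> integrable P h"
  using assms(1) unfolding distr_V[OF assms(1), symmetric]
  by (simp_all add: integral_distr integrable_distr_eq)

text \<open>Markov's inequality, with a bound that is free of \<open>n\<close>: an average of
  nonnegative terms of small mean is controlled at all sample sizes at once.\<close>

lemma prob_average_ge:
  fixes h :: "'s \<Rightarrow> real"
  assumes h: "h \<in> borel_measurable borel" and int: "integrable P h"
    and nn: "\<And>v. h v \<ge> 0" and c: "c > 0"
  shows "prob {\<omega>\<in>space M. (\<Sum>i=1..n. h (V i \<omega>)) / real n \<ge> c} \<le> (\<integral>v. h v \<partial>P) / c"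
proof -
  note [measurable] = h
  have i: "integrable M (\<lambda>\<omega>. (\<Sum>i=1..n. h (V i \<omega>)) / real n)"
    by (intro integrable_divide Bochner_Integration.integrable_sum) (use int in \<open>simp add: integrable_V[OF _ h]\<close>)
  have "prob {\<omega>\<in>space M. (\<Sum>i=1..n. h (V i \<omega>)) / real n \<ge> c} \<le> (\<integral>\<omega>. (\<Sum>i=1..n. h (V i \<omega>)) / real n \<partial>M) / c"
    using nn c by (intro integral_Markov_inequality_measure[OF i, where A="{}"])
      (auto intro!: divide_nonneg_nonneg sum_nonneg)
  also have "(\<integral>\<omega>. (\<Sum>i=1..n. h (V i \<omega>)) / real n \<partial>M) = (\<Sum>i=1..n. \<integral>v. h v \<partial>P) / real n"
  proof -
    have "(\<integral>\<omega>. (\<Sum>i=1..n. h (V i \<omega>)) \<partial>M) = (\<Sum>i=1..n. \<integral>\<omega>. h (V i \<omega>) \<partial>M)"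
      by (rule Bochner_Integration.integral_sum) (use int in \<open>simp add: integrable_V[OF _ h]\<close>)
    also have "\<dots> = (\<Sum>i=1..n. \<integral>v. h v \<partial>P)"
      by (intro sum.cong refl expectation_V[OF _ h]) simp
    finally show ?thesis by simp
  qed
  \<comment> \<open>An inequality because of n = 0, where the quotient is 0 by convention.\<close>
  also have "\<dots> \<le> (\<integral>v. h v \<partial>P)"
    using nn by (auto simp: integral_nonneg_AE)
  finally show ?thesis using c by (simp add: divide_right_mono)
qed

text \<open>Integrability alone gives no variance bound, so \<open>h\<close> is truncated at a level
  K: Hoeffding's inequality handles the bounded part \<open>h1\<close>, and Markov's inequality the
  discarded part, of absolute value \<open>h2\<close>.\<close>

lemma weak_law_of_large_numbers:
  fixes h :: "'s \<Rightarrow> real"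
  assumes h[measurable]: "h \<in> borel_measurable borel" and int: "integrable P h" and e: "e > 0"
  shows "(\<lambda>n. prob {\<omega>\<in>space M. \<bar>(\<Sum>i=1..n. h (V i \<omega>)) / real n - (\<integral>v. h v \<partial>P)\<bar> \<ge> e}) \<longlonglongrightarrow> 0"
proof (rule LIMSEQ_I)
  fix r :: real assume r: "r > 0"
  \<comment> \<open>The bound e / 3 limits the change of the mean under truncation. The bound e r /
    6, divided by the level e / 3 in Markov's inequality, yields r / 2.\<close>
  define \<delta> where "\<delta> = min (e / 3) (e * r / 6)"
  have \<delta>: "\<delta> > 0" using e r by (simp add: \<delta>_def)
  have "(\<lambda>k. \<integral>v. \<bar>h v\<bar> * indicator {v. \<bar>h v\<bar> > real k} v \<partial>P) \<longlonglongrightarrow> (\<integral>v. 0 \<partial>P)"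
  proof (rule integral_dominated_convergence[where w="\<lambda>v. \<bar>h v\<bar>"])
    show "AE v in P. (\<lambda>k. \<bar>h v\<bar> * indicator {v. \<bar>h v\<bar> > real k} v) \<longlonglongrightarrow> 0"
    proof (rule AE_I2)
      fix v
      obtain k0 where "\<bar>h v\<bar> < real k0" using reals_Archimedean2 by blast
      then have "\<forall>\<^sub>F k in sequentially. \<bar>h v\<bar> * indicator {v. \<bar>h v\<bar> > real k} v = 0"
        by (intro eventually_sequentiallyI[of k0]) auto
      then show "(\<lambda>k. \<bar>h v\<bar> * indicator {v. \<bar>h v\<bar> > real k} v) \<longlonglongrightarrow> 0" by (rule tendsto_eventually)
    qed
    show "AE v in P. norm (\<bar>h v\<bar> * indicator {v. \<bar>h v\<bar> > real k} v) \<le> \<bar>h v\<bar>" for k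
      by (auto simp: indicator_def)
  qed (use int in auto)
  then have "\<forall>\<^sub>F k in sequentially. (\<integral>v. \<bar>h v\<bar> * indicator {v. \<bar>h v\<bar> > real k} v \<partial>P) < \<delta>"
    using \<delta> by (intro order_tendstoD) auto
  then obtain k where k: "(\<integral>v. \<bar>h v\<bar> * indicator {v. \<bar>h v\<bar> > real k} v \<partial>P) < \<delta>" "k > 0"
    by (metis (mono_tags, lifting) eventually_conj eventually_gt_at_top eventually_happens trivial_limit_sequentially)
  define K where "K = real k"
  have K: "K > 0" using k by (simp add: K_def)
  define h1 where "h1 v = (if \<bar>h v\<bar> > K then 0 else h v)" for v
  define h2 where "h2 v = \<bar>h v\<bar> * indicator {v. \<bar>h v\<bar> > K} v" for v
  have h12: "h v = h1 v + (h v - h1 v)" "\<bar>h v - h1 v\<bar> = h2 v" "h2 v \<ge> 0" for v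
    by (auto simp: h1_def h2_def)
  have [measurable]: "h1 \<in> borel_measurable borel" "h2 \<in> borel_measurable borel"
    unfolding h1_def h2_def by measurable
  have i1: "integrable P h1"
    using K by (intro P.integrable_const_bound[of _ K]) (auto simp: h1_def)
  have i2: "integrable P h2"
    by (rule Bochner_Integration.integrable_bound[OF int]) (auto simp: h2_def indicator_def)
  have small: "(\<integral>v. h2 v \<partial>P) < \<delta>" using k(1) by (simp add: h2_def K_def)
  have m12: "\<bar>(\<integral>v. h v \<partial>P) - (\<integral>v. h1 v \<partial>P)\<bar> < e / 3"
  proof -
    have "\<bar>(\<integral>v. h v \<partial>P) - (\<integral>v. h1 v \<partial>P)\<bar> = \<bar>\<integral>v. h v - h1 v \<partial>P\<bar>" using int i1 by simp
    also have "\<dots> \<le> (\<integral>v. \<bar>h v - h1 v\<bar> \<partial>P)" by (rule integral_abs_bound)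
    also have "\<dots> < e / 3" using small by (simp add: h12(2) \<delta>_def)
    finally show ?thesis .
  qed
  have bd: "prob {\<omega>\<in>space M. \<bar>(\<Sum>i=1..n. h (V i \<omega>)) / real n - (\<integral>v. h v \<partial>P)\<bar> \<ge> e}
     \<le> 2 * exp (-2 * real n * (e/3)\<^sup>2 / (K - (-K))\<^sup>2) + r / 2" if n: "n \<ge> 1" for n
  proof -
    interpret H: Hoeffding_ineq_iid M "{1..n}" "\<lambda>i \<omega>. h1 (V i \<omega>)" "\<lambda>\<omega>. h1 (V 1 \<omega>)" "-K" K "\<integral>\<omega>. h1 (V 1 \<omega>) \<partial>M"
    proof unfold_locales
      show "indep_vars (\<lambda>_. borel) (\<lambda>i \<omega>. h1 (V i \<omega>)) {1..n}"
        by (rule indep_vars_compose2[OF indep_vars_subset[OF indep_V]]) auto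
      show "distr M borel (\<lambda>\<omega>. h1 (V i \<omega>)) = distr M borel (\<lambda>\<omega>. h1 (V 1 \<omega>))" if "i \<in> {1..n}" for i
      proof -
        have "distr M borel (\<lambda>\<omega>. h1 (V j \<omega>)) = distr P borel h1" if "j \<ge> 1" for j
          using that distr_V[OF that, symmetric] by (simp add: distr_distr comp_def)
        then show ?thesis using that by simp
      qed
      show "AE \<omega> in M. h1 (V 1 \<omega>) \<in> {- K..K}" using K by (auto simp: h1_def)
    qed auto
    let ?A = "{\<omega>\<in>space M. e / 3 \<le> \<bar>(\<Sum>i=1..n. h1 (V i \<omega>)) / real n - (\<integral>v. h1 v \<partial>P)\<bar>}"
    let ?B = "{\<omega>\<in>space M. e / 3 \<le> (\<Sum>i=1..n. h2 (V i \<omega>)) / real n}"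
    have [measurable]: "?A \<in> sets M" "?B \<in> sets M" by measurable
    have "prob ?A \<le> 2 * exp (-2 * real n * (e/3)\<^sup>2 / (K - (-K))\<^sup>2)"
      using H.Hoeffding_ineq_abs_ge'[of "e/3"] e K n unfolding expectation_V[of 1 h1, OF order_refl \<open>h1 \<in> borel_measurable borel\<close>] by simp
    moreover have "prob ?B \<le> r / 2"
    proof -
      have "prob ?B \<le> (\<integral>v. h2 v \<partial>P) / (e/3)"
        by (rule prob_average_ge) (use i2 h12(3) e in auto)
      also have "\<dots> \<le> (e * r / 6) / (e / 3)"
        using small e by (intro divide_right_mono) (auto simp: \<delta>_def)
      also have "\<dots> = r / 2" using e by simp
      finally show ?thesis .
    qed
    moreover have "prob {\<omega>\<in>space M. \<bar>(\<Sum>i=1..n. h (V i \<omega>)) / real n - (\<integral>v. h v \<partial>P)\<bar> \<ge> e} \<le> prob (?A \<union> ?B)"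
    proof (rule finite_measure_mono)
      show "{\<omega>\<in>space M. \<bar>(\<Sum>i=1..n. h (V i \<omega>)) / real n - (\<integral>v. h v \<partial>P)\<bar> \<ge> e} \<subseteq> ?A \<union> ?B"
      proof (rule subsetI, rule ccontr)
        fix \<omega> assume w: "\<omega> \<in> {\<omega>\<in>space M. \<bar>(\<Sum>i=1..n. h (V i \<omega>)) / real n - (\<integral>v. h v \<partial>P)\<bar> \<ge> e}"
          and "\<omega> \<notin> ?A \<union> ?B"
        then have a: "\<bar>(\<Sum>i=1..n. h1 (V i \<omega>)) / real n - (\<integral>v. h1 v \<partial>P)\<bar> < e / 3"
          and b: "(\<Sum>i=1..n. h2 (V i \<omega>)) / real n < e / 3" by auto
        have "\<bar>(\<Sum>i=1..n. h (V i \<omega>)) / real n - (\<Sum>i=1..n. h1 (V i \<omega>)) / real n\<bar>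
          = \<bar>\<Sum>i=1..n. h (V i \<omega>) - h1 (V i \<omega>)\<bar> / real n"
          by (simp add: sum_subtractf diff_divide_distrib[symmetric])
        also have "\<dots> \<le> (\<Sum>i=1..n. h2 (V i \<omega>)) / real n"
          unfolding h12(2)[symmetric] by (intro divide_right_mono sum_abs) auto
        finally have "\<bar>(\<Sum>i=1..n. h (V i \<omega>)) / real n - (\<Sum>i=1..n. h1 (V i \<omega>)) / real n\<bar> < e / 3"
          using b by linarith
        moreover have "\<bar>(\<Sum>i=1..n. h (V i \<omega>)) / real n - (\<integral>v. h v \<partial>P)\<bar> \<ge> e" using w by blast
        ultimately show False using a m12 by linarith
      qed
    qed auto
    moreover have "prob (?A \<union> ?B) \<le> prob ?A + prob ?B" by (rule measure_Un_le) auto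
    ultimately show ?thesis by linarith
  qed
  have "(\<lambda>n. 2 * exp (-2 * real n * (e/3)\<^sup>2 / (K - (-K))\<^sup>2)) \<longlonglongrightarrow> 0"
  proof -
    have "(\<lambda>n. 2 * exp (- (2 * (e/3)\<^sup>2 / (K - (-K))\<^sup>2)) ^ n) \<longlonglongrightarrow> 2 * 0"
      using e K by (intro tendsto_intros LIMSEQ_realpow_zero) auto
    then show ?thesis by (simp add: exp_of_nat_mult[symmetric] mult_ac)
  qed
  then have "\<forall>\<^sub>F n in sequentially. 2 * exp (-2 * real n * (e/3)\<^sup>2 / (K - (-K))\<^sup>2) < r / 2"
    by (rule order_tendstoD(2)) (use r in simp)
  then have "\<forall>\<^sub>F n in sequentially. norm (prob {\<omega>\<in>space M. \<bar>(\<Sum>i=1..n. h (V i \<omega>)) / real n - (\<integral>v. h v \<partial>P)\<bar> \<ge> e} - 0) < r"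
    using eventually_ge_at_top[of 1]
  proof eventually_elim
    case (elim n)
    then show ?case using bd[of n] by simp
  qed
  then show "\<exists>n0. \<forall>n\<ge>n0. norm (prob {\<omega>\<in>space M. \<bar>(\<Sum>i=1..n. h (V i \<omega>)) / real n - (\<integral>v. h v \<partial>P)\<bar> \<ge> e} - 0) < r"
    by (simp add: eventually_sequentially)
qed

text \<open>For a fixed \<open>t\<close> this concerns the scalar variables t . s(V i), so the
  univariate theorem applies. Only t = 0 has zero variance, and there both sides are 1.\<close>

lemma clt_char:
  fixes s :: "'s \<Rightarrow> 'b::euclidean_space"
  assumes s[measurable]: "s \<in> borel_measurable borel"
    and int: "integrable P (\<lambda>v. (norm (s v))\<^sup>2)"
    and mean: "\<And>t. (\<integral>v. t \<bullet> s v \<partial>P) = 0"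
    and var: "\<And>t. t \<noteq> 0 \<Longrightarrow> (\<integral>v. (t \<bullet> s v)\<^sup>2 \<partial>P) > 0"
  shows "(\<lambda>n. \<integral>\<omega>. iexp (t \<bullet> ((1 / sqrt (real n)) *\<^sub>R (\<Sum>i=1..n. s (V i \<omega>)))) \<partial>M)
     \<longlonglongrightarrow> complex_of_real (exp (- (\<integral>v. (t \<bullet> s v)\<^sup>2 \<partial>P) / 2))"
proof (cases "t = 0")
  case True
  then show ?thesis by (simp add: prob_space)
next
  case False
  define \<sigma> where "\<sigma> = sqrt (\<integral>v. (t \<bullet> s v)\<^sup>2 \<partial>P)"
  have \<sigma>: "\<sigma> > 0" "\<sigma>\<^sup>2 = (\<integral>v. (t \<bullet> s v)\<^sup>2 \<partial>P)"
    using var[OF False] by (auto simp: \<sigma>_def)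
  let ?X = "\<lambda>n \<omega>. t \<bullet> s (V (Suc n) \<omega>)"
  have sq: "integrable P (\<lambda>v. (t \<bullet> s v)\<^sup>2)"
  proof (rule Bochner_Integration.integrable_bound[OF integrable_mult_right[OF int, of "(norm t)\<^sup>2"]])
    show "AE v in P. norm ((t \<bullet> s v)\<^sup>2) \<le> norm ((norm t)\<^sup>2 * (norm (s v))\<^sup>2)"
      by (auto simp: power_mult_distrib[symmetric] power2_le_iff_abs_le Cauchy_Schwarz_ineq2)
  qed auto
  have X0: "expectation (?X n) = 0" for n
    using expectation_V[of "Suc n" "\<lambda>v. t \<bullet> s v"] mean[of t] by simp
  have "weak_conv_m (\<lambda>n. distr M borel (\<lambda>\<omega>. (\<Sum>i<n. ?X i \<omega>) / sqrt (n * \<sigma>\<^sup>2))) std_normal_distribution"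
  proof (rule central_limit_theorem_zero_mean[where \<mu>="distr P borel (\<lambda>v. t \<bullet> s v)"])
    have "indep_vars (\<lambda>_. borel) (\<lambda>i. V (Suc i)) UNIV"
      by (intro indep_vars_reindex_Suc indep_V)
    then show "indep_vars (\<lambda>i. borel) ?X UNIV"
      by (rule indep_vars_compose2) auto
    show "expectation (?X n) = 0" for n by (rule X0)
    show "\<sigma> > 0" by fact
    show "integrable M (\<lambda>\<omega>. (?X n \<omega>)\<^sup>2)" for n
      using integrable_V[of "Suc n" "\<lambda>v. (t \<bullet> s v)\<^sup>2"] sq by simp
    show "variance (?X n) = \<sigma>\<^sup>2" for n
      using expectation_V[of "Suc n" "\<lambda>v. (t \<bullet> s v)\<^sup>2"] unfolding X0 \<sigma>(2) by simp
    show "distr M borel (?X n) = distr P borel (\<lambda>v. t \<bullet> s v)" for n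
      using distr_V[of "Suc n", symmetric] by (simp add: distr_distr comp_def)
  qed
  \<comment> \<open>Evaluation at \<open>\<sigma>\<close> instead of 1 undoes the standardization,
    so the limit carries the variance of t . s.\<close>
  then have "(\<lambda>n. char (distr M borel (\<lambda>\<omega>. (\<Sum>i<n. ?X i \<omega>) / sqrt (n * \<sigma>\<^sup>2))) \<sigma>) \<longlonglongrightarrow> char std_normal_distribution \<sigma>"
    by (intro levy_continuity1 real_distribution_distr real_dist_normal_dist) auto
  moreover have "char (distr M borel (\<lambda>\<omega>. (\<Sum>i<n. ?X i \<omega>) / sqrt (n * \<sigma>\<^sup>2))) \<sigma> =
     (\<integral>\<omega>. iexp (t \<bullet> ((1 / sqrt (real n)) *\<^sub>R (\<Sum>i=1..n. s (V i \<omega>)))) \<partial>M)" for n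
  proof -
    have "t \<bullet> ((1 / sqrt (real n)) *\<^sub>R (\<Sum>i=1..n. s (V i \<omega>))) = \<sigma> * ((\<Sum>i<n. ?X i \<omega>) / sqrt (n * \<sigma>\<^sup>2))" for \<omega>
    proof -
      have "(\<Sum>i=1..n. s (V i \<omega>)) = (\<Sum>i<n. s (V (Suc i) \<omega>))"
        by (simp add: sum.atLeast1_atMost_eq)
      then show ?thesis using \<sigma>(1) by (simp add: inner_sum_right real_sqrt_mult)
    qed
    moreover have "char (distr M borel (\<lambda>\<omega>. (\<Sum>i<n. ?X i \<omega>) / sqrt (n * \<sigma>\<^sup>2))) \<sigma> =
        (\<integral>\<omega>. iexp (\<sigma> * ((\<Sum>i<n. ?X i \<omega>) / sqrt (n * \<sigma>\<^sup>2))) \<partial>M)"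
      unfolding char_def by (rule integral_distr) auto
    ultimately show ?thesis by (simp only:)
  qed
  ultimately show ?thesis unfolding char_std_normal_distribution \<sigma>(2) by (simp only:)
qed

end

section \<open>The loss function and its score\<close>

lemma logistic_bounds: "0 < logistic t" "logistic t < 1"
  by (auto simp: logistic_def field_simps add_pos_pos)

lemma logistic_has_derivative [derivative_intros]:
  assumes "(f has_real_derivative f') (at t within S)"
  shows "((\<lambda>t. logistic (f t)) has_real_derivative (logistic (f t) * (1 - logistic (f t)) * f')) (at t within S)"
proof -
  have p: "1 + exp (f t) \<noteq> 0" using exp_gt_zero[of "f t"] by linarith
  show ?thesis unfolding logistic_def[abs_def]
    by (rule derivative_eq_intros assms refl p)+ (use p in \<open>simp add: field_simps power2_eq_square\<close>)
qed

lemma continuous_on_logistic: "continuous_on S logistic"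
  unfolding logistic_def[abs_def]
  by (intro continuous_intros) (metis add_pos_pos exp_gt_zero less_irrefl zero_less_one)

lemma logistic_measurable [measurable]: "logistic \<in> borel_measurable borel"
  by (intro borel_measurable_continuous_onI continuous_on_logistic)

text \<open>By the mean value theorem the remainder is (f' z - f' t)(s - t) with z between s and t.
  The bound on f' gives the global estimate, and uniform continuity of f' on a compact interval
  gives the local one, so no second derivative enters.\<close>

lemma C1_remainder:
  fixes f f' :: "real \<Rightarrow> real"
  assumes d: "\<And>t. (f has_real_derivative f' t) (at t)" and b: "\<And>t. \<bar>f' t\<bar> \<le> C"
    and c: "continuous_on UNIV f'"
  shows "\<bar>f s - f t - f' t * (s - t)\<bar> \<le> 2 * C * \<bar>s - t\<bar>"
    and "\<eta> > 0 \<Longrightarrow> \<exists>r>0. \<forall>s t. \<bar>t\<bar> \<le> T \<longrightarrow> \<bar>s - t\<bar> \<le> r \<longrightarrow> \<bar>f s - f t - f' t * (s - t)\<bar> \<le> \<eta> * \<bar>s - t\<bar>"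
proof -
  have mvt: "\<exists>z. \<bar>z - t\<bar> \<le> \<bar>s - t\<bar> \<and> f s - f t - f' t * (s - t) = (f' z - f' t) * (s - t)" for s t
  proof (cases s t rule: linorder_cases)
    case less
    obtain z where "z > s" "z < t" "f t - f s = (t - s) * f' z"
      using MVT2[OF less d] by blast
    then show ?thesis by (intro exI[of _ z]) (auto simp: algebra_simps)
  next
    case greater
    obtain z where "z > t" "z < s" "f s - f t = (s - t) * f' z"
      using MVT2[OF greater d] by blast
    then show ?thesis by (intro exI[of _ z]) (auto simp: algebra_simps)
  qed auto
  show "\<bar>f s - f t - f' t * (s - t)\<bar> \<le> 2 * C * \<bar>s - t\<bar>"
  proof -
    obtain z where z: "f s - f t - f' t * (s - t) = (f' z - f' t) * (s - t)" using mvt by blast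
    have "\<bar>f' z - f' t\<bar> \<le> 2 * C" using b[of z] b[of t] by linarith
    then show ?thesis unfolding z abs_mult by (intro mult_right_mono) auto
  qed
  assume \<eta>: "\<eta> > 0"
  \<comment> \<open>The margin 1 keeps the intermediate point inside the interval. Below, the radius
    \<open>min (r / 2) 1\<close> respects this margin, and the half turns a weak bound on the
    distance into a strict one.\<close>
  have "uniformly_continuous_on {- T - 1..T + 1} f'"
    by (intro compact_uniformly_continuous continuous_on_subset[OF c]) auto
  then obtain r where r: "r > 0" "\<And>x y. x \<in> {- T - 1..T + 1} \<Longrightarrow> y \<in> {- T - 1..T + 1} \<Longrightarrow> dist y x < r \<Longrightarrow> dist (f' y) (f' x) < \<eta>"
    using \<eta> unfolding uniformly_continuous_on_def by metis
  have "\<bar>f s - f t - f' t * (s - t)\<bar> \<le> \<eta> * \<bar>s - t\<bar>" if t: "\<bar>t\<bar> \<le> T" and s: "\<bar>s - t\<bar> \<le> min (r / 2) 1" for s t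
  proof -
    obtain z where z: "\<bar>z - t\<bar> \<le> \<bar>s - t\<bar>" "f s - f t - f' t * (s - t) = (f' z - f' t) * (s - t)" using mvt by blast
    have "dist (f' z) (f' t) < \<eta>"
    proof (intro r(2))
      have z': "\<bar>z - t\<bar> < r" "\<bar>z - t\<bar> \<le> 1" using s z(1) r(1) by linarith+
      show "dist z t < r" using z' by (simp add: dist_real_def)
      show "t \<in> {- T - 1..T + 1}" "z \<in> {- T - 1..T + 1}" using t z' unfolding atLeastAtMost_iff by linarith+
    qed
    then show ?thesis unfolding z abs_mult by (intro mult_right_mono) (auto simp: dist_real_def)
  qed
  then show "\<exists>r>0. \<forall>s t. \<bar>t\<bar> \<le> T \<longrightarrow> \<bar>s - t\<bar> \<le> r \<longrightarrow> \<bar>f s - f t - f' t * (s - t)\<bar> \<le> \<eta> * \<bar>s - t\<bar>"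
    using r(1) by (intro exI[of _ "min (r / 2) 1"]) auto
qed

locale robust_loss =
  fixes \<rho> \<psi> \<psi>' :: "real \<Rightarrow> real"
  assumes \<rho>_deriv: "\<And>t. t \<ge> 0 \<Longrightarrow> (\<rho> has_real_derivative \<psi> t) (at t within {0..})"
    and \<psi>_deriv: "\<And>t. t \<ge> 0 \<Longrightarrow> (\<psi> has_real_derivative \<psi>' t) (at t within {0..})"
    and \<psi>'_cont: "continuous_on {0..} \<psi>'"
    and \<psi>_bdd: "bounded (\<psi> ` {0..})" and \<psi>'_bdd: "bounded (\<psi>' ` {0..})"
begin

text \<open>The loss is composed with \<open>u1\<close> and \<open>u2\<close>, which are positive
  everywhere, so these two-sided derivatives are what the chain rule asks for.\<close>

lemma deriv_interior:
  assumes "t > 0"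
  shows "(\<rho> has_real_derivative \<psi> t) (at t)" "(\<psi> has_real_derivative \<psi>' t) (at t)"
proof -
  have "at t within {0..} = at t" by (rule at_within_interior) (use assms in simp)
  then show "(\<rho> has_real_derivative \<psi> t) (at t)" "(\<psi> has_real_derivative \<psi>' t) (at t)"
    using \<rho>_deriv[of t] \<psi>_deriv[of t] assms by simp_all
qed

abbreviation "u1 t \<equiv> - ln (logistic t)"
abbreviation "u2 t \<equiv> - ln (1 - logistic t)"

lemma u_pos: "u1 t > 0" "u2 t > 0"
  using logistic_bounds[of t] by auto

lemma logistic_deriv: "(logistic has_real_derivative logistic t * (1 - logistic t)) (at t)"
  using logistic_has_derivative[OF DERIV_ident, of t UNIV] by simp

lemma u_deriv: "(u1 has_real_derivative - (1 - logistic t)) (at t)" "(u2 has_real_derivative logistic t) (at t)"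
proof -
  have b: "logistic t > 0" "1 - logistic t > 0" using logistic_bounds[of t] by auto
  show "(u1 has_real_derivative - (1 - logistic t)) (at t)"
    by (rule DERIV_cong[OF DERIV_minus[OF DERIV_chain2[OF DERIV_ln_divide[OF b(1)] logistic_deriv]]]) (use b in simp)
  show "(u2 has_real_derivative logistic t) (at t)"
    by (rule DERIV_cong[OF DERIV_minus[OF DERIV_chain2[OF DERIV_ln_divide[OF b(2)] DERIV_diff[OF DERIV_const logistic_deriv]]]]) (use b in simp)
qed

lemma u_cont: "continuous_on UNIV u1" "continuous_on UNIV u2"
  by (intro continuous_at_imp_continuous_on ballI DERIV_isCont[OF u_deriv(1)] DERIV_isCont[OF u_deriv(2)])+

lemma psi_cont: "continuous_on {0..} \<psi>"
  unfolding continuous_on_eq_continuous_within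
  by (intro ballI DERIV_continuous[OF \<psi>_deriv]) simp

lemma comp_deriv:
  "((\<lambda>t. \<rho> (u1 t)) has_real_derivative \<psi> (u1 t) * - (1 - logistic t)) (at t)"
  "((\<lambda>t. \<rho> (u2 t)) has_real_derivative \<psi> (u2 t) * logistic t) (at t)"
  "((\<lambda>t. \<psi> (u1 t)) has_real_derivative \<psi>' (u1 t) * - (1 - logistic t)) (at t)"
  "((\<lambda>t. \<psi> (u2 t)) has_real_derivative \<psi>' (u2 t) * logistic t) (at t)"
  by (rule DERIV_chain2[OF deriv_interior(1)[OF u_pos(1)] u_deriv(1)]
    DERIV_chain2[OF deriv_interior(1)[OF u_pos(2)] u_deriv(2)]
    DERIV_chain2[OF deriv_interior(2)[OF u_pos(1)] u_deriv(1)]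
    DERIV_chain2[OF deriv_interior(2)[OF u_pos(2)] u_deriv(2)])+

text \<open>The fundamental theorem of calculus at an interior point. The integrand may be
  discontinuous at 0, so integrability is first shown on the half-open interval, from boundedness
  and continuity, and then extended across a null set.\<close>

lemma corr_G_deriv:
  assumes u: "0 < u" "u < 1"
  shows "(corr_G \<psi> has_real_derivative \<psi> (- ln u)) (at u)"
proof -
  let ?f = "\<lambda>u. \<psi> (- ln u)"
  note \<psi>c = psi_cont
  have c: "continuous_on {0<..1} ?f"
    by (rule continuous_on_compose2[OF \<psi>c]) (auto intro!: continuous_intros)
  obtain C where C: "\<And>t. t \<ge> 0 \<Longrightarrow> \<bar>\<psi> t\<bar> \<le> C" using \<psi>_bdd by (auto simp: bounded_iff)
  have "set_integrable lborel {0<..1} ?f"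
    unfolding set_integrable_def
  proof (rule Bochner_Integration.integrable_bound[of _ "\<lambda>x. indicator {0<..1} x * C"])
    show "integrable lborel (\<lambda>x::real. indicator {0<..1} x * C)" by simp
    show "(\<lambda>x. indicator {0<..1} x *\<^sub>R ?f x) \<in> borel_measurable lborel"
      using borel_measurable_continuous_on_indicator[OF _ c] by simp
    have "\<bar>?f x\<bar> \<le> \<bar>C\<bar>" if "0 < x" "x \<le> 1" for x
      using C[of "- ln x"] that by simp
    then show "AE x in lborel. norm (indicator {0<..1} x *\<^sub>R ?f x) \<le> norm (indicator {0<..1} x * C)"
      by (auto simp: indicator_def)
  qed
  then have "?f integrable_on {0<..1}" by (rule set_borel_integral_eq_integral)
  then have int: "?f integrable_on {0..1}"
  proof (rule integrable_spike_set)
    show "negligible {x \<in> {0<..1} - {0..1}. ?f x \<noteq> 0}"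
      by (rule negligible_subset[OF negligible_sing[of 0]]) auto
    show "negligible {x \<in> {0..1} - {0<..1}. ?f x \<noteq> 0}"
      by (rule negligible_subset[OF negligible_sing[of 0]]) auto
  qed
  have "isCont ?f u"
  proof -
    have "continuous_on {0<..<1} ?f" by (rule continuous_on_subset[OF c]) auto
    then have "\<forall>x\<in>{0<..<1}. isCont ?f x"
      by (rule continuous_on_eq_continuous_at[OF open_greaterThanLessThan, THEN iffD1])
    then show ?thesis using u by simp
  qed
  then have "((\<lambda>v. integral {0..v} ?f) has_vector_derivative ?f u) (at u within ({0..1} - {}))"
    using u by (intro integral_has_vector_derivative_continuous_at int) (auto intro: continuous_at_imp_continuous_at_within)
  moreover have "at u within {0..1} = at u" by (rule at_within_interior) (use u in simp)
  ultimately show ?thesis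
    by (simp add: has_real_derivative_iff_has_vector_derivative corr_G_def[abs_def])
qed

text \<open>The two correction terms contribute F (1 - F) times \<open>\<psi> (u1 t)\<close> and
  minus F (1 - F) times \<open>\<psi> (u2 t)\<close>. They turn the coefficients -Y and 1 - Y into F
  - Y in both places, so F - Y factors out and the score is centred given the covariates.\<close>

lemma loss_phi_deriv:
  "(loss_phi \<rho> \<psi> Y has_real_derivative (logistic t - Y) * nu \<psi> t) (at t)"
proof -
  note dl = logistic_deriv
  have g1: "((\<lambda>t. corr_G \<psi> (logistic t)) has_real_derivative \<psi> (u1 t) * (logistic t * (1 - logistic t))) (at t)"
    by (rule DERIV_chain2[OF corr_G_deriv dl]) (use logistic_bounds in auto)
  have g2: "((\<lambda>t. corr_G \<psi> (1 - logistic t)) has_real_derivative \<psi> (u2 t) * (- (logistic t * (1 - logistic t)))) (at t)"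
    by (rule DERIV_chain2[OF corr_G_deriv]) (use logistic_bounds in \<open>auto intro!: derivative_eq_intros dl\<close>)
  show ?thesis
    unfolding loss_phi_def[abs_def]
    by (rule derivative_eq_intros comp_deriv g1 g2 refl)+ (simp add: nu_def algebra_simps)
qed

definition nu' :: "real \<Rightarrow> real" where
  "nu' t = - \<psi>' (u1 t) * (1 - logistic t)\<^sup>2 - \<psi> (u1 t) * (logistic t * (1 - logistic t))
     + \<psi>' (u2 t) * (logistic t)\<^sup>2 + \<psi> (u2 t) * (logistic t * (1 - logistic t))"

lemma nu_deriv: "(nu \<psi> has_real_derivative nu' t) (at t)"
proof -
  note dl = logistic_deriv
  show ?thesis unfolding nu_def[abs_def]
    by (rule derivative_eq_intros comp_deriv dl refl)+ (simp add: nu'_def power2_eq_square algebra_simps)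
qed

lemma nu_cont: "continuous_on UNIV (nu \<psi>)"
  by (intro continuous_at_imp_continuous_on ballI DERIV_isCont[OF nu_deriv])

lemma nu'_cont: "continuous_on UNIV nu'"
proof -
  note \<psi>c = psi_cont
  have im: "u1 ` UNIV \<subseteq> {0..}" "u2 ` UNIV \<subseteq> {0..}"
    using less_imp_le[OF u_pos(1)] less_imp_le[OF u_pos(2)] by (auto simp del: neg_0_le_iff_le)
  note c = continuous_on_compose2[OF \<psi>c u_cont(1) im(1)] continuous_on_compose2[OF \<psi>c u_cont(2) im(2)]
    continuous_on_compose2[OF \<psi>'_cont u_cont(1) im(1)] continuous_on_compose2[OF \<psi>'_cont u_cont(2) im(2)]
  show ?thesis unfolding nu'_def[abs_def]
    by (intro continuous_on_add continuous_on_diff continuous_on_mult continuous_on_minus continuous_on_power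
        continuous_on_const continuous_on_logistic c)
qed

lemma nu_bounds: "\<exists>C>0. \<forall>t. \<bar>nu \<psi> t\<bar> \<le> C \<and> \<bar>nu' t\<bar> \<le> C"
proof -
  obtain C1 where C1: "\<And>t. t \<ge> 0 \<Longrightarrow> \<bar>\<psi> t\<bar> \<le> C1" using \<psi>_bdd by (auto simp: bounded_iff)
  obtain C2 where C2: "\<And>t. t \<ge> 0 \<Longrightarrow> \<bar>\<psi>' t\<bar> \<le> C2" using \<psi>'_bdd by (auto simp: bounded_iff)
  \<comment> \<open>The maximum with 1 makes the common bound positive; the factor 4 below counts
    the terms of \<open>nu'\<close>.\<close>
  define C where "C = max 1 (max C1 C2)"
  have b: "\<bar>\<psi> (u1 t)\<bar> \<le> C" "\<bar>\<psi> (u2 t)\<bar> \<le> C" "\<bar>\<psi>' (u1 t)\<bar> \<le> C" "\<bar>\<psi>' (u2 t)\<bar> \<le> C" for t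
    using C1[of "u1 t"] C1[of "u2 t"] C2[of "u1 t"] C2[of "u2 t"] u_pos[of t] unfolding C_def by linarith+
  have m: "\<bar>x * y\<bar> \<le> C" if "\<bar>x\<bar> \<le> C" "0 \<le> y" "y \<le> 1" for x y
  proof -
    have "\<bar>x\<bar> * \<bar>y\<bar> \<le> C * 1" using that by (intro mult_mono) (auto simp: C_def)
    then show ?thesis by (simp add: abs_mult)
  qed
  have y: "0 \<le> logistic t" "logistic t \<le> 1" "0 \<le> 1 - logistic t" "1 - logistic t \<le> 1"
     "0 \<le> logistic t * (1 - logistic t)" "logistic t * (1 - logistic t) \<le> 1" "(1 - logistic t)\<^sup>2 \<le> 1" "(logistic t)\<^sup>2 \<le> 1" for t
    using logistic_bounds[of t] by (auto intro: mult_le_one power_le_one)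
  have "\<bar>nu \<psi> t\<bar> \<le> 4 * C" for t
    using m[OF b(1) y(3) y(4), of t t] m[OF b(2) y(1) y(2), of t t] b(1)[of t] unfolding nu_def by linarith
  moreover have "\<bar>nu' t\<bar> \<le> 4 * C" for t
  proof -
    have "\<bar>\<psi>' (u1 t) * (1 - logistic t)\<^sup>2\<bar> \<le> C" by (rule m[OF b(3) zero_le_power2 y(7)])
    moreover have "\<bar>\<psi> (u1 t) * (logistic t * (1 - logistic t))\<bar> \<le> C" by (rule m[OF b(1) y(5) y(6)])
    moreover have "\<bar>\<psi>' (u2 t) * (logistic t)\<^sup>2\<bar> \<le> C" by (rule m[OF b(4) zero_le_power2 y(8)])
    moreover have "\<bar>\<psi> (u2 t) * (logistic t * (1 - logistic t))\<bar> \<le> C" by (rule m[OF b(2) y(5) y(6)])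
    ultimately show ?thesis unfolding nu'_def mult_minus_left by linarith
  qed
  ultimately show ?thesis by (intro exI[of _ "4 * C"]) (auto simp: C_def)
qed

definition score :: "real \<Rightarrow> real \<Rightarrow> real" where
  "score Y t = (logistic t - Y) * nu \<psi> t"

definition score' :: "real \<Rightarrow> real \<Rightarrow> real" where
  "score' Y t = logistic t * (1 - logistic t) * nu \<psi> t + (logistic t - Y) * nu' t"

text \<open>The factor 1 + |Y| keeps the bounds valid for every real response. Sampled responses
  have the law of \<open>y\<close>, hence lie in {0, 1} only almost surely, while the expansion is
  carried out pointwise on the sample space.\<close>

lemma score_bounds: "\<exists>C>0. \<forall>Y t. \<bar>score Y t\<bar> \<le> C * (1 + \<bar>Y\<bar>) \<and> \<bar>score' Y t\<bar> \<le> C * (1 + \<bar>Y\<bar>)"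
proof -
  obtain C where C: "C > 0" "\<And>t. \<bar>nu \<psi> t\<bar> \<le> C" "\<And>t. \<bar>nu' t\<bar> \<le> C" using nu_bounds by blast
  have a: "\<bar>logistic t - Y\<bar> \<le> 1 + \<bar>Y\<bar>" for t Y using logistic_bounds[of t] by auto
  have 1: "\<bar>(logistic t - Y) * x\<bar> \<le> C * (1 + \<bar>Y\<bar>)" if "\<bar>x\<bar> \<le> C" for t Y x
    using mult_mono[OF that a[of t Y]] C(1) by (simp add: abs_mult mult.commute)
  have 2: "\<bar>logistic t * (1 - logistic t) * nu \<psi> t\<bar> \<le> C * (1 + \<bar>Y\<bar>)" for t Y
  proof -
    have "\<bar>logistic t * (1 - logistic t)\<bar> \<le> 1 + \<bar>Y\<bar>"
      using logistic_bounds[of t] mult_le_one[of "logistic t" "1 - logistic t"] by (auto simp: abs_mult)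
    from mult_mono[OF C(2)[of t] this] C(1) show ?thesis by (simp add: abs_mult mult.commute)
  qed
  have "\<bar>score Y t\<bar> \<le> 2 * C * (1 + \<bar>Y\<bar>)" "\<bar>score' Y t\<bar> \<le> 2 * C * (1 + \<bar>Y\<bar>)" for Y t
  proof -
    have "C * (1 + \<bar>Y\<bar>) \<ge> 0" using C(1) by simp
    then show "\<bar>score Y t\<bar> \<le> 2 * C * (1 + \<bar>Y\<bar>)" "\<bar>score' Y t\<bar> \<le> 2 * C * (1 + \<bar>Y\<bar>)"
      using 1[OF C(2), of t Y t] 1[OF C(3), of t Y t] 2[of t Y] unfolding score_def score'_def by linarith+
  qed
  then show ?thesis using C(1) by (intro exI[of _ "2 * C"]) auto
qed

text \<open>The score is affine in Y, so its remainder is that of \<open>score 0\<close> minus Y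
  times that of \<open>nu \<psi>\<close>. One radius good for these two functions serves all
  responses at once.\<close>

lemma score_remainder:
  obtains C where "C > 0"
    "\<And>Y s t. \<bar>score Y s - score Y t - score' Y t * (s - t)\<bar> \<le> C * (1 + \<bar>Y\<bar>) * \<bar>s - t\<bar>"
    "\<And>\<eta> T. \<eta> > 0 \<Longrightarrow> \<exists>r>0. \<forall>Y s t. \<bar>t\<bar> \<le> T \<longrightarrow> \<bar>s - t\<bar> \<le> r \<longrightarrow>
        \<bar>score Y s - score Y t - score' Y t * (s - t)\<bar> \<le> \<eta> * (1 + \<bar>Y\<bar>) * \<bar>s - t\<bar>"
proof -
  obtain C where C: "C > 0" "\<And>Y t. \<bar>score' Y t\<bar> \<le> C * (1 + \<bar>Y\<bar>)" "\<And>t. \<bar>nu' t\<bar> \<le> C"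
  proof -
    obtain C1 C2 where "C1 > 0" "C2 > 0" "\<And>Y t. \<bar>score' Y t\<bar> \<le> C1 * (1 + \<bar>Y\<bar>)" "\<And>t. \<bar>nu' t\<bar> \<le> C2"
      using score_bounds nu_bounds by metis
    then have "\<bar>score' Y t\<bar> \<le> (C1 + C2) * (1 + \<bar>Y\<bar>)" "\<bar>nu' t\<bar> \<le> C1 + C2" for Y t
    proof -
      have "C1 * (1 + \<bar>Y\<bar>) \<le> (C1 + C2) * (1 + \<bar>Y\<bar>)" using \<open>C2 > 0\<close> by (intro mult_right_mono) auto
      then show "\<bar>score' Y t\<bar> \<le> (C1 + C2) * (1 + \<bar>Y\<bar>)" using \<open>\<And>Y t. \<bar>score' Y t\<bar> \<le> C1 * (1 + \<bar>Y\<bar>)\<close>[of Y t] by linarith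
      show "\<bar>nu' t\<bar> \<le> C1 + C2" using \<open>\<And>t. \<bar>nu' t\<bar> \<le> C2\<close>[of t] \<open>C1 > 0\<close> by linarith
    qed
    then show ?thesis using \<open>C1 > 0\<close> \<open>C2 > 0\<close> by (intro that[of "C1 + C2"]) auto
  qed
  let ?R = "\<lambda>f f' s t. f s - f t - f' t * (s - t :: real) :: real"
  note dl = logistic_deriv
  have d0: "(score 0 has_real_derivative score' 0 t) (at t)" for t
    unfolding score_def[abs_def] score'_def
    by (rule derivative_eq_intros dl nu_deriv refl)+ (simp add: algebra_simps)
  have c0: "continuous_on UNIV (score' 0)"
    unfolding score'_def[abs_def] by (intro continuous_intros continuous_on_logistic nu_cont nu'_cont)
  have b0: "\<bar>score' 0 t\<bar> \<le> C" for t using C(2)[of 0 t] by simp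
  have dec: "score Y s - score Y t - score' Y t * (s - t) = ?R (score 0) (score' 0) s t - Y * ?R (nu \<psi>) nu' s t" for Y s t
    by (simp add: score_def score'_def algebra_simps)
  have comb: "\<bar>score Y s - score Y t - score' Y t * (s - t)\<bar> \<le> k * (1 + \<bar>Y\<bar>) * \<bar>s - t\<bar>"
    if "\<bar>?R (score 0) (score' 0) s t\<bar> \<le> k * \<bar>s - t\<bar>" "\<bar>?R (nu \<psi>) nu' s t\<bar> \<le> k * \<bar>s - t\<bar>" for Y s t k
  proof -
    have "\<bar>Y * ?R (nu \<psi>) nu' s t\<bar> \<le> \<bar>Y\<bar> * (k * \<bar>s - t\<bar>)"
      unfolding abs_mult by (rule mult_left_mono[OF that(2)]) auto
    then have "\<bar>?R (score 0) (score' 0) s t - Y * ?R (nu \<psi>) nu' s t\<bar> \<le> k * \<bar>s - t\<bar> + \<bar>Y\<bar> * (k * \<bar>s - t\<bar>)"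
      using that(1) by linarith
    also have "\<dots> = k * (1 + \<bar>Y\<bar>) * \<bar>s - t\<bar>" by (simp add: algebra_simps)
    finally show ?thesis unfolding dec[of Y s t] .
  qed
  show ?thesis
  proof (rule that[of "2 * C"])
    show "2 * C > 0" using C by simp
    show "\<bar>score Y s - score Y t - score' Y t * (s - t)\<bar> \<le> 2 * C * (1 + \<bar>Y\<bar>) * \<bar>s - t\<bar>" for Y s t
      by (rule comb C1_remainder(1)[OF d0 b0 c0] C1_remainder(1)[OF nu_deriv C(3) nu'_cont])+
    fix \<eta> T :: real assume \<eta>: "\<eta> > 0"
    obtain r1 where r1: "r1 > 0" "\<And>s t. \<bar>t\<bar> \<le> T \<Longrightarrow> \<bar>s - t\<bar> \<le> r1 \<Longrightarrow> \<bar>?R (score 0) (score' 0) s t\<bar> \<le> \<eta> * \<bar>s - t\<bar>"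
      using C1_remainder(2)[OF d0 b0 c0 \<eta>, of T] by blast
    obtain r2 where r2: "r2 > 0" "\<And>s t. \<bar>t\<bar> \<le> T \<Longrightarrow> \<bar>s - t\<bar> \<le> r2 \<Longrightarrow> \<bar>?R (nu \<psi>) nu' s t\<bar> \<le> \<eta> * \<bar>s - t\<bar>"
      using C1_remainder(2)[OF nu_deriv C(3) nu'_cont \<eta>, of T] by blast
    show "\<exists>r>0. \<forall>Y s t. \<bar>t\<bar> \<le> T \<longrightarrow> \<bar>s - t\<bar> \<le> r \<longrightarrow>
        \<bar>score Y s - score Y t - score' Y t * (s - t)\<bar> \<le> \<eta> * (1 + \<bar>Y\<bar>) * \<bar>s - t\<bar>"
      using r1 r2 by (intro exI[of _ "min r1 r2"]) (auto intro!: comb)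
  qed
qed

end

section \<open>The active block\<close>

context
  fixes emb :: "'k::finite \<Rightarrow> 'p::finite"
  assumes emb: "inj emb"
begin

text \<open>Padding is adjoint to restriction. At a padded parameter the linear predictor involves
  the active covariates alone, which reduces the problem to the active block.\<close>

lemma inner_zero_pad: "v \<bullet> zero_pad emb b = blockA emb v \<bullet> b"
proof -
  have "v \<bullet> zero_pad emb b = (\<Sum>j\<in>range emb. v $ j * b $ inv emb j)"
    unfolding inner_vec_def zero_pad_def by (intro sum.mono_neutral_cong_right) auto
  also have "\<dots> = (\<Sum>i\<in>UNIV. v $ emb i * b $ i)"
    using emb by (subst sum.reindex) (auto simp: inv_f_f)
  finally show ?thesis by (simp add: inner_vec_def blockA_def)
qed

lemma blockA_zero_pad: "blockA emb (zero_pad emb b) = b"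
  using emb by (simp add: blockA_def zero_pad_def vec_eq_iff inv_f_f)

lemma zero_pad_blockA: "(\<And>j. j \<notin> range emb \<Longrightarrow> \<beta> $ j = 0) \<Longrightarrow> zero_pad emb (blockA emb \<beta>) = \<beta>"
  by (auto simp: blockA_def zero_pad_def vec_eq_iff f_inv_into_f)

lemma norm_blockA_le: "norm (blockA emb v) \<le> norm v"
proof -
  have "(norm (blockA emb v))\<^sup>2 = (\<Sum>j\<in>range emb. (v $ j)\<^sup>2)"
    unfolding power2_norm_eq_inner inner_vec_def
    using emb by (subst sum.reindex) (auto simp: blockA_def power2_eq_square)
  also have "\<dots> \<le> (\<Sum>j\<in>UNIV. (v $ j)\<^sup>2)" by (rule sum_mono2) auto
  also have "\<dots> = (norm v)\<^sup>2" unfolding power2_norm_eq_inner inner_vec_def by (simp add: power2_eq_square)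
  finally show ?thesis by (rule power2_le_imp_le) simp
qed

end

lemma blockA_diff: "blockA emb (u - v) = blockA emb u - blockA emb v"
  by (simp add: blockA_def vec_eq_iff)

lemma blockA_measurable [measurable]: "blockA emb \<in> borel_measurable borel"
proof -
  have "linear (blockA emb)" by (rule linearI) (auto simp: blockA_def vec_eq_iff)
  then show ?thesis by (intro borel_measurable_continuous_onI linear_continuous_on) (simp add: linear_linear)
qed

lemma vec_nth_measurable [measurable]: "(\<lambda>v :: real^'n::finite. v $ i) \<in> borel_measurable borel"
  by (intro borel_measurable_continuous_onI continuous_intros)

text \<open>Reduces integrability of the matrix-valued moments to that of a scalar second
  moment.\<close>

lemma norm_outer: "norm (outer v) = (norm v)\<^sup>2"
proof -
  have "norm (outer v $ i) = norm v * \<bar>v $ i\<bar>" for i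
  proof -
    have "outer v $ i = v $ i *\<^sub>R v" by (simp add: outer_def vec_eq_iff)
    then show ?thesis by simp
  qed
  then have "norm (outer v) = L2_set (\<lambda>i. norm v * \<bar>v $ i\<bar>) UNIV"
    by (simp add: norm_vec_def[of "outer v"])
  also have "\<dots> = norm v * norm v"
    by (simp add: L2_set_right_distrib[symmetric] norm_vec_def[of v])
  finally show ?thesis by (simp add: power2_eq_square)
qed

lemma outer_measurable [measurable]: "outer \<in> borel_measurable borel"
proof -
  have "continuous_on UNIV (outer :: real^'p \<Rightarrow> _)"
    unfolding outer_def[abs_def] by (intro continuous_intros)
  then show ?thesis by (rule borel_measurable_continuous_onI)
qed

text \<open>Taking an entry is bounded linear, so it commutes with the integral of the integrable
  matrix function; the quadratic form then follows by summing finitely many integrable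
  entries.\<close>

lemma
  fixes x :: "'a \<Rightarrow> real^'p::finite" and c :: "'a \<Rightarrow> real" and emb :: "'k::finite \<Rightarrow> 'p"
  assumes [measurable]: "x \<in> borel_measurable M" "c \<in> borel_measurable M"
    and int: "integrable M (\<lambda>\<omega>. c \<omega> * (norm (x \<omega>))\<^sup>2)"
  defines "S \<equiv> submat emb (\<integral>\<omega>. c \<omega> *\<^sub>R outer (x \<omega>) \<partial>M)"
  shows submat_moment_entry: "S $ i $ j = (\<integral>\<omega>. c \<omega> * (blockA emb (x \<omega>) $ i * blockA emb (x \<omega>) $ j) \<partial>M)"
    and submat_moment_integrable: "integrable M (\<lambda>\<omega>. c \<omega> * (blockA emb (x \<omega>) $ i * blockA emb (x \<omega>) $ j))"
    and submat_moment_transpose: "transpose S = S"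
    and submat_moment_bilinear: "u \<bullet> (S *v v) = (\<integral>\<omega>. c \<omega> * ((u \<bullet> blockA emb (x \<omega>)) * (v \<bullet> blockA emb (x \<omega>))) \<partial>M)"
proof -
  have iO: "integrable M (\<lambda>\<omega>. c \<omega> *\<^sub>R outer (x \<omega>))"
    by (rule Bochner_Integration.integrable_bound[OF int]) (auto simp: norm_outer)
  have "S $ i $ j = (\<integral>\<omega>. (c \<omega> *\<^sub>R outer (x \<omega>)) $ emb i $ emb j \<partial>M)" for i j
  proof -
    have bl: "bounded_linear (\<lambda>H :: real^'p^'p. H $ emb i $ emb j)"
      using bounded_linear_compose[OF bounded_linear_vec_nth bounded_linear_vec_nth] .
    show ?thesis unfolding S_def submat_def using integral_bounded_linear[OF bl iO] by simp
  qed
  then show entry: "S $ i $ j = (\<integral>\<omega>. c \<omega> * (blockA emb (x \<omega>) $ i * blockA emb (x \<omega>) $ j) \<partial>M)" for i j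
    by (simp add: outer_def blockA_def)
  show i: "integrable M (\<lambda>\<omega>. c \<omega> * (blockA emb (x \<omega>) $ i * blockA emb (x \<omega>) $ j))" for i j
  proof (rule Bochner_Integration.integrable_bound[OF int])
    show "AE \<omega> in M. norm (c \<omega> * (blockA emb (x \<omega>) $ i * blockA emb (x \<omega>) $ j)) \<le> norm (c \<omega> * (norm (x \<omega>))\<^sup>2)"
      by (auto simp: abs_mult blockA_def power2_eq_square intro!: mult_left_mono mult_mono component_le_norm_cart)
  qed measurable
  show "transpose S = S" unfolding transpose_def vec_eq_iff by (simp add: entry mult.commute)
  have "u \<bullet> (S *v v) = (\<Sum>i\<in>UNIV. \<Sum>j\<in>UNIV. u $ i * v $ j * S $ i $ j)"
    by (simp add: inner_vec_def matrix_vector_mult_def sum_distrib_left mult_ac)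
  also have "\<dots> = (\<Sum>i\<in>UNIV. \<Sum>j\<in>UNIV. \<integral>\<omega>. u $ i * v $ j * (c \<omega> * (blockA emb (x \<omega>) $ i * blockA emb (x \<omega>) $ j)) \<partial>M)"
    by (simp only: entry integral_mult_right_zero)
  also have "\<dots> = (\<integral>\<omega>. (\<Sum>i\<in>UNIV. \<Sum>j\<in>UNIV. u $ i * v $ j * (c \<omega> * (blockA emb (x \<omega>) $ i * blockA emb (x \<omega>) $ j))) \<partial>M)"
    using i by (simp add: Bochner_Integration.integral_sum)
  also have "\<dots> = (\<integral>\<omega>. c \<omega> * ((u \<bullet> blockA emb (x \<omega>)) * (v \<bullet> blockA emb (x \<omega>))) \<partial>M)"
    unfolding inner_vec_def inner_real_def sum_product unfolding sum_distrib_left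
    by (intro Bochner_Integration.integral_cong sum.cong refl) (simp add: mult_ac)
  finally show "u \<bullet> (S *v v) = (\<integral>\<omega>. c \<omega> * ((u \<bullet> blockA emb (x \<omega>)) * (v \<bullet> blockA emb (x \<omega>))) \<partial>M)" .
qed

text \<open>A function of \<open>x\<close> is measurable for the sigma-algebra generated by
  \<open>x\<close>, so it can be pulled out of the conditional expectation before
  integrating.\<close>

lemma (in prob_space) integral_mult_cond_exp_vimage:
  fixes g :: "'b \<Rightarrow> real" and f :: "'a \<Rightarrow> real"
  assumes x[measurable]: "x \<in> M \<rightarrow>\<^sub>M N" and f[measurable]: "f \<in> borel_measurable M"
    and g[measurable]: "g \<in> borel_measurable N"
    and int: "integrable M (\<lambda>\<omega>. g (x \<omega>) * f \<omega>)"
    and ce: "AE \<omega> in M. real_cond_exp M (vimage_algebra (space M) x N) f \<omega> = p \<omega>"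
    and p[measurable]: "p \<in> borel_measurable M"
  shows "(\<integral>\<omega>. g (x \<omega>) * f \<omega> \<partial>M) = (\<integral>\<omega>. g (x \<omega>) * p \<omega> \<partial>M)"
proof -
  let ?F = "vimage_algebra (space M) x N"
  have xs: "x \<in> space M \<rightarrow> space N" using measurable_space[OF x] by auto
  have sub: "subalgebra M ?F"
    unfolding subalgebra_def using measurable_sets[OF x] by (auto simp: sets_vimage_algebra2[OF xs])
  interpret S: finite_measure_subalgebra M ?F by unfold_locales (rule sub)
  have gx: "(\<lambda>\<omega>. g (x \<omega>)) \<in> borel_measurable ?F"
    by (rule measurable_compose[OF measurable_vimage_algebra1[OF xs] g])
  have "(\<integral>\<omega>. g (x \<omega>) * real_cond_exp M ?F f \<omega> \<partial>M) = (\<integral>\<omega>. g (x \<omega>) * f \<omega> \<partial>M)"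
    by (rule S.real_cond_exp_intg(2)[OF int gx f])
  moreover have "(\<integral>\<omega>. g (x \<omega>) * real_cond_exp M ?F f \<omega> \<partial>M) = (\<integral>\<omega>. g (x \<omega>) * p \<omega> \<partial>M)"
    by (rule integral_cong_AE) (use ce in auto)
  ultimately show ?thesis by simp
qed

section \<open>Population moments\<close>

locale sparse_logistic = robust_loss \<rho> \<psi> \<psi>' + prob_space M
  for \<rho> \<psi> \<psi>' :: "real \<Rightarrow> real" and M :: "'a measure" +
  fixes y :: "'a \<Rightarrow> real" and x :: "'a \<Rightarrow> real ^ 'p::finite" and emb :: "'k::finite \<Rightarrow> 'p"
    and b0 :: "real ^ 'k" and w :: "real ^ 'p \<Rightarrow> real"
  assumes y_meas [measurable]: "y \<in> borel_measurable M" and x_meas [measurable]: "x \<in> borel_measurable M"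
    and y01: "\<And>\<omega>. \<omega> \<in> space M \<Longrightarrow> y \<omega> \<in> {0, 1}"
    and emb: "inj emb"
    and model: "AE \<omega> in M. real_cond_exp M (vimage_algebra (space M) x borel)
                  (indicator {\<omega> \<in> space M. y \<omega> = 1}) \<omega> = logistic (x \<omega> \<bullet> zero_pad emb b0)"
    and w_meas [measurable]: "w \<in> borel_measurable borel" and w_nonneg: "w v \<ge> 0" and w_le_1: "w v \<le> 1"
    and second_moment: "integrable M (\<lambda>\<omega>. w (x \<omega>) * (norm (x \<omega>))\<^sup>2)"
begin

abbreviation "act \<equiv> blockA emb"
abbreviation "A_act \<equiv> submat emb (mat_A M x \<psi> w (zero_pad emb b0))"
abbreviation "B_act \<equiv> submat emb (mat_B M x \<psi> w (zero_pad emb b0))"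

lemma nu_measurable [measurable]: "nu \<psi> \<in> borel_measurable borel"
  by (intro borel_measurable_continuous_onI nu_cont)

lemma nu'_measurable [measurable]: "nu' \<in> borel_measurable borel"
  by (intro borel_measurable_continuous_onI nu'_cont)

lemma score_measurable [measurable]:
  "(\<lambda>(Y, t). score Y t) \<in> borel_measurable (borel \<Otimes>\<^sub>M borel)"
  "(\<lambda>(Y, t). score' Y t) \<in> borel_measurable (borel \<Otimes>\<^sub>M borel)"
  unfolding score_def[abs_def] score'_def[abs_def] by measurable

text \<open>One envelope for the population moments: its constant part is integrable because the
  weight is at most 1, its quadratic part by \<open>second_moment\<close>. Integrability becomes a
  pointwise estimate.\<close>

lemma integrable_weighted:
  assumes [measurable]: "f \<in> borel_measurable M" and f: "\<And>\<omega>. \<omega> \<in> space M \<Longrightarrow> \<bar>f \<omega>\<bar> \<le> C * (w (x \<omega>) * (1 + (norm (x \<omega>))\<^sup>2))"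
  shows "integrable M f"
proof -
  have "integrable M (\<lambda>\<omega>. w (x \<omega>))"
    using w_nonneg w_le_1 by (intro integrable_const_bound[of _ 1]) auto
  then have i: "integrable M (\<lambda>\<omega>. C * (w (x \<omega>) * (1 + (norm (x \<omega>))\<^sup>2)))"
    using second_moment by (simp add: algebra_simps)
  show ?thesis
    by (rule Bochner_Integration.integrable_bound[OF i]) (use f in \<open>force intro!: AE_I2\<close>)+
qed

text \<open>A response in {0, 1} is the indicator whose conditional expectation the model
  prescribes. Inside an expectation, a factor \<open>y\<close> next to a function of
  \<open>x\<close> may thus be replaced by the success probability.\<close>

lemma score_orthogonal:
  fixes g :: "real^'p \<Rightarrow> real"
  assumes [measurable]: "g \<in> borel_measurable borel" and int: "integrable M (\<lambda>\<omega>. g (x \<omega>))"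
  shows "(\<integral>\<omega>. g (x \<omega>) * y \<omega> \<partial>M) = (\<integral>\<omega>. g (x \<omega>) * logistic (x \<omega> \<bullet> zero_pad emb b0) \<partial>M)"
    and "integrable M (\<lambda>\<omega>. g (x \<omega>) * y \<omega>)"
    and "integrable M (\<lambda>\<omega>. g (x \<omega>) * logistic (x \<omega> \<bullet> zero_pad emb b0))"
proof -
  let ?i = "indicator {\<omega> \<in> space M. y \<omega> = 1} :: 'a \<Rightarrow> real"
  have yi: "y \<omega> = ?i \<omega>" if "\<omega> \<in> space M" for \<omega> using y01[OF that] that by auto
  show iy: "integrable M (\<lambda>\<omega>. g (x \<omega>) * y \<omega>)"
  proof (rule Bochner_Integration.integrable_bound[OF int])
    show "AE \<omega> in M. norm (g (x \<omega>) * y \<omega>) \<le> norm (g (x \<omega>))" using y01 by force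
  qed measurable
  show "integrable M (\<lambda>\<omega>. g (x \<omega>) * logistic (x \<omega> \<bullet> zero_pad emb b0))"
  proof (rule Bochner_Integration.integrable_bound[OF int])
    have "\<bar>g v * logistic s\<bar> \<le> \<bar>g v\<bar>" for v s
      using logistic_bounds[of s] by (simp add: abs_mult mult_left_le)
    then show "AE \<omega> in M. norm (g (x \<omega>) * logistic (x \<omega> \<bullet> zero_pad emb b0)) \<le> norm (g (x \<omega>))" by simp
  qed measurable
  have eq: "(\<integral>\<omega>. g (x \<omega>) * y \<omega> \<partial>M) = (\<integral>\<omega>. g (x \<omega>) * ?i \<omega> \<partial>M)"
    by (intro Bochner_Integration.integral_cong refl arg_cong2[where f="(*)"] yi)
  have "integrable M (\<lambda>\<omega>. g (x \<omega>) * ?i \<omega>)"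
    by (rule Bochner_Integration.integrable_cong[THEN iffD1, OF refl arg_cong2[where f="(*)", OF refl yi] iy])
  then have "(\<integral>\<omega>. g (x \<omega>) * ?i \<omega> \<partial>M) = (\<integral>\<omega>. g (x \<omega>) * logistic (x \<omega> \<bullet> zero_pad emb b0) \<partial>M)"
    by (intro integral_mult_cond_exp_vimage[where N=borel] model) auto
  then show "(\<integral>\<omega>. g (x \<omega>) * y \<omega> \<partial>M) = (\<integral>\<omega>. g (x \<omega>) * logistic (x \<omega> \<bullet> zero_pad emb b0) \<partial>M)"
    using eq by simp
qed

definition cA :: "'a \<Rightarrow> real" where
  "cA \<omega> = logistic (x \<omega> \<bullet> zero_pad emb b0) * (1 - logistic (x \<omega> \<bullet> zero_pad emb b0)) * nu \<psi> (x \<omega> \<bullet> zero_pad emb b0) * w (x \<omega>)"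

definition cB :: "'a \<Rightarrow> real" where
  "cB \<omega> = logistic (x \<omega> \<bullet> zero_pad emb b0) * (1 - logistic (x \<omega> \<bullet> zero_pad emb b0)) * (nu \<psi> (x \<omega> \<bullet> zero_pad emb b0))\<^sup>2 * (w (x \<omega>))\<^sup>2"

lemma cA_measurable [measurable]: "cA \<in> borel_measurable M"
  and cB_measurable [measurable]: "cB \<in> borel_measurable M"
  unfolding cA_def[abs_def] cB_def[abs_def] by measurable

text \<open>Brings the squared weight of B under a moment assumption that contains only the first
  power of the weight.\<close>

lemma w_sq_le: "(w v)\<^sup>2 \<le> w v"
  using w_nonneg[of v] w_le_1[of v] by (simp add: power2_eq_square mult_left_le)

lemma integrable_cA: "integrable M (\<lambda>\<omega>. cA \<omega> * (norm (x \<omega>))\<^sup>2)"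
  and integrable_cB: "integrable M (\<lambda>\<omega>. cB \<omega> * (norm (x \<omega>))\<^sup>2)"
proof -
  obtain C where C: "C > 0" "\<And>t. \<bar>nu \<psi> t\<bar> \<le> C" using nu_bounds by blast
  have F: "0 \<le> logistic t * (1 - logistic t)" "logistic t * (1 - logistic t) \<le> 1" for t
    using logistic_bounds[of t] by (auto intro: mult_le_one)
  have n2: "(nu \<psi> t)\<^sup>2 \<le> C\<^sup>2" for t using C(2)[of t] C(1) by (simp add: abs_le_square_iff[symmetric])
  show "integrable M (\<lambda>\<omega>. cA \<omega> * (norm (x \<omega>))\<^sup>2)"
  proof (rule integrable_weighted[where C=C])
    fix \<omega>
    have "\<bar>cA \<omega>\<bar> \<le> 1 * C * w (x \<omega>)"
      unfolding cA_def abs_mult[of _ "w _"] abs_mult[of _ "nu _ _"]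
      using C F w_nonneg by (intro mult_mono) auto
    then have "\<bar>cA \<omega>\<bar> * (norm (x \<omega>))\<^sup>2 \<le> C * w (x \<omega>) * (1 + (norm (x \<omega>))\<^sup>2)"
      using C(1) w_nonneg by (intro mult_mono) auto
    then show "\<bar>cA \<omega> * (norm (x \<omega>))\<^sup>2\<bar> \<le> C * (w (x \<omega>) * (1 + (norm (x \<omega>))\<^sup>2))"
      by (simp add: abs_mult mult.assoc)
  qed measurable
  show "integrable M (\<lambda>\<omega>. cB \<omega> * (norm (x \<omega>))\<^sup>2)"
  proof (rule integrable_weighted[where C="C\<^sup>2"])
    fix \<omega>
    have "\<bar>cB \<omega>\<bar> \<le> 1 * C\<^sup>2 * w (x \<omega>)"
      unfolding cB_def abs_mult[of _ "(w _)\<^sup>2"] abs_mult[of _ "(nu _ _)\<^sup>2"]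
      using C F w_nonneg w_sq_le n2 by (intro mult_mono) auto
    then have "\<bar>cB \<omega>\<bar> * (norm (x \<omega>))\<^sup>2 \<le> C\<^sup>2 * w (x \<omega>) * (1 + (norm (x \<omega>))\<^sup>2)"
      using C(1) w_nonneg by (intro mult_mono) auto
    then show "\<bar>cB \<omega> * (norm (x \<omega>))\<^sup>2\<bar> \<le> C\<^sup>2 * (w (x \<omega>) * (1 + (norm (x \<omega>))\<^sup>2))"
      by (simp add: abs_mult mult.assoc)
  qed measurable
qed

lemma mat_A_eq: "mat_A M x \<psi> w (zero_pad emb b0) = (\<integral>\<omega>. cA \<omega> *\<^sub>R outer (x \<omega>) \<partial>M)"
  and mat_B_eq: "mat_B M x \<psi> w (zero_pad emb b0) = (\<integral>\<omega>. cB \<omega> *\<^sub>R outer (x \<omega>) \<partial>M)"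
  by (simp_all add: mat_A_def mat_B_def cA_def cB_def)

lemmas A_act_entry = submat_moment_entry[OF x_meas cA_measurable integrable_cA, of emb, folded mat_A_eq]
  and A_act_integrable = submat_moment_integrable[OF x_meas cA_measurable integrable_cA, of emb]
  and A_act_transpose = submat_moment_transpose[OF x_meas cA_measurable integrable_cA, of emb, folded mat_A_eq]
  and A_act_bilinear = submat_moment_bilinear[OF x_meas cA_measurable integrable_cA, of _ emb, folded mat_A_eq]
  and B_act_transpose = submat_moment_transpose[OF x_meas cB_measurable integrable_cB, of emb, folded mat_B_eq]
  and B_act_bilinear = submat_moment_bilinear[OF x_meas cB_measurable integrable_cB, of _ emb, folded mat_B_eq]

lemma abs_inner_act_le: "\<bar>u \<bullet> act v\<bar> \<le> norm u * norm v"
  by (rule order_trans[OF Cauchy_Schwarz_ineq2]) (intro mult_left_mono norm_blockA_le emb norm_ge_zero)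

lemma B_act_posdef:
  assumes inv: "invertible A_act" and v: "v \<noteq> 0"
  shows "v \<bullet> (B_act *v v) > 0"
proof -
  let ?f = "\<lambda>\<omega>. cB \<omega> * ((v \<bullet> act (x \<omega>)) * (v \<bullet> act (x \<omega>)))"
  have F: "0 < logistic t * (1 - logistic t)" for t using logistic_bounds[of t] by simp
  have f0: "?f \<omega> \<ge> 0" for \<omega> using F[of "x \<omega> \<bullet> zero_pad emb b0"] by (simp add: cB_def)
  have if': "integrable M ?f"
  proof (rule Bochner_Integration.integrable_bound[OF integrable_mult_right[OF integrable_cB, of "(norm v)\<^sup>2"]])
    have "\<bar>v \<bullet> act u\<bar> * \<bar>v \<bullet> act u\<bar> \<le> (norm v)\<^sup>2 * (norm u)\<^sup>2" for u
      using mult_mono[OF abs_inner_act_le[of v u] abs_inner_act_le[of v u]] by (simp add: power2_eq_square mult_ac)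
    then have "\<bar>cB \<omega>\<bar> * (\<bar>v \<bullet> act (x \<omega>)\<bar> * \<bar>v \<bullet> act (x \<omega>)\<bar>) \<le> \<bar>cB \<omega>\<bar> * ((norm v)\<^sup>2 * (norm (x \<omega>))\<^sup>2)" for \<omega>
      by (intro mult_left_mono) auto
    then show "AE \<omega> in M. norm (?f \<omega>) \<le> norm ((norm v)\<^sup>2 * (cB \<omega> * (norm (x \<omega>))\<^sup>2))"
      by (intro AE_I2) (simp only: real_norm_def abs_mult abs_power2 mult.left_commute[of "(norm v)\<^sup>2"])
  qed measurable
  have "v \<bullet> (B_act *v v) \<noteq> 0"
  proof
    assume "v \<bullet> (B_act *v v) = 0"
    then have "AE \<omega> in M. ?f \<omega> = 0"
      unfolding B_act_bilinear using if' f0 by (subst (asm) integral_nonneg_eq_0_iff_AE) auto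
    \<comment> \<open>The positive factor F (1 - F) can be divided out of \<open>cB\<close>, leaving
      the square of nu w (v . x). Its root is a factor of the integrand of u . A v for every
      u.\<close>
    then have AE0: "AE \<omega> in M. cA \<omega> * ((u \<bullet> act (x \<omega>)) * (v \<bullet> act (x \<omega>))) = 0" for u
    proof eventually_elim
      case (elim \<omega>)
      then have "nu \<psi> (x \<omega> \<bullet> zero_pad emb b0) * w (x \<omega>) * (v \<bullet> act (x \<omega>)) = 0"
        using F[of "x \<omega> \<bullet> zero_pad emb b0"] by (auto simp: cB_def)
      then show ?case by (auto simp: cA_def)
    qed
    have "u \<bullet> (A_act *v v) = 0" for u
      unfolding A_act_bilinear using AE0[of u] by (subst integral_cong_AE[where g="\<lambda>_. 0"]) auto
    then have "A_act *v v = 0" by (metis inner_eq_zero_iff)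
    then have "matrix_inv A_act *v (A_act *v v) = 0" by simp
    then show False using v by (simp add: matrix_vector_mul_assoc matrix_inv_left[OF inv])
  qed
  moreover have "v \<bullet> (B_act *v v) \<ge> 0"
    unfolding B_act_bilinear using f0 by (intro integral_nonneg_AE) auto
  ultimately show ?thesis by simp
qed

text \<open>Fisher consistency: given \<open>x\<close>, the factor F - y has mean zero, and all
  other factors are functions of \<open>x\<close>.\<close>

lemma score_mean: "(\<integral>\<omega>. score (y \<omega>) (act (x \<omega>) \<bullet> b0) * w (x \<omega>) * (u \<bullet> act (x \<omega>)) \<partial>M) = 0"
proof -
  define g where "g v = nu \<psi> (v \<bullet> zero_pad emb b0) * w v * (u \<bullet> act v)" for v
  have [measurable]: "g \<in> borel_measurable borel" unfolding g_def[abs_def] by measurable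
  obtain C where C: "C > 0" "\<And>t. \<bar>nu \<psi> t\<bar> \<le> C" using nu_bounds by blast
  have int: "integrable M (\<lambda>\<omega>. g (x \<omega>))"
  proof (rule integrable_weighted[where C="C * norm u"])
    fix \<omega>
    have "norm (x \<omega>) \<le> 1 + (norm (x \<omega>))\<^sup>2"
    proof -
      have "2 * norm (x \<omega>) \<le> 1 + (norm (x \<omega>))\<^sup>2"
        using zero_le_power2[of "norm (x \<omega>) - 1"] by (simp add: power2_eq_square algebra_simps)
      then show ?thesis using norm_ge_zero[of "x \<omega>"] by linarith
    qed
    then have "\<bar>u \<bullet> act (x \<omega>)\<bar> \<le> norm u * (1 + (norm (x \<omega>))\<^sup>2)"
      using abs_inner_act_le[of u "x \<omega>"] by (meson mult_left_mono norm_ge_zero order_trans)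
    then have "\<bar>g (x \<omega>)\<bar> \<le> C * w (x \<omega>) * (norm u * (1 + (norm (x \<omega>))\<^sup>2))"
      unfolding g_def abs_mult using C w_nonneg by (intro mult_mono) auto
    then show "\<bar>g (x \<omega>)\<bar> \<le> C * norm u * (w (x \<omega>) * (1 + (norm (x \<omega>))\<^sup>2))" by (simp add: mult_ac)
  qed measurable
  have "(\<integral>\<omega>. score (y \<omega>) (act (x \<omega>) \<bullet> b0) * w (x \<omega>) * (u \<bullet> act (x \<omega>)) \<partial>M)
     = (\<integral>\<omega>. g (x \<omega>) * logistic (x \<omega> \<bullet> zero_pad emb b0) - g (x \<omega>) * y \<omega> \<partial>M)"
    by (intro Bochner_Integration.integral_cong refl)
       (simp add: score_def g_def inner_zero_pad[OF emb] algebra_simps)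
  also have "\<dots> = 0" using score_orthogonal[OF _ int] by simp
  finally show ?thesis .
qed

text \<open>For y in {0, 1} the square (F - y)^2 equals F^2 + (1 - 2 F) y, which is linear in y.
  Replacing y by F gives the Bernoulli variance F (1 - F), the factor that appears in B.\<close>

lemma score_second_moment:
  "(\<integral>\<omega>. (score (y \<omega>) (act (x \<omega>) \<bullet> b0) * w (x \<omega>) * (u \<bullet> act (x \<omega>)))\<^sup>2 \<partial>M) = u \<bullet> (B_act *v u)"
proof -
  define g where "g v = (nu \<psi> (v \<bullet> zero_pad emb b0))\<^sup>2 * (w v)\<^sup>2 * (u \<bullet> act v)\<^sup>2" for v
  define L where "L v = logistic (v \<bullet> zero_pad emb b0)" for v
  have [measurable]: "g \<in> borel_measurable borel" "L \<in> borel_measurable borel" unfolding g_def[abs_def] L_def[abs_def] by measurable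
  obtain C where C: "C > 0" "\<And>t. \<bar>nu \<psi> t\<bar> \<le> C" using nu_bounds by blast
  have int: "integrable M (\<lambda>\<omega>. g (x \<omega>))"
  proof (rule integrable_weighted[where C="C\<^sup>2 * (norm u)\<^sup>2"])
    fix \<omega>
    have "(u \<bullet> act (x \<omega>))\<^sup>2 \<le> (norm u)\<^sup>2 * (norm (x \<omega>))\<^sup>2"
      using abs_inner_act_le[of u "x \<omega>"] by (simp add: power_mult_distrib[symmetric] abs_le_square_iff[symmetric] abs_mult)
    also have "\<dots> \<le> (norm u)\<^sup>2 * (1 + (norm (x \<omega>))\<^sup>2)" by (intro mult_left_mono) auto
    finally have "\<bar>(u \<bullet> act (x \<omega>))\<^sup>2\<bar> \<le> (norm u)\<^sup>2 * (1 + (norm (x \<omega>))\<^sup>2)" by simp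
    moreover have "\<bar>(nu \<psi> t)\<^sup>2\<bar> \<le> C\<^sup>2" for t using C(2)[of t] C(1) by (simp add: abs_le_square_iff[symmetric])
    moreover have "\<bar>(w v)\<^sup>2\<bar> \<le> w v" for v using w_sq_le by simp
    ultimately have "\<bar>g (x \<omega>)\<bar> \<le> C\<^sup>2 * w (x \<omega>) * ((norm u)\<^sup>2 * (1 + (norm (x \<omega>))\<^sup>2))"
      unfolding g_def abs_mult[of _ "(u \<bullet> _)\<^sup>2"] abs_mult[of _ "(w _)\<^sup>2"]
      using C w_nonneg by (intro mult_mono) auto
    then show "\<bar>g (x \<omega>)\<bar> \<le> C\<^sup>2 * (norm u)\<^sup>2 * (w (x \<omega>) * (1 + (norm (x \<omega>))\<^sup>2))" by (simp add: mult_ac)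
  qed measurable
  note s1 = score_orthogonal[OF _ int, folded L_def]
  have int2: "integrable M (\<lambda>\<omega>. g (x \<omega>) * (1 - 2 * L (x \<omega>)))"
  proof -
    have "integrable M (\<lambda>\<omega>. g (x \<omega>) - 2 * (g (x \<omega>) * L (x \<omega>)))" using int s1(3) by simp
    then show ?thesis by (simp add: right_diff_distrib mult.left_commute)
  qed
  note s2 = score_orthogonal[of "\<lambda>v. g v * (1 - 2 * L v)", OF _ int2, folded L_def]
  have int3: "integrable M (\<lambda>\<omega>. g (x \<omega>) * L (x \<omega>))" using s1(3) by simp
  note s3 = score_orthogonal(3)[of "\<lambda>v. g v * L v", OF _ int3, folded L_def]
  have "(\<integral>\<omega>. (score (y \<omega>) (act (x \<omega>) \<bullet> b0) * w (x \<omega>) * (u \<bullet> act (x \<omega>)))\<^sup>2 \<partial>M)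
     = (\<integral>\<omega>. g (x \<omega>) * L (x \<omega>) * L (x \<omega>) + g (x \<omega>) * (1 - 2 * L (x \<omega>)) * y \<omega> \<partial>M)"
  proof (intro Bochner_Integration.integral_cong refl)
    fix \<omega> assume "\<omega> \<in> space M"
    then have "(L (x \<omega>) - y \<omega>)\<^sup>2 = L (x \<omega>) * L (x \<omega>) + (1 - 2 * L (x \<omega>)) * y \<omega>"
      using y01[of \<omega>] by (auto simp: power2_eq_square algebra_simps)
    then have "g (x \<omega>) * (L (x \<omega>) - y \<omega>)\<^sup>2 = g (x \<omega>) * L (x \<omega>) * L (x \<omega>) + g (x \<omega>) * (1 - 2 * L (x \<omega>)) * y \<omega>"
      by (simp only: distrib_left mult.assoc)
    then show "(score (y \<omega>) (act (x \<omega>) \<bullet> b0) * w (x \<omega>) * (u \<bullet> act (x \<omega>)))\<^sup>2 = g (x \<omega>) * L (x \<omega>) * L (x \<omega>) + g (x \<omega>) * (1 - 2 * L (x \<omega>)) * y \<omega>"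
      by (simp add: score_def g_def L_def inner_zero_pad[OF emb] power_mult_distrib mult_ac)
  qed
  also have "\<dots> = (\<integral>\<omega>. g (x \<omega>) * L (x \<omega>) * L (x \<omega>) \<partial>M) + (\<integral>\<omega>. g (x \<omega>) * (1 - 2 * L (x \<omega>)) * L (x \<omega>) \<partial>M)"
    using s2 s3 by simp
  also have "\<dots> = (\<integral>\<omega>. g (x \<omega>) * L (x \<omega>) * L (x \<omega>) + g (x \<omega>) * (1 - 2 * L (x \<omega>)) * L (x \<omega>) \<partial>M)"
    using s2(3) s3 by simp
  also have "\<dots> = (\<integral>\<omega>. cB \<omega> * ((u \<bullet> act (x \<omega>)) * (u \<bullet> act (x \<omega>))) \<partial>M)"
    by (intro Bochner_Integration.integral_cong refl)
       (simp add: g_def L_def cB_def power2_eq_square algebra_simps)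
  finally show ?thesis by (simp only: B_act_bilinear)
qed

text \<open>The term with \<open>nu'\<close> carries the factor F - y and so integrates to zero;
  what remains of the second derivative of the loss is the integrand of A.\<close>

lemma score'_moment:
  "(\<integral>\<omega>. score' (y \<omega>) (act (x \<omega>) \<bullet> b0) * w (x \<omega>) * (act (x \<omega>) $ i * act (x \<omega>) $ j) \<partial>M) = A_act $ i $ j"
proof -
  define g where "g v = nu' (v \<bullet> zero_pad emb b0) * w v * (act v $ i * act v $ j)" for v
  have [measurable]: "g \<in> borel_measurable borel" unfolding g_def[abs_def] by measurable
  obtain C where C: "C > 0" "\<And>t. \<bar>nu' t\<bar> \<le> C" using nu_bounds by blast
  have int: "integrable M (\<lambda>\<omega>. g (x \<omega>))"
  proof (rule integrable_weighted[where C="C"])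
    fix \<omega>
    have "\<bar>act (x \<omega>) $ i * act (x \<omega>) $ j\<bar> \<le> norm (x \<omega>) * norm (x \<omega>)"
      unfolding abs_mult blockA_def by (intro mult_mono) (auto simp: component_le_norm_cart)
    also have "\<dots> \<le> 1 + (norm (x \<omega>))\<^sup>2" by (simp add: power2_eq_square)
    finally have "\<bar>g (x \<omega>)\<bar> \<le> C * w (x \<omega>) * (1 + (norm (x \<omega>))\<^sup>2)"
      unfolding g_def abs_mult[of _ "_ * _ $ j"] abs_mult[of "nu' _"] using C w_nonneg by (intro mult_mono) auto
    then show "\<bar>g (x \<omega>)\<bar> \<le> C * (w (x \<omega>) * (1 + (norm (x \<omega>))\<^sup>2))" by (simp add: mult_ac)
  qed measurable
  note so = score_orthogonal[OF _ int]
  have "(\<integral>\<omega>. score' (y \<omega>) (act (x \<omega>) \<bullet> b0) * w (x \<omega>) * (act (x \<omega>) $ i * act (x \<omega>) $ j) \<partial>M)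
     = (\<integral>\<omega>. cA \<omega> * (act (x \<omega>) $ i * act (x \<omega>) $ j) + (g (x \<omega>) * logistic (x \<omega> \<bullet> zero_pad emb b0) - g (x \<omega>) * y \<omega>) \<partial>M)"
    by (intro Bochner_Integration.integral_cong refl)
       (simp add: score'_def g_def cA_def inner_zero_pad[OF emb] algebra_simps)
  also have "\<dots> = (\<integral>\<omega>. cA \<omega> * (act (x \<omega>) $ i * act (x \<omega>) $ j) \<partial>M)"
    using so A_act_integrable[of i j] by simp
  finally show ?thesis by (simp only: A_act_entry)
qed

lemma integrable_score_weight:
  assumes [measurable]: "f \<in> borel_measurable M"
    and f: "\<And>\<omega>. \<omega> \<in> space M \<Longrightarrow> \<bar>f \<omega>\<bar> \<le> C * (1 + \<bar>y \<omega>\<bar>) * (w (x \<omega>) * (norm (act (x \<omega>)))\<^sup>2)"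
    and C: "C \<ge> 0"
  shows "integrable M f"
\<comment> \<open>The 2 bounds 1 + |y| for y in {0, 1}.\<close>
proof (rule integrable_weighted[where C="2 * C"])
  fix \<omega> assume w: "\<omega> \<in> space M"
  have "(norm (act (x \<omega>)))\<^sup>2 \<le> 1 + (norm (x \<omega>))\<^sup>2"
  proof -
    have "(norm (act (x \<omega>)))\<^sup>2 \<le> (norm (x \<omega>))\<^sup>2" by (intro power_mono norm_blockA_le emb norm_ge_zero)
    then show ?thesis by linarith
  qed
  then have "C * (1 + \<bar>y \<omega>\<bar>) * (w (x \<omega>) * (norm (act (x \<omega>)))\<^sup>2) \<le> C * 2 * (w (x \<omega>) * (1 + (norm (x \<omega>))\<^sup>2))"
    using y01[OF w] C w_nonneg by (intro mult_mono mult_left_mono) auto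
  then show "\<bar>f \<omega>\<bar> \<le> 2 * C * (w (x \<omega>) * (1 + (norm (x \<omega>))\<^sup>2))" using f[OF w] by (simp add: mult_ac)
qed measurable

end

section \<open>The estimating equation\<close>

text \<open>A minimizer over the whole space also minimizes along each active coordinate line
  through it. Along such a line the loss is differentiable and the penalty has its partial
  derivative, so Fermat's rule applies coordinate by coordinate, without joint differentiability of
  the penalty.\<close>

lemma (in robust_loss) penalized_first_order:
  fixes emb :: "'k::finite \<Rightarrow> 'p::finite" and pen :: "real ^ 'p \<Rightarrow> real"
  assumes emb: "inj emb"
    and min: "is_arg_min (\<lambda>\<beta>. emp_loss \<rho> \<psi> w ys xs n \<beta> + pen \<beta>) (\<lambda>_. True) (zero_pad emb b)"
    and part: "has_partials_at (\<lambda>b. pen (zero_pad emb b)) b"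
  shows "(1 / real n) *\<^sub>R (\<Sum>i=1..n. (score (ys i) (blockA emb (xs i) \<bullet> b) * w (xs i)) *\<^sub>R blockA emb (xs i))
    = - grad (\<lambda>b. pen (zero_pad emb b)) b"
proof -
  have "((1 / real n) *\<^sub>R (\<Sum>i=1..n. (score (ys i) (blockA emb (xs i) \<bullet> b) * w (xs i)) *\<^sub>R blockA emb (xs i))) $ j
    = - grad (\<lambda>b. pen (zero_pad emb b)) b $ j" for j
  proof -
    let ?a = "\<lambda>i. blockA emb (xs i)"
    let ?e = "\<lambda>s::real. emp_loss \<rho> \<psi> w ys xs n (zero_pad emb (b + s *\<^sub>R axis j 1))"
    let ?q = "\<lambda>s::real. pen (zero_pad emb (b + s *\<^sub>R axis j 1))"
    have lin: "?a i \<bullet> (b + s *\<^sub>R axis j 1) = ?a i \<bullet> b + s * ?a i $ j" for i s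
      by (simp add: inner_add_right inner_axis)
    have dt: "((\<lambda>s. loss_phi \<rho> \<psi> (ys i) (?a i \<bullet> b + s * ?a i $ j)) has_real_derivative score (ys i) (?a i \<bullet> b) * ?a i $ j) (at 0)" for i
    proof (rule DERIV_chain2[where f="loss_phi \<rho> \<psi> (ys i)" and g="\<lambda>s. ?a i \<bullet> b + s * ?a i $ j"])
      show "(loss_phi \<rho> \<psi> (ys i) has_real_derivative score (ys i) (?a i \<bullet> b)) (at (?a i \<bullet> b + 0 * ?a i $ j))"
        using loss_phi_deriv[of "ys i" "?a i \<bullet> b"] by (simp add: score_def)
      show "((\<lambda>s. ?a i \<bullet> b + s * ?a i $ j) has_real_derivative ?a i $ j) (at 0)"
        by (auto intro!: derivative_eq_intros)
    qed
    have d1: "(?e has_real_derivative (1 / real n) * (\<Sum>i=1..n. score (ys i) (?a i \<bullet> b) * ?a i $ j * w (xs i))) (at 0)"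
      unfolding emp_loss_def inner_zero_pad[OF emb] lin
      by (intro DERIV_cmult DERIV_sum DERIV_cmult_right dt)
    have d2: "(?q has_real_derivative deriv ?q 0) (at 0)"
      using part unfolding has_partials_at_def by (simp add: DERIV_deriv_iff_real_differentiable)
    have "(1 / real n) * (\<Sum>i=1..n. score (ys i) (?a i \<bullet> b) * ?a i $ j * w (xs i)) + deriv ?q 0 = 0"
    proof (rule DERIV_local_min[OF DERIV_add[OF d1 d2] zero_less_one], intro allI impI)
      show "?e 0 + ?q 0 \<le> ?e s + ?q s" for s
        using min by (auto simp: is_arg_min_linorder)
    qed
    then show ?thesis
      by (simp add: grad_def mult_ac)
  qed
  then show ?thesis by (simp add: vec_eq_iff)
qed

text \<open>The law of large numbers is applied entry by entry; the crude factor k^2 is compensated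
  later by the choice of the entrywise tolerance.\<close>

lemma norm_matrix_vector_le:
  fixes D :: "real^'k::finite^'k"
  assumes "\<And>i j. \<bar>D $ i $ j\<bar> \<le> \<kappa>"
  shows "norm (D *v h) \<le> (real CARD('k))\<^sup>2 * \<kappa> * norm h"
proof -
  have k0: "\<kappa> \<ge> 0" using assms[of undefined undefined] by linarith
  have "norm (D *v h) \<le> (\<Sum>i\<in>UNIV. \<bar>(D *v h) $ i\<bar>)" by (rule norm_le_l1_cart)
  also have "\<dots> \<le> (\<Sum>i\<in>(UNIV::'k set). real CARD('k) * (\<kappa> * norm h))"
  proof (rule sum_mono)
    fix i
    have "\<bar>(D *v h) $ i\<bar> \<le> (\<Sum>j\<in>UNIV. \<bar>D $ i $ j * h $ j\<bar>)"
      unfolding matrix_vector_mult_def by (simp add: sum_abs)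
    also have "\<dots> \<le> (\<Sum>j\<in>(UNIV::'k set). \<kappa> * norm h)"
      unfolding abs_mult using assms k0 by (intro sum_mono mult_mono) (auto simp: component_le_norm_cart)
    finally show "\<bar>(D *v h) $ i\<bar> \<le> real CARD('k) * (\<kappa> * norm h)" by simp
  qed
  also have "\<dots> = (real CARD('k))\<^sup>2 * \<kappa> * norm h" by (simp add: power2_eq_square)
  finally show ?thesis .
qed

text \<open>The deterministic core of the expansion, for one realization. The coefficients
  \<open>m\<close> may differ between observations, since the quality of the Taylor bound depends on
  the size of the covariate. The error is expressed through the rescaled \<open>h\<close> itself,
  ready to be absorbed.\<close>

lemma (in robust_loss) linearized_estimating_equation:
  fixes A Ai :: "real^'k::finite^'k" and a :: "nat \<Rightarrow> real^'k" and Y W m :: "nat \<Rightarrow> real"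
  assumes n: "n \<ge> 1" and AiA: "Ai ** A = mat 1" and c: "\<And>v. norm (Ai *v v) \<le> c * norm v" "c \<ge> 0"
    and W: "\<And>l. W l \<ge> 0"
    and fo: "(1 / real n) *\<^sub>R (\<Sum>l=1..n. (score (Y l) (a l \<bullet> (b0 + h)) * W l) *\<^sub>R a l) = - p"
    and ent: "\<And>i j. \<bar>(\<Sum>l=1..n. score' (Y l) (a l \<bullet> b0) * W l * (a l $ i * a l $ j)) / real n - A $ i $ j\<bar> \<le> \<kappa>"
    and rem: "\<And>l. \<bar>score (Y l) (a l \<bullet> (b0 + h)) - score (Y l) (a l \<bullet> b0) - score' (Y l) (a l \<bullet> b0) * (a l \<bullet> h)\<bar>
       \<le> m l * \<bar>a l \<bullet> h\<bar>"
    and m: "\<And>l. m l \<ge> 0"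
    and avg: "(\<Sum>l=1..n. m l * (W l * (norm (a l))\<^sup>2)) / real n \<le> \<kappa>'"
  shows "norm (sqrt (real n) *\<^sub>R h - (1 / sqrt (real n)) *\<^sub>R (\<Sum>l=1..n. - (score (Y l) (a l \<bullet> b0) * W l) *\<^sub>R (Ai *v a l)))
    \<le> c * (sqrt (real n) * norm p + ((real CARD('k))\<^sup>2 * \<kappa> + \<kappa>') * norm (sqrt (real n) *\<^sub>R h))"
proof -
  define r where "r l = score (Y l) (a l \<bullet> (b0 + h)) - score (Y l) (a l \<bullet> b0) - score' (Y l) (a l \<bullet> b0) * (a l \<bullet> h)" for l
  define H where "H = (\<chi> i j. (\<Sum>l=1..n. score' (Y l) (a l \<bullet> b0) * W l * (a l $ i * a l $ j)) / real n)"
  define s0 where "s0 = (1 / real n) *\<^sub>R (\<Sum>l=1..n. (score (Y l) (a l \<bullet> b0) * W l) *\<^sub>R a l)"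
  define R where "R = (1 / real n) *\<^sub>R (\<Sum>l=1..n. (r l * W l) *\<^sub>R a l)"
  have n0: "real n > 0" using n by simp
  have Hh: "H *v h = (1 / real n) *\<^sub>R (\<Sum>l=1..n. (score' (Y l) (a l \<bullet> b0) * (a l \<bullet> h) * W l) *\<^sub>R a l)"
  proof -
    have "(H *v h) $ i = (\<Sum>j\<in>UNIV. \<Sum>l=1..n. score' (Y l) (a l \<bullet> b0) * W l * (a l $ i * a l $ j) * h $ j / real n)" for i
      by (simp add: H_def matrix_vector_mult_def sum_divide_distrib sum_distrib_right)
    also have "\<dots> i = (\<Sum>l=1..n. \<Sum>j\<in>UNIV. score' (Y l) (a l \<bullet> b0) * W l * (a l $ i * a l $ j) * h $ j / real n)" for i
      by (rule sum.swap)
    also have "\<dots> i = ((1 / real n) *\<^sub>R (\<Sum>l=1..n. (score' (Y l) (a l \<bullet> b0) * (a l \<bullet> h) * W l) *\<^sub>R a l)) $ i" for i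
      by (simp add: inner_vec_def sum_distrib_left sum_distrib_right sum_divide_distrib mult_ac)
    finally show ?thesis by (simp add: vec_eq_iff)
  qed
  have "- p = s0 + H *v h + R"
    unfolding fo[symmetric] s0_def Hh R_def r_def scaleR_add_right[symmetric] sum.distrib[symmetric] scaleR_add_left[symmetric]
    by (intro arg_cong2[where f=scaleR] sum.cong refl) (simp add: algebra_simps)
  then have s0: "s0 = - p - H *v h - R" by simp
  \<comment> \<open>An exact identity that isolates the three sources of error: the deviation of the
    empirical matrix from A, the penalty gradient, and the Taylor remainder.\<close>
  have key: "A *v h + s0 = (A - H) *v h - p - R"
    unfolding s0 by (simp add: matrix_vector_mult_diff_rdistrib)
  have nR: "norm R \<le> \<kappa>' * norm h"
  proof -
    have "norm (\<Sum>l=1..n. (r l * W l) *\<^sub>R a l) \<le> (\<Sum>l=1..n. m l * (W l * (norm (a l))\<^sup>2) * norm h)"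
    proof (rule sum_norm_le)
      fix l
      have "\<bar>r l\<bar> \<le> m l * (norm (a l) * norm h)"
        using rem[of l] mult_left_mono[OF Cauchy_Schwarz_ineq2[of "a l" h] m[of l]] unfolding r_def by linarith
      then have "\<bar>r l\<bar> * (W l * norm (a l)) \<le> m l * (norm (a l) * norm h) * (W l * norm (a l))"
        using W by (intro mult_right_mono) auto
      then show "norm ((r l * W l) *\<^sub>R a l) \<le> m l * (W l * (norm (a l))\<^sup>2) * norm h"
        using W[of l] by (simp add: abs_mult power2_eq_square mult_ac)
    qed
    also have "\<dots> = (\<Sum>l=1..n. m l * (W l * (norm (a l))\<^sup>2)) * norm h" by (simp add: sum_distrib_right)
    finally have "norm R \<le> (\<Sum>l=1..n. m l * (W l * (norm (a l))\<^sup>2)) / real n * norm h"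
      using n0 by (simp add: R_def divide_right_mono)
    also have "\<dots> \<le> \<kappa>' * norm h" using avg by (intro mult_right_mono) auto
    finally show ?thesis .
  qed
  have nAH: "norm ((A - H) *v h) \<le> (real CARD('k))\<^sup>2 * \<kappa> * norm h"
    using ent by (intro norm_matrix_vector_le) (simp add: H_def abs_minus_commute)
  have sn: "sqrt (real n) / real n = 1 / sqrt (real n)"
    using n0 by (simp add: field_simps)
  have "(\<Sum>l=1..n. - (score (Y l) (a l \<bullet> b0) * W l) *\<^sub>R (Ai *v a l)) = - (Ai *v (\<Sum>l=1..n. (score (Y l) (a l \<bullet> b0) * W l) *\<^sub>R a l))"
    by (simp add: linear_sum[OF matrix_vector_mul_linear] matrix_vector_mult_scaleR sum_negf)
  then have U: "(1 / sqrt (real n)) *\<^sub>R (\<Sum>l=1..n. - (score (Y l) (a l \<bullet> b0) * W l) *\<^sub>R (Ai *v a l)) = - (sqrt (real n) *\<^sub>R (Ai *v s0))"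
    by (simp add: s0_def matrix_vector_mult_scaleR sn)
  have "h = Ai *v (A *v h)" by (simp add: matrix_vector_mul_assoc AiA)
  then have "sqrt (real n) *\<^sub>R h - (1 / sqrt (real n)) *\<^sub>R (\<Sum>l=1..n. - (score (Y l) (a l \<bullet> b0) * W l) *\<^sub>R (Ai *v a l))
     = sqrt (real n) *\<^sub>R (Ai *v (A *v h + s0))"
    unfolding U by (simp add: matrix_vector_right_distrib scaleR_add_right)
  also have "norm \<dots> \<le> sqrt (real n) * (c * norm (A *v h + s0))"
    using c(1)[of "A *v h + s0"] by (simp add: mult_left_mono)
  also have "\<dots> \<le> sqrt (real n) * (c * (norm p + ((real CARD('k))\<^sup>2 * \<kappa> + \<kappa>') * norm h))"
  proof (intro mult_left_mono c(2) real_sqrt_ge_zero)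
    have "norm (A *v h + s0) \<le> norm ((A - H) *v h) + norm p + norm R"
      unfolding key using norm_triangle_ineq4[of "(A - H) *v h - p" R] norm_triangle_ineq4[of "(A - H) *v h" p] by linarith
    then show "norm (A *v h + s0) \<le> norm p + ((real CARD('k))\<^sup>2 * \<kappa> + \<kappa>') * norm h"
      using nR nAH by (simp add: algebra_simps)
  qed simp
  also have "\<dots> = c * (sqrt (real n) * norm p + ((real CARD('k))\<^sup>2 * \<kappa> + \<kappa>') * norm (sqrt (real n) *\<^sub>R h))"
    by (simp add: algebra_simps)
  finally show ?thesis .
qed

section \<open>Asymptotic normality\<close>

theorem theorem5p7:
  fixes M :: "'a measure"
    and y :: "'a \<Rightarrow> real" and x :: "'a \<Rightarrow> real ^ 'p::finite"
    and Y :: "nat \<Rightarrow> 'a \<Rightarrow> real" and X :: "nat \<Rightarrow> 'a \<Rightarrow> real ^ 'p"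
    and emb :: "'k::finite \<Rightarrow> 'p"
    and \<beta>0A :: "real ^ 'k" and \<beta>0 :: "real ^ 'p"
    and \<rho> \<psi> \<psi>' :: "real \<Rightarrow> real"
    and w :: "real ^ 'p \<Rightarrow> real"
    and I :: "real \<Rightarrow> real ^ 'p \<Rightarrow> real" and lam :: "nat \<Rightarrow> real"
    and \<beta>hat :: "nat \<Rightarrow> 'a \<Rightarrow> real ^ 'p"
    and \<delta> :: real
  assumes prob: "prob_space M"
    \<comment> \<open>the generic pair and its i.i.d. copies\<close>
    and y_meas: "y \<in> borel_measurable M" and x_meas: "x \<in> borel_measurable M"
    and y01: "\<forall>\<omega>\<in>space M. y \<omega> \<in> {0, 1}"
    and indep: "prob_space.indep_vars M (\<lambda>_. borel) (\<lambda>i \<omega>. (Y i \<omega>, X i \<omega>)) {1..}"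
    and ident: "\<forall>i\<ge>1. distr M borel (\<lambda>\<omega>. (Y i \<omega>, X i \<omega>)) = distr M borel (\<lambda>\<omega>. (y \<omega>, x \<omega>))"
    \<comment> \<open>the logistic model with sparse true parameter\<close>
    and emb: "inj emb"
    and \<beta>0: "\<beta>0 = zero_pad emb \<beta>0A" and \<beta>0A_nz: "\<forall>i. \<beta>0A $ i \<noteq> 0"
    and model: "AE \<omega> in M. real_cond_exp M (vimage_algebra (space M) x borel)
                  (indicator {\<omega> \<in> space M. y \<omega> = 1}) \<omega> = logistic (x \<omega> \<bullet> \<beta>0)"
    \<comment> \<open>the loss function, including (R3)\<close>
    and \<rho>_bdd: "bounded (\<rho> ` {0..})" and \<rho>_mono: "mono_on {0..} \<rho>"
    and \<rho>_deriv: "\<forall>t\<ge>0. (\<rho> has_real_derivative \<psi> t) (at t within {0..})"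
    and \<psi>_deriv: "\<forall>t\<ge>0. (\<psi> has_real_derivative \<psi>' t) (at t within {0..})"
    and \<psi>'_cont: "continuous_on {0..} \<psi>'"
    and \<psi>_bdd: "bounded (\<psi> ` {0..})" and \<psi>'_bdd: "bounded (\<psi>' ` {0..})"
    \<comment> \<open>(H2) and (H3)\<close>
    and w_meas: "w \<in> borel_measurable borel" and w_nonneg: "\<forall>v. w v \<ge> 0"
    and w_bdd: "bounded (range w)" and w_sup: "(SUP v. \<bar>w v\<bar>) = 1"
    and w_supp: "measure M {\<omega> \<in> space M. x \<omega> \<in> {v. w v > 0}} > 0"
    and H3: "integrable M (\<lambda>\<omega>. w (x \<omega>) * (norm (x \<omega>))\<^sup>2)"
    \<comment> \<open>the penalty\<close>
    and I_nonneg: "\<forall>l>0. \<forall>\<beta>. I l \<beta> \<ge> 0"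
    and lam_pos: "\<forall>n\<ge>1. lam n > 0"
    and \<delta>_pos: "\<delta> > 0"
    and I_grad: "\<forall>n\<ge>1. \<forall>b\<in>cball \<beta>0A \<delta>. has_partials_at (\<lambda>b. I (lam n) (zero_pad emb b)) b"
    and I_grad_bdd: "\<forall>\<^sub>F n in sequentially.
          bdd_above ((\<lambda>b. norm (grad (\<lambda>b. I (lam n) (zero_pad emb b)) b)) ` cball \<beta>0A \<delta>)"
    and I_grad_small: "(\<lambda>n. SUP b\<in>cball \<beta>0A \<delta>. norm (grad (\<lambda>b. I (lam n) (zero_pad emb b)) b))
          \<in> o(\<lambda>n. 1 / sqrt (real n))"
    \<comment> \<open>the estimator\<close>
    and \<beta>hat_meas: "\<forall>n\<ge>1. \<beta>hat n \<in> borel_measurable M"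
    and \<beta>hat_min: "\<forall>n\<ge>1. \<forall>\<omega>\<in>space M.
          is_arg_min (\<lambda>\<beta>. emp_loss \<rho> \<psi> w (\<lambda>i. Y i \<omega>) (\<lambda>i. X i \<omega>) n \<beta> + I (lam n) \<beta>)
            (\<lambda>_. True) (\<beta>hat n \<omega>)"
    and sparse: "(\<lambda>n. measure M {\<omega> \<in> space M. \<forall>j. j \<notin> range emb \<longrightarrow> \<beta>hat n \<omega> $ j = 0}) \<longlonglongrightarrow> 1"
    and consistent: "converges_in_prob M \<beta>hat \<beta>0"
    and A_inv: "invertible (submat emb (mat_A M x \<psi> w \<beta>0))"
  shows "converges_in_distr M
           (\<lambda>n \<omega>. sqrt (real n) *\<^sub>R (blockA emb (\<beta>hat n \<omega>) - \<beta>0A))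
           (mvn 0 (matrix_inv (submat emb (mat_A M x \<psi> w \<beta>0))
                   ** submat emb (mat_B M x \<psi> w \<beta>0)
                   ** matrix_inv (submat emb (mat_A M x \<psi> w \<beta>0))))"
proof -
  interpret prob_space M by (rule prob)
  have w_le_1: "w v \<le> 1" for v
  proof -
    \<comment> \<open>A real supremum bounds its family only if the family is bounded above.\<close>
    have "bdd_above (range (\<lambda>v. \<bar>w v\<bar>))" using w_bdd by (auto simp: bounded_iff bdd_above_def)
    then have "\<bar>w v\<bar> \<le> (SUP v. \<bar>w v\<bar>)" by (rule cSUP_upper[OF UNIV_I])
    then show ?thesis using w_sup by simp
  qed
  interpret L: sparse_logistic \<rho> \<psi> \<psi>' M y x emb \<beta>0A w
    using \<rho>_deriv \<psi>_deriv \<psi>'_cont \<psi>_bdd \<psi>'_bdd y_meas x_meas y01 emb model w_meas w_nonneg w_le_1 H3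
    by unfold_locales (auto simp: \<beta>0)
  define V where "V i \<omega> = (Y i \<omega>, X i \<omega>)" for i \<omega>
  define P where "P = distr M borel (\<lambda>\<omega>. (y \<omega>, x \<omega>))"
  interpret S: iid_sample M V P
    using indep ident by unfold_locales (auto simp: V_def[abs_def] P_def)
  have yx[measurable]: "(\<lambda>\<omega>. (y \<omega>, x \<omega>)) \<in> borel_measurable M"
    using y_meas x_meas by (intro borel_measurable_Pair)
  have intP: "(\<integral>v. g v \<partial>P) = (\<integral>\<omega>. g (y \<omega>, x \<omega>) \<partial>M)" if "g \<in> borel_measurable borel" for g :: "real \<times> (real^'p) \<Rightarrow> real"
    unfolding P_def using that by (intro integral_distr) auto
  have integrableP: "integrable P g \<longleftrightarrow> integrable M (\<lambda>\<omega>. g (y \<omega>, x \<omega>))" if "g \<in> borel_measurable borel" for g :: "real \<times> (real^'p) \<Rightarrow> real"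
    unfolding P_def using that by (intro integrable_distr_eq) auto

  \<comment> \<open>The limit covariance and its normal law\<close>
  let ?act = "blockA emb"
  let ?A = "submat emb (mat_A M x \<psi> w \<beta>0)" and ?B = "submat emb (mat_B M x \<psi> w \<beta>0)"
  define Ai where "Ai = matrix_inv ?A"
  have AiA: "Ai ** ?A = mat 1" "?A ** Ai = mat 1"
    unfolding Ai_def by (rule matrix_inv_left[OF A_inv] matrix_inv_right[OF A_inv])+
  have AiT: "transpose Ai = Ai"
  proof -
    have "?A ** transpose Ai = mat 1"
      using arg_cong[OF AiA(1), of transpose] L.A_act_transpose by (simp add: matrix_transpose_mul transpose_mat \<beta>0)
    then show ?thesis using matrix_inv_eqI Ai_def by metis
  qed
  have AiAdj: "t \<bullet> (Ai *v v) = (Ai *v t) \<bullet> v" for t v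
    by (metis AiT dot_lmul_matrix transpose_matrix_vector)
  define \<Sigma> where "\<Sigma> = Ai ** ?B ** Ai"
  have \<Sigma>_bil: "t \<bullet> (\<Sigma> *v t) = (Ai *v t) \<bullet> (?B *v (Ai *v t))" for t
    unfolding \<Sigma>_def by (simp only: matrix_vector_mul_assoc[symmetric] AiAdj)
  have Ai_nz: "Ai *v t \<noteq> 0" if "t \<noteq> 0" for t
  proof
    assume "Ai *v t = 0"
    then have "?A *v (Ai *v t) = 0" by simp
    then show False using that by (simp add: matrix_vector_mul_assoc AiA)
  qed
  have \<Sigma>_pd: "t \<bullet> (\<Sigma> *v t) > 0" if "t \<noteq> 0" for t
    unfolding \<Sigma>_bil using L.B_act_posdef[of "Ai *v t"] Ai_nz[OF that] A_inv by (simp add: \<beta>0)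
  have \<Sigma>_sym: "transpose \<Sigma> = \<Sigma>"
    using L.B_act_transpose by (simp add: \<Sigma>_def matrix_transpose_mul AiT matrix_mul_assoc \<beta>0)
  have N: "prob_space (mvn 0 \<Sigma>)" by (rule prob_space_mvn[OF \<Sigma>_sym \<Sigma>_pd])
  have N_char: "(\<integral>z. iexp (t \<bullet> z) \<partial>mvn 0 \<Sigma>) = complex_of_real (exp (- (t \<bullet> (\<Sigma> *v t)) / 2))" for t
    by (rule char_mvn[OF \<Sigma>_sym \<Sigma>_pd])
  have N_sets: "sets (mvn 0 \<Sigma>) = sets borel" by (simp add: mvn_def)
  obtain c where c: "c > 0" "\<And>v. norm (Ai *v v) \<le> c * norm v"
    using linear_bounded_pos[OF matrix_vector_mul_linear[of Ai]] by (auto simp: mult.commute)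

  \<comment> \<open>The influence function: the rescaled error is asymptotically its normalized sum.\<close>
  define s where "s v = - (L.score (fst v) (?act (snd v) \<bullet> \<beta>0A) * w (snd v)) *\<^sub>R (Ai *v ?act (snd v))" for v
  have Ai_meas[measurable]: "(*v) Ai \<in> borel_measurable borel"
    by (intro borel_measurable_continuous_onI linear_continuous_on) (simp add: linear_linear[symmetric])
  have s_meas[measurable]: "s \<in> borel_measurable borel"
    unfolding s_def[abs_def] borel_prod[symmetric] by measurable
  have ts: "t \<bullet> s v = - (L.score (fst v) (?act (snd v) \<bullet> \<beta>0A) * w (snd v) * ((Ai *v t) \<bullet> ?act (snd v)))" for t v
    by (simp add: s_def AiAdj)
  obtain Cs where Cs: "Cs > 0" "\<And>Y t. \<bar>L.score Y t\<bar> \<le> Cs * (1 + \<bar>Y\<bar>)" "\<And>Y t. \<bar>L.score' Y t\<bar> \<le> Cs * (1 + \<bar>Y\<bar>)"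
    using L.score_bounds by metis
  have s_mean: "(\<integral>v. t \<bullet> s v \<partial>P) = 0" for t
  proof -
    have "(\<integral>v. t \<bullet> s v \<partial>P) = (\<integral>\<omega>. t \<bullet> s (y \<omega>, x \<omega>) \<partial>M)" by (rule intP) measurable
    then show ?thesis using L.score_mean[of "Ai *v t"] by (simp add: ts)
  qed
  have s_var: "(\<integral>v. (t \<bullet> s v)\<^sup>2 \<partial>P) = t \<bullet> (\<Sigma> *v t)" for t
  proof -
    have "(\<integral>v. (t \<bullet> s v)\<^sup>2 \<partial>P) = (\<integral>\<omega>. (t \<bullet> s (y \<omega>, x \<omega>))\<^sup>2 \<partial>M)" by (rule intP) measurable
    then show ?thesis using L.score_second_moment[of "Ai *v t"] by (simp add: ts \<Sigma>_bil \<beta>0)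
  qed
  have s_sq: "integrable P (\<lambda>v. (norm (s v))\<^sup>2)"
  proof (subst integrableP)
    show "(\<lambda>v. (norm (s v))\<^sup>2) \<in> borel_measurable borel" by measurable
    show "integrable M (\<lambda>\<omega>. (norm (s (y \<omega>, x \<omega>)))\<^sup>2)"
    proof (rule L.integrable_score_weight[where C="2 * (Cs * c)\<^sup>2"])
      fix \<omega> assume om: "\<omega> \<in> space M"
      let ?a = "norm (?act (x \<omega>))"
      have "norm (s (y \<omega>, x \<omega>)) \<le> (Cs * (1 + \<bar>y \<omega>\<bar>) * w (x \<omega>)) * (c * ?a)"
        unfolding s_def using Cs(1,2) c w_nonneg by (auto simp: abs_mult intro!: mult_mono)
      then have "(norm (s (y \<omega>, x \<omega>)))\<^sup>2 \<le> ((Cs * (1 + \<bar>y \<omega>\<bar>) * w (x \<omega>)) * (c * ?a))\<^sup>2"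
        by (rule power_mono) simp
      also have "\<dots> = (Cs * c)\<^sup>2 * ((1 + \<bar>y \<omega>\<bar>)\<^sup>2 * ((w (x \<omega>))\<^sup>2 * ?a\<^sup>2))"
        by (simp add: power_mult_distrib mult_ac)
      \<comment> \<open>For y in {0, 1} one factor 1 + |y| is replaced by 2 and one factor w by 1,
        which leaves the shape required by \<open>integrable_score_weight\<close>.\<close>
      also have "\<dots> \<le> (Cs * c)\<^sup>2 * ((2 * (1 + \<bar>y \<omega>\<bar>)) * (w (x \<omega>) * ?a\<^sup>2))"
      proof (intro mult_left_mono mult_mono)
        show "(1 + \<bar>y \<omega>\<bar>)\<^sup>2 \<le> 2 * (1 + \<bar>y \<omega>\<bar>)" using y01 om by (auto simp: power2_eq_square)
        show "(w (x \<omega>))\<^sup>2 \<le> w (x \<omega>)" by (rule L.w_sq_le)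
      qed (use w_nonneg in auto)
      finally show "\<bar>(norm (s (y \<omega>, x \<omega>)))\<^sup>2\<bar> \<le> 2 * (Cs * c)\<^sup>2 * (1 + \<bar>y \<omega>\<bar>) * (w (x \<omega>) * ?a\<^sup>2)"
        by (simp only: abs_power2 mult_ac)
    qed auto
  qed

  \<comment> \<open>Asymptotic normality of the normalized score sum\<close>
  define U where "U n \<omega> = (1 / sqrt (real n)) *\<^sub>R (\<Sum>i=1..n. s (V i \<omega>))" for n \<omega>
  have sV: "(\<lambda>\<omega>. s (V i \<omega>)) \<in> borel_measurable M" if "i \<ge> 1" for i
    using measurable_compose[OF S.V_measurable[OF that] s_meas] .
  have U_meas[measurable]: "U n \<in> borel_measurable M" for n
    unfolding U_def[abs_def] by (intro borel_measurable_scaleR borel_measurable_const borel_measurable_sum sV) auto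
  have U_conv: "(\<lambda>n. \<integral>z. g z \<partial>distr M borel (U n)) \<longlonglongrightarrow> (\<integral>z. g z \<partial>mvn 0 \<Sigma>)"
    if "uniformly_continuous_on UNIV g" "bounded (range g)" for g :: "real^'k \<Rightarrow> real"
  proof (rule char_tendsto_imp_integral_uniformly_continuous[OF _ N _ N_sets _ that])
    fix t
    have "(\<integral>z. iexp (t \<bullet> z) \<partial>distr M borel (U n)) = (\<integral>\<omega>. iexp (t \<bullet> U n \<omega>) \<partial>M)" for n
      by (rule integral_distr) auto
    then show "(\<lambda>n. \<integral>z. iexp (t \<bullet> z) \<partial>distr M borel (U n)) \<longlonglongrightarrow> (\<integral>z. iexp (t \<bullet> z) \<partial>mvn 0 \<Sigma>)"
      using S.clt_char[OF s_meas s_sq s_mean, of t] \<Sigma>_pd unfolding U_def s_var N_char by simp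
  qed (auto intro: prob_space_distr)

  \<comment> \<open>The rescaled error and its distance from the sum\<close>
  define T where "T n \<omega> = sqrt (real n) *\<^sub>R (?act (\<beta>hat n \<omega>) - \<beta>0A)" for n \<omega>
  have T_meas: "T n \<in> borel_measurable M" for n
  proof (cases "n \<ge> 1")
    case True
    then have [measurable]: "\<beta>hat n \<in> borel_measurable M" using \<beta>hat_meas by simp
    show ?thesis unfolding T_def[abs_def] by measurable
  next
    \<comment> \<open>Measurability of the estimator is given only from n = 1 on; at n = 0 the
      factor sqrt 0 makes \<open>T\<close> constant.\<close>
    case False
    then have "n = 0" by simp
    then show ?thesis by (simp add: T_def[abs_def])
  qed
  obtain C where C: "C > 0"
    "\<And>Y s t. \<bar>L.score Y s - L.score Y t - L.score' Y t * (s - t)\<bar> \<le> C * (1 + \<bar>Y\<bar>) * \<bar>s - t\<bar>"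
    "\<And>\<eta> T. \<eta> > 0 \<Longrightarrow> \<exists>r>0. \<forall>Y s t. \<bar>t\<bar> \<le> T \<longrightarrow> \<bar>s - t\<bar> \<le> r \<longrightarrow>
        \<bar>L.score Y s - L.score Y t - L.score' Y t * (s - t)\<bar> \<le> \<eta> * (1 + \<bar>Y\<bar>) * \<bar>s - t\<bar>"
    using L.score_remainder by blast

  have "converges_in_distr M T (mvn 0 \<Sigma>)"
  proof (rule converges_in_distr_slutsky[OF prob N N_sets T_meas U_meas U_conv])
    fix \<tau> e :: real assume \<tau>: "\<tau> > 0" and e: "e > 0"
    \<comment> \<open>Five exceptional events, each of probability below e / 6, leave a strict
      margin.\<close>
    define e6 where "e6 = e / 6"
    have e6: "e6 > 0" using e by (simp add: e6_def)
    obtain K where K: "K > 0" "\<forall>\<^sub>F n in sequentially. measure M {\<omega>\<in>space M. norm (U n \<omega>) \<ge> K} < e6"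
      using uniformly_continuous_convergence_imp_tight[OF prob N N_sets U_meas U_conv e6] by blast
    \<comment> \<open>Tolerance for sqrt n times the penalty gradient: c \<open>\<zeta>\<close> at
      most 1 enters the bound on \<open>T\<close>, and at most \<open>\<tau>\<close> / 4 is its
      share of the final distance.\<close>
    define \<zeta> where "\<zeta> = min 1 (\<tau> / 4) / c"
    have \<zeta>: "\<zeta> > 0" "c * \<zeta> \<le> 1" "c * \<zeta> \<le> \<tau> / 4" using \<tau> c(1) by (auto simp: \<zeta>_def)
    \<comment> \<open>Coefficient of the norm of \<open>T\<close> in the linearization error. The
      bound c \<open>\<theta>\<close> at most 1/2 allows absorption and gives norm at most 2 (K + 1)
      for \<open>T\<close>; the other term in the minimum makes the resulting error at most
      \<open>\<tau>\<close> / 4.\<close>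
    define \<theta> where "\<theta> = min (1 / 2) (\<tau> / (8 * (K + 1))) / c"
    have \<theta>: "\<theta> > 0" "c * \<theta> \<le> 1 / 2" "c * \<theta> * (2 * (K + 1)) \<le> \<tau> / 4"
    proof -
      have ct: "c * \<theta> = min (1 / 2) (\<tau> / (8 * (K + 1)))" using c(1) by (simp add: \<theta>_def)
      show "\<theta> > 0" using \<tau> c(1) K(1) by (auto simp: \<theta>_def)
      show "c * \<theta> \<le> 1 / 2" unfolding ct by (rule min.cobounded1)
      have "c * \<theta> \<le> \<tau> / (8 * (K + 1))" unfolding ct by (rule min.cobounded2)
      then have "c * \<theta> * (2 * (K + 1)) \<le> \<tau> / (8 * (K + 1)) * (2 * (K + 1))" using K(1) by (intro mult_right_mono) auto
      also have "\<dots> = \<tau> / 4" using K(1) by (simp add: field_simps)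
      finally show "c * \<theta> * (2 * (K + 1)) \<le> \<tau> / 4" .
    qed
    define k2 where "k2 = (real CARD('k))\<^sup>2"
    have k2: "k2 > 0" by (simp add: k2_def)
    \<comment> \<open>Half of \<open>\<theta>\<close> is spent on the matrix error, bounded by k2
      times the entrywise tolerance; the other half is kept for the Taylor remainder.\<close>
    define \<kappa> where "\<kappa> = \<theta> / 2 / k2"
    have \<kappa>: "\<kappa> > 0" "k2 * \<kappa> = \<theta> / 2" using \<theta>(1) k2 by (auto simp: \<kappa>_def)

    \<comment> \<open>Truncating the covariates at \<open>R\<close> replaces a uniform law of large numbers: below \<open>R\<close> the score
      derivative has a common modulus of continuity, above \<open>R\<close> the second moment is small.\<close>
    let ?q = "\<lambda>v. (1 + \<bar>fst v\<bar>) * (w (snd v) * (norm (?act (snd v)))\<^sup>2)"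
    have q_meas[measurable]: "?q \<in> borel_measurable borel" unfolding borel_prod[symmetric] by measurable
    have q_nn: "?q v \<ge> 0" for v using w_nonneg by simp
    have q_int: "integrable P ?q"
      by (subst integrableP[OF q_meas], rule L.integrable_score_weight[where C=1]) (use w_nonneg in auto)
    obtain R where R: "C * (\<integral>v. ?q v * indicator {v. norm (?act (snd v)) > real R} v \<partial>P) < e6 * (\<theta> / 2) / 2"
    proof -
      have "(\<lambda>R. \<integral>v. ?q v * indicator {v. norm (?act (snd v)) > real R} v \<partial>P) \<longlonglongrightarrow> (\<integral>v. 0 \<partial>P)"
      proof (rule integral_dominated_convergence[where w="?q"])
        show "AE v in P. (\<lambda>R. ?q v * indicator {v. norm (?act (snd v)) > real R} v) \<longlonglongrightarrow> 0"
        proof (rule AE_I2)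
          fix v :: "real \<times> (real^'p)"
          obtain k0 where "norm (?act (snd v)) < real k0" using reals_Archimedean2 by blast
          then have "\<forall>\<^sub>F R in sequentially. ?q v * indicator {v. norm (?act (snd v)) > real R} v = 0"
            by (intro eventually_sequentiallyI[of k0]) auto
          then show "(\<lambda>R. ?q v * indicator {v. norm (?act (snd v)) > real R} v) \<longlonglongrightarrow> 0" by (rule tendsto_eventually)
        qed
        show "(\<lambda>v. ?q v * indicator {v. norm (?act (snd v)) > real R} v) \<in> borel_measurable P" for R
          unfolding P_def borel_prod[symmetric] by measurable
        show "AE v in P. norm (?q v * indicator {v. norm (?act (snd v)) > real R} v) \<le> ?q v" for R
          using q_nn by (auto simp: indicator_def simp del: mult_nonneg_nonneg)
      qed (use q_int in auto)
      then have "(\<lambda>R. C * (\<integral>v. ?q v * indicator {v. norm (?act (snd v)) > real R} v \<partial>P)) \<longlonglongrightarrow> C * 0"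
        by (intro tendsto_mult_left) simp
      then have "\<forall>\<^sub>F R in sequentially. C * (\<integral>v. ?q v * indicator {v. norm (?act (snd v)) > real R} v \<partial>P) < e6 * (\<theta> / 2) / 2"
        by (rule order_tendstoD(2)) (use e6 \<theta> in simp)
      then show ?thesis using that eventually_happens'[OF sequentially_bot] by blast
    qed
    \<comment> \<open>Markov's inequality at level \<open>\<theta>\<close> / 2 needs a mean below
      \<open>e6 * (\<theta> / 2)\<close>. Covariates inside the ball receive half of this budget,
      those outside the other half through \<open>R\<close>; the 1 in the divisor excludes division
      by zero.\<close>
    define \<eta> where "\<eta> = e6 * (\<theta> / 2) / 2 / (1 + (\<integral>v. ?q v \<partial>P))"
    have q_int_nn: "(\<integral>v. ?q v \<partial>P) \<ge> 0" using q_nn by (intro integral_nonneg_AE) auto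
    have \<eta>: "\<eta> > 0" using e6 \<theta> q_int_nn by (simp add: \<eta>_def)
    have \<eta>q: "\<eta> * (\<integral>v. ?q v \<partial>P) \<le> e6 * (\<theta> / 2) / 2"
    proof -
      have "\<eta> * (\<integral>v. ?q v \<partial>P) \<le> \<eta> * (1 + (\<integral>v. ?q v \<partial>P))" using \<eta> by (intro mult_left_mono) auto
      also have "\<dots> = e6 * (\<theta> / 2) / 2" unfolding \<eta>_def using q_int_nn by (intro nonzero_eq_divide_eq[THEN iffD1]) auto
      finally show ?thesis .
    qed
    obtain r where r: "r > 0" "\<And>Y s t. \<bar>t\<bar> \<le> real R * norm \<beta>0A \<Longrightarrow> \<bar>s - t\<bar> \<le> r \<Longrightarrow>
        \<bar>L.score Y s - L.score Y t - L.score' Y t * (s - t)\<bar> \<le> \<eta> * (1 + \<bar>Y\<bar>) * \<bar>s - t\<bar>"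
      using C(3)[OF \<eta>, of "real R * norm \<beta>0A"] by blast
    \<comment> \<open>Taylor coefficient of an observation: the small modulus inside the ball, the
      global constant outside. Its weighted version \<open>M5\<close> below is averaged in the fifth
      event.\<close>
    define m where "m v = (if norm (?act (snd v)) \<le> real R then \<eta> else C) * (1 + \<bar>fst v\<bar>)" for v
    have m_nn: "m v \<ge> 0" for v using \<eta> C(1) by (simp add: m_def)
    define M5 where "M5 v = m v * (w (snd v) * (norm (?act (snd v)))\<^sup>2)" for v
    have M5_meas: "M5 \<in> borel_measurable borel"
      unfolding M5_def[abs_def] m_def[abs_def] borel_prod[symmetric] by measurable
    have M5_le: "M5 v \<le> \<eta> * ?q v + C * (?q v * indicator {v. norm (?act (snd v)) > real R} v)" for v
    proof (cases "norm (?act (snd v)) \<le> real R")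
      case True
      then show ?thesis by (simp add: M5_def m_def mult_ac)
    next
      case False
      have "\<eta> * ?q v \<ge> 0" using q_nn[of v] \<eta> by simp
      then show ?thesis using False by (simp add: M5_def m_def mult_ac)
    qed
    have M5_nn: "M5 v \<ge> 0" for v using m_nn w_nonneg by (simp add: M5_def)
    have qR_int: "integrable P (\<lambda>v. ?q v * indicator {v. norm (?act (snd v)) > real R} v)"
    proof (rule Bochner_Integration.integrable_bound[OF q_int])
      show "(\<lambda>v. ?q v * indicator {v. norm (?act (snd v)) > real R} v) \<in> borel_measurable P"
        unfolding P_def borel_prod[symmetric] by measurable
    qed (auto simp: indicator_def)
    have M5_int: "integrable P M5"
    proof (rule Bochner_Integration.integrable_bound)
      show "integrable P (\<lambda>v. \<eta> * ?q v + C * (?q v * indicator {v. norm (?act (snd v)) > real R} v))"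
        using q_int qR_int by (intro Bochner_Integration.integrable_add integrable_mult_right)
      show "M5 \<in> borel_measurable P" using M5_meas by (simp add: P_def)
      show "AE v in P. norm (M5 v) \<le> norm (\<eta> * ?q v + C * (?q v * indicator {v. norm (?act (snd v)) > real R} v))"
      proof (rule AE_I2)
        show "norm (M5 v) \<le> norm (\<eta> * ?q v + C * (?q v * indicator {v. norm (?act (snd v)) > real R} v))" for v
          using M5_le[of v] M5_nn[of v] unfolding real_norm_def by linarith
      qed
    qed
    have M5_small: "(\<integral>v. M5 v \<partial>P) < e6 * (\<theta> / 2)"
    proof -
      have "(\<integral>v. M5 v \<partial>P) \<le> (\<integral>v. \<eta> * ?q v + C * (?q v * indicator {v. norm (?act (snd v)) > real R} v) \<partial>P)"
        using q_int qR_int M5_le M5_int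
        by (intro integral_mono Bochner_Integration.integrable_add integrable_mult_right)
      also have "\<dots> = \<eta> * (\<integral>v. ?q v \<partial>P) + C * (\<integral>v. ?q v * indicator {v. norm (?act (snd v)) > real R} v \<partial>P)"
        by (simp only: Bochner_Integration.integral_add[OF integrable_mult_right[OF q_int] integrable_mult_right[OF qR_int]] integral_mult_right_zero)
      finally show ?thesis using R \<eta>q by linarith
    qed
    \<comment> \<open>The first bound keeps the estimator where the penalty gradient is controlled,
      the second keeps the predictor within \<open>r\<close> of its true value for covariates of
      norm at most R. R may be 0, hence R + 1.\<close>
    define \<epsilon> where "\<epsilon> = min (\<delta> / 2) (r / (real R + 1))"
    have \<epsilon>: "\<epsilon> > 0" "\<epsilon> < \<delta>" "real R * \<epsilon> \<le> r"
    proof -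
      show "\<epsilon> > 0" "\<epsilon> < \<delta>" using \<delta>_pos r(1) by (auto simp: \<epsilon>_def min_less_iff_disj)
      have "real R * \<epsilon> \<le> (real R + 1) * (r / (real R + 1))"
        using r(1) \<delta>_pos by (intro mult_mono) (auto simp: \<epsilon>_def)
      then show "real R * \<epsilon> \<le> r" by simp
    qed

    \<comment> \<open>The exceptional events and their probabilities\<close>
    define D where "D i j n \<omega> = \<bar>(\<Sum>l=1..n. L.score' (Y l \<omega>) (?act (X l \<omega>) \<bullet> \<beta>0A) * w (X l \<omega>) * (?act (X l \<omega>) $ i * ?act (X l \<omega>) $ j)) / real n - ?A $ i $ j\<bar>"
      for i j n \<omega>
    define Q where "Q n ij = {\<omega>\<in>space M. D (fst ij) (snd ij) n \<omega> \<ge> \<kappa>}" for n ij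
    let ?E1 = "\<lambda>n. {\<omega>\<in>space M. \<not> (\<forall>j. j \<notin> range emb \<longrightarrow> \<beta>hat n \<omega> $ j = 0)}"
    let ?E2 = "\<lambda>n. {\<omega>\<in>space M. dist (\<beta>hat n \<omega>) \<beta>0 > \<epsilon>}"
    let ?E3 = "\<lambda>n. {\<omega>\<in>space M. norm (U n \<omega>) \<ge> K}"
    let ?E4 = "\<lambda>n. \<Union>ij\<in>UNIV. Q n ij"
    let ?E5 = "\<lambda>n. {\<omega>\<in>space M. (\<Sum>l=1..n. M5 (V l \<omega>)) / real n \<ge> \<theta> / 2}"

    have P1: "\<forall>\<^sub>F n in sequentially. ?E1 n \<in> sets M \<and> prob (?E1 n) < e6"
    proof -
      have "\<forall>\<^sub>F n in sequentially. measure M {\<omega> \<in> space M. \<forall>j. j \<notin> range emb \<longrightarrow> \<beta>hat n \<omega> $ j = 0} > 1 - e6"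
        using sparse by (rule order_tendstoD(1)) (use e6 in simp)
      then show ?thesis using eventually_ge_at_top[of 1]
      proof eventually_elim
        case (elim n)
        have [measurable]: "\<beta>hat n \<in> borel_measurable M" using \<beta>hat_meas elim(2) by simp
        have m: "{\<omega> \<in> space M. \<forall>j. j \<notin> range emb \<longrightarrow> \<beta>hat n \<omega> $ j = 0} \<in> sets M" by measurable
        have eq: "?E1 n = space M - {\<omega> \<in> space M. \<forall>j. j \<notin> range emb \<longrightarrow> \<beta>hat n \<omega> $ j = 0}" by auto
        show ?case using m elim(1) unfolding eq prob_compl[OF m] by auto
      qed
    qed
    have P2: "\<forall>\<^sub>F n in sequentially. ?E2 n \<in> sets M \<and> prob (?E2 n) < e6"
    proof -
      have "(\<lambda>n. measure M (?E2 n)) \<longlonglongrightarrow> 0"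
        using consistent \<epsilon>(1) unfolding converges_in_prob_def by blast
      then have "\<forall>\<^sub>F n in sequentially. prob (?E2 n) < e6" using e6 by (rule order_tendstoD(2))
      then show ?thesis using eventually_ge_at_top[of 1]
      proof eventually_elim
        case (elim n)
        have [measurable]: "\<beta>hat n \<in> borel_measurable M" using \<beta>hat_meas elim(2) by simp
        have "?E2 n \<in> sets M" by measurable
        then show ?case using elim(1) by simp
      qed
    qed
    have P3: "\<forall>\<^sub>F n in sequentially. ?E3 n \<in> sets M \<and> prob (?E3 n) < e6"
      using K(2) by (auto elim!: eventually_mono)
    have P4: "\<forall>\<^sub>F n in sequentially. ?E4 n \<in> sets M \<and> prob (?E4 n) < e6"
    proof -
      \<comment> \<open>A union bound over the k2 pairs of indices follows; the + 1 makes the sum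
        strictly smaller than \<open>e6\<close>.\<close>
      have D_ij: "\<forall>\<^sub>F n in sequentially. {\<omega>\<in>space M. D i j n \<omega> \<ge> \<kappa>} \<in> sets M \<and> prob {\<omega>\<in>space M. D i j n \<omega> \<ge> \<kappa>} < e6 / (k2 + 1)" for i j
      proof -
        let ?h = "\<lambda>v. L.score' (fst v) (?act (snd v) \<bullet> \<beta>0A) * w (snd v) * (?act (snd v) $ i * ?act (snd v) $ j)"
        have h[measurable]: "?h \<in> borel_measurable borel" unfolding borel_prod[symmetric] by measurable
        have hi: "integrable P ?h"
        proof (subst integrableP[OF h], rule L.integrable_score_weight[where C=Cs])
          fix \<omega>
          have "\<bar>?act (x \<omega>) $ i * ?act (x \<omega>) $ j\<bar> \<le> norm (?act (x \<omega>)) * norm (?act (x \<omega>))"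
            unfolding abs_mult by (intro mult_mono) (auto simp: component_le_norm_cart)
          then have "\<bar>L.score' (y \<omega>) (?act (x \<omega>) \<bullet> \<beta>0A)\<bar> * (w (x \<omega>) * \<bar>?act (x \<omega>) $ i * ?act (x \<omega>) $ j\<bar>)
             \<le> Cs * (1 + \<bar>y \<omega>\<bar>) * (w (x \<omega>) * (norm (?act (x \<omega>)))\<^sup>2)"
            using Cs w_nonneg by (intro mult_mono mult_left_mono) (auto simp: power2_eq_square)
          then show "\<bar>?h (y \<omega>, x \<omega>)\<bar> \<le> Cs * (1 + \<bar>y \<omega>\<bar>) * (w (x \<omega>) * (norm (?act (x \<omega>)))\<^sup>2)"
            using w_nonneg by (simp add: abs_mult mult.assoc)
        qed (use Cs in auto)
        have hP: "(\<integral>v. ?h v \<partial>P) = ?A $ i $ j"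
          unfolding intP[OF h] using L.score'_moment[of i j] by (simp add: \<beta>0)
        have "(\<lambda>n. prob {\<omega>\<in>space M. D i j n \<omega> \<ge> \<kappa>}) \<longlonglongrightarrow> 0"
          using S.weak_law_of_large_numbers[OF h hi \<kappa>(1)] unfolding hP by (simp add: V_def D_def)
        then have "\<forall>\<^sub>F n in sequentially. prob {\<omega>\<in>space M. D i j n \<omega> \<ge> \<kappa>} < e6 / (k2 + 1)"
          by (rule order_tendstoD(2)) (use e6 k2 in simp)
        moreover have "{\<omega>\<in>space M. D i j n \<omega> \<ge> \<kappa>} \<in> sets M" for n
        proof -
          have "(\<lambda>\<omega>. ?h (V l \<omega>)) \<in> borel_measurable M" if "l \<in> {1..n}" for l
            using measurable_compose[OF S.V_measurable h] that by simp
          then have "(\<lambda>\<omega>. \<Sum>l=1..n. ?h (V l \<omega>)) \<in> borel_measurable M" by (rule borel_measurable_sum)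
          then have "(\<lambda>\<omega>. \<bar>(\<Sum>l=1..n. ?h (V l \<omega>)) / real n - ?A $ i $ j\<bar>) \<in> borel_measurable M" by measurable
          then have [measurable]: "D i j n \<in> borel_measurable M" by (simp add: V_def D_def[abs_def])
          show ?thesis by measurable
        qed
        ultimately show ?thesis by simp
      qed
      have "\<forall>\<^sub>F n in sequentially. \<forall>ij\<in>(UNIV :: ('k \<times> 'k) set). Q n ij \<in> sets M \<and> prob (Q n ij) < e6 / (k2 + 1)"
        unfolding Q_def by (intro eventually_ball_finite ballI finite D_ij)
      then show ?thesis
      proof eventually_elim
        case (elim n)
        have Q: "Q n ij \<in> sets M" "prob (Q n ij) < e6 / (k2 + 1)" for ij
          using bspec[OF elim UNIV_I, of ij] by simp_all
        have "prob (\<Union>ij\<in>UNIV. Q n ij) \<le> (\<Sum>ij\<in>UNIV. prob (Q n ij))"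
          by (intro measure_UNION_le finite Q)
        also have "\<dots> \<le> (\<Sum>ij\<in>(UNIV :: ('k \<times> 'k) set). e6 / (k2 + 1))"
          by (intro sum_mono less_imp_le Q)
        also have "\<dots> = k2 * (e6 / (k2 + 1))"
          by (simp add: k2_def power2_eq_square card_cartesian_product flip: UNIV_Times_UNIV)
        also have "\<dots> < e6" using e6 k2 by (simp add: field_simps)
        finally show ?case using Q(1) by (auto intro: sets.finite_UN)
      qed
    qed
    \<comment> \<open>The Markov bound is free of \<open>n\<close>, so this event is controlled at
      every sample size.\<close>
    have P5: "?E5 n \<in> sets M \<and> prob (?E5 n) < e6" for n
    proof
      have "prob (?E5 n) \<le> (\<integral>v. M5 v \<partial>P) / (\<theta> / 2)"
        by (rule S.prob_average_ge[OF M5_meas M5_int M5_nn]) (use \<theta> in simp)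
      also have "\<dots> < e6" using M5_small \<theta>(1) by (simp add: pos_divide_less_eq)
      finally show "prob (?E5 n) < e6" .
      have "(\<lambda>\<omega>. M5 (V l \<omega>)) \<in> borel_measurable M" if "l \<in> {1..n}" for l
        using measurable_compose[OF S.V_measurable M5_meas] that by simp
      then have [measurable]: "(\<lambda>\<omega>. \<Sum>l=1..n. M5 (V l \<omega>)) \<in> borel_measurable M" by (rule borel_measurable_sum)
      show "?E5 n \<in> sets M" by measurable
    qed
    have Pen: "\<forall>\<^sub>F n in sequentially. \<forall>b\<in>cball \<beta>0A \<delta>. sqrt (real n) * norm (grad (\<lambda>b. I (lam n) (zero_pad emb b)) b) \<le> \<zeta>"
    proof -
      have "\<forall>\<^sub>F n in sequentially. norm (SUP b\<in>cball \<beta>0A \<delta>. norm (grad (\<lambda>b. I (lam n) (zero_pad emb b)) b)) \<le> \<zeta> * norm (1 / sqrt (real n))"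
        using landau_o.smallD[OF I_grad_small \<zeta>(1)] .
      then show ?thesis using I_grad_bdd eventually_ge_at_top[of 1]
      proof eventually_elim
        case (elim n)
        show ?case
        proof
          fix b assume b: "b \<in> cball \<beta>0A \<delta>"
          \<comment> \<open>\<open>I_grad_bdd\<close> is what makes the supremum an upper bound for
            the individual gradients.\<close>
          have "norm (grad (\<lambda>b. I (lam n) (zero_pad emb b)) b) \<le> (SUP b\<in>cball \<beta>0A \<delta>. norm (grad (\<lambda>b. I (lam n) (zero_pad emb b)) b))"
            by (rule cSUP_upper[OF b elim(2)])
          also have "\<dots> \<le> \<zeta> * (1 / sqrt (real n))" using elim(1) by simp
          finally have "sqrt (real n) * norm (grad (\<lambda>b. I (lam n) (zero_pad emb b)) b) \<le> sqrt (real n) * (\<zeta> * (1 / sqrt (real n)))"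
            by (intro mult_left_mono) auto
          also have "\<dots> = \<zeta>" using elim(3) by simp
          finally show "sqrt (real n) * norm (grad (\<lambda>b. I (lam n) (zero_pad emb b)) b) \<le> \<zeta>" .
        qed
      qed
    qed

    \<comment> \<open>The deterministic estimate outside the exceptional events\<close>
    show "\<forall>\<^sub>F n in sequentially. measure M {\<omega>\<in>space M. dist (T n \<omega>) (U n \<omega>) \<ge> \<tau>} < e"
      using P1 P2 P3 P4 Pen eventually_ge_at_top[of 1]
    proof eventually_elim
      case (elim n)
      have "{\<omega>\<in>space M. dist (T n \<omega>) (U n \<omega>) \<ge> \<tau>} \<subseteq> ?E1 n \<union> ?E2 n \<union> ?E3 n \<union> ?E4 n \<union> ?E5 n"
      proof (rule subsetI, rule ccontr)
        fix \<omega> assume om: "\<omega> \<in> {\<omega>\<in>space M. dist (T n \<omega>) (U n \<omega>) \<ge> \<tau>}"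
          and no: "\<omega> \<notin> ?E1 n \<union> ?E2 n \<union> ?E3 n \<union> ?E4 n \<union> ?E5 n"
        have sp: "\<omega> \<in> space M" using om by simp
        have g1: "\<beta>hat n \<omega> $ j = 0" if "j \<notin> range emb" for j using no sp that by blast
        have g2: "dist (\<beta>hat n \<omega>) \<beta>0 \<le> \<epsilon>" using no sp by auto
        have g3: "norm (U n \<omega>) < K" using no sp by auto
        have g4: "D i j n \<omega> \<le> \<kappa>" for i j
        proof -
          have "\<omega> \<notin> Q n (i, j)" using no by blast
          then show ?thesis using sp by (simp add: Q_def)
        qed
        have g5: "(\<Sum>l=1..n. M5 (V l \<omega>)) / real n \<le> \<theta> / 2" using no sp by auto
        define h where "h = ?act (\<beta>hat n \<omega>) - \<beta>0A"
        let ?b = "\<beta>0A + h"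
        have bh: "\<beta>hat n \<omega> = zero_pad emb ?b" using zero_pad_blockA[OF emb g1] by (simp add: h_def)
        have nh: "norm h \<le> \<epsilon>"
        proof -
          have "h = ?act (\<beta>hat n \<omega> - \<beta>0)" by (simp add: h_def blockA_diff \<beta>0 blockA_zero_pad[OF emb])
          then show ?thesis using norm_blockA_le[OF emb, of "\<beta>hat n \<omega> - \<beta>0"] g2 by (simp add: dist_norm)
        qed
        have bb: "?b \<in> cball \<beta>0A \<delta>" using nh \<epsilon>(2) by (simp add: dist_norm)
        define p where "p = grad (\<lambda>b. I (lam n) (zero_pad emb b)) ?b"
        have np: "sqrt (real n) * norm p \<le> \<zeta>" using elim(5) bb by (simp add: p_def)
        have fo: "(1 / real n) *\<^sub>R (\<Sum>l=1..n. (L.score (Y l \<omega>) (?act (X l \<omega>) \<bullet> (\<beta>0A + h)) * w (X l \<omega>)) *\<^sub>R ?act (X l \<omega>)) = - p"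
          unfolding p_def
          by (rule L.penalized_first_order[OF emb]) (use \<beta>hat_min I_grad bb elim(6) sp in \<open>simp_all add: bh[symmetric]\<close>)
        have rem: "\<bar>L.score (Y l \<omega>) (?act (X l \<omega>) \<bullet> (\<beta>0A + h)) - L.score (Y l \<omega>) (?act (X l \<omega>) \<bullet> \<beta>0A) - L.score' (Y l \<omega>) (?act (X l \<omega>) \<bullet> \<beta>0A) * (?act (X l \<omega>) \<bullet> h)\<bar>
          \<le> m (V l \<omega>) * \<bar>?act (X l \<omega>) \<bullet> h\<bar>" for l
        proof -
          let ?a = "?act (X l \<omega>)"
          have df: "?a \<bullet> (\<beta>0A + h) - ?a \<bullet> \<beta>0A = ?a \<bullet> h" by (simp add: inner_add_right)
          show ?thesis
          proof (cases "norm ?a \<le> real R")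
            case True
            have t: "\<bar>?a \<bullet> \<beta>0A\<bar> \<le> real R * norm \<beta>0A"
              using order_trans[OF Cauchy_Schwarz_ineq2 mult_right_mono[OF True norm_ge_zero]] .
            have "\<bar>?a \<bullet> h\<bar> \<le> real R * \<epsilon>"
              by (rule order_trans[OF Cauchy_Schwarz_ineq2]) (intro mult_mono True nh, auto)
            then show ?thesis
              using r(2)[OF t, of "?a \<bullet> (\<beta>0A + h)" "Y l \<omega>"] True \<epsilon>(3) unfolding df by (simp add: m_def V_def)
          next
            case False
            then show ?thesis
              using C(2)[of "Y l \<omega>" "?a \<bullet> (\<beta>0A + h)" "?a \<bullet> \<beta>0A"] unfolding df by (simp add: m_def V_def)
          qed
        qed
        have U_eq: "(1 / sqrt (real n)) *\<^sub>R (\<Sum>l=1..n. - (L.score (Y l \<omega>) (?act (X l \<omega>) \<bullet> \<beta>0A) * w (X l \<omega>)) *\<^sub>R (Ai *v ?act (X l \<omega>))) = U n \<omega>"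
          by (simp add: U_def s_def V_def)
        have "norm (sqrt (real n) *\<^sub>R h - U n \<omega>) \<le> c * (sqrt (real n) * norm p + (k2 * \<kappa> + \<theta> / 2) * norm (sqrt (real n) *\<^sub>R h))"
          unfolding U_eq[symmetric] k2_def
        proof (rule L.linearized_estimating_equation[OF elim(6) AiA(1) c(2) _ _ fo g4[unfolded D_def] rem m_nn])
          show "(\<Sum>l=1..n. m (V l \<omega>) * (w (X l \<omega>) * (norm (?act (X l \<omega>)))\<^sup>2)) / real n \<le> \<theta> / 2"
            using g5 by (simp add: M5_def V_def)
        qed (use c w_nonneg in auto)
        also have "sqrt (real n) *\<^sub>R h = T n \<omega>" by (simp add: T_def h_def)
        also have "k2 * \<kappa> + \<theta> / 2 = \<theta>" by (simp add: \<kappa>(2))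
        finally have d: "norm (T n \<omega> - U n \<omega>) \<le> c * (sqrt (real n) * norm p + \<theta> * norm (T n \<omega>))" .
        have "c * (sqrt (real n) * norm p) \<le> c * \<zeta>" using np c(1) by (intro mult_left_mono) auto
        then have d1: "norm (T n \<omega> - U n \<omega>) \<le> c * \<zeta> + c * \<theta> * norm (T n \<omega>)" using d by (simp add: distrib_left mult.assoc)
        have "c * \<theta> * norm (T n \<omega>) \<le> 1 / 2 * norm (T n \<omega>)" using \<theta>(2) by (intro mult_right_mono) auto
        \<comment> \<open>Absorption: the norm of \<open>T\<close> is at most K + 1 plus half of
          itself. Here the root-n rate emerges, starting from mere consistency.\<close>
        moreover have "t \<le> 2 * (k + 1)" if "x \<le> 1 / 2 * t" "d \<le> z + x" "u < k" "z \<le> 1" "t \<le> u + d" for t u d z x k :: real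
          using that by (simp add: field_simps)
        ultimately have "norm (T n \<omega>) \<le> 2 * (K + 1)"
          using d1 g3 \<zeta>(2) norm_triangle_sub[of "T n \<omega>" "U n \<omega>"] by blast
        then have "c * \<theta> * norm (T n \<omega>) \<le> c * \<theta> * (2 * (K + 1))" using \<theta>(1) c(1) by (intro mult_left_mono) auto
        \<comment> \<open>Penalty and linearization contribute at most \<open>\<tau>\<close> / 4
          each.\<close>
        then have "norm (T n \<omega> - U n \<omega>) < \<tau>" using d1 \<zeta>(3) \<theta>(3) \<tau> by linarith
        then show False using om by (simp add: dist_norm)
      qed
      then have "measure M {\<omega>\<in>space M. dist (T n \<omega>) (U n \<omega>) \<ge> \<tau>} \<le> prob (?E1 n \<union> ?E2 n \<union> ?E3 n \<union> ?E4 n \<union> ?E5 n)"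
        using elim P5[of n] by (intro finite_measure_mono) (auto simp del: UN_iff)
      also have "\<dots> \<le> prob (?E1 n) + prob (?E2 n) + prob (?E3 n) + prob (?E4 n) + prob (?E5 n)"
        using elim P5[of n]
        by (intro order_trans[OF measure_Un_le] add_mono order_refl sets.Un) blast+
      also have "\<dots> < e" using elim P5[of n] e unfolding e6_def by linarith
      finally show ?case .
    qed
  qed
  then show ?thesis unfolding T_def[abs_def] \<Sigma>_def Ai_def .
qed

end
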